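(* Let $\mathcal L$ be the set of covectors of an oriented matroid of rank $n$ with no loops on a finite ground set $E$, and let $\mathcal C$ be a polyhedral complex in $\mathcal L$ such that $\operatorname{Supp}(\mathcal C)$ is a polyhedron. Then a subset $\mathcal E$ of the edges of the adjacency graph $\mathcal G$ of $\mathcal C$ is the edge set of a polyhedral complex coarsening $\mathcal C$ if and only if $\mathcal E$ has the polygon property.
   Context: $\mathcal L\subseteq\{+,-,0\}^E$ is ordered as the face lattice ($X\le Y$ iff $X_e\in\{0,Y_e\}$ for all $e$); rank of a covector is its rank in this poset. Closed halfspaces: $H_e^+$ (covectors with $X_e\in\{+,0\}$), $H_e^-$ ($X_e\in\{-,0\}$); hyperplane $H_e=H_e^+\cap H_e^-$. A polyhedron is an intersection of closed halfspaces; its rank is that of its maximal covectors. An accessible face of $P$ is $P\cap H_e$ for $e$ with $P\subseteq H_e^\pm$; a face is an intersection of accessible faces (empty intersection $=P$). A polyhedral complex in $\mathcal L$ is a finite nonempty collection of polyhedra closed under faces in which any two members intersect in a face of each; $\operatorname{Supp}$ is the union of members. A complex $\mathcal C'$ coarsens $\mathcal C$ if they have the same support and every face of $\mathcal C'$ is a union of faces of $\mathcal C$. The adjacency graph $\mathcal G$ has as vertices the rank-$n$ faces of $\mathcal C$, with $M$---$N$ an edge when $M\cap N$ has rank $n-1$; the edge set of a coarsening $\mathcal C'$ is the set of edges $M$---$N$ with $M,N$ in a common face of $\mathcal C'$. The boundary of an order ideal $U\subseteq\mathcal L$ is the set of $X\in U$ whose principal order filter is not contained in $U$. For each face $F$ of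 $\mathcal C$ of rank $n-2$ not contained in the boundary of $\operatorname{Supp}(\mathcal C)$, the rank-$n$ faces of $\mathcal C$ containing $F$ form a cycle $\mathcal P_F$ in $\mathcal G$ (a polygon). Let $\operatorname{Perp}(F)$ be the rank-2 oriented matroid obtained from $\mathcal L$ by deleting all $e\in E$ with $F\not\subseteq H_e$ (covectors: restrictions of covectors of $\mathcal L$ to $E_F=\{e:F\subseteq H_e\}$). For each $M\in\mathcal P_F$ let $\sigma_M=\{X|_{E_F}:X\in M\}$; the $\sigma_M$ and their faces form a complex $\mathcal C|_F$ in $\operatorname{Perp}(F)$ (a complete fan, as rank-2 oriented matroids are realizable), with adjacency graph identified with $\mathcal P_F$ via $M\mapsto\sigma_M$. $\mathcal E$ has the polygon property if, for every such $F$, the edges of $\mathcal E$ in $\mathcal P_F$ form (under this identification) the edge set of some complex in $\operatorname{Perp}(F)$ coarsening $\mathcal C|_F$. *)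

theory Defs
  imports Main
begin

datatype sign = Zero | Plus | Minus

fun sign_neg :: "sign \<Rightarrow> sign" where
  "sign_neg Zero = Zero"
| "sign_neg Plus = Minus"
| "sign_neg Minus = Plus"

(* Sign vectors on a ground set E are total functions that vanish outside E,
   as required by the first conjunct on L in oriented_matroid below. *)

type_synonym 'e covector = "'e \<Rightarrow> sign"

definition composition :: "'e covector \<Rightarrow> 'e covector \<Rightarrow> 'e covector" where
  "composition X Y = (\<lambda>e. if X e = Zero then Y e else X e)"

definition separation :: "'e covector \<Rightarrow> 'e covector \<Rightarrow> 'e set" where
  "separation X Y = {e. X e \<noteq> Zero \<and> Y e = sign_neg (X e)}"

definition oriented_matroid :: "'e set \<Rightarrow> 'e covector set \<Rightarrow> bool" where
  "oriented_matroid E L \<longleftrightarrow>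
     finite E \<and>
     (\<forall>X\<in>L. \<forall>e. e \<notin> E \<longrightarrow> X e = Zero) \<and>
     (\<lambda>e. Zero) \<in> L \<and>
     (\<forall>X\<in>L. (\<lambda>e. sign_neg (X e)) \<in> L) \<and>
     (\<forall>X\<in>L. \<forall>Y\<in>L. composition X Y \<in> L) \<and>
     (\<forall>X\<in>L. \<forall>Y\<in>L. \<forall>e\<in>separation X Y.
        \<exists>Z\<in>L. Z e = Zero \<and> (\<forall>f\<in>E - separation X Y. Z f = composition X Y f))"

definition no_loops :: "'e set \<Rightarrow> 'e covector set \<Rightarrow> bool" where
  "no_loops E L \<longleftrightarrow> (\<forall>e\<in>E. \<exists>X\<in>L. X e \<noteq> Zero)"

definition cov_le :: "'e covector \<Rightarrow> 'e covector \<Rightarrow> bool" where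
  "cov_le X Y \<longleftrightarrow> (\<forall>e. X e \<in> {Zero, Y e})"

(* A chain with k elements has length k - 1; the longest chains below X run from 0 to X. *)

definition cov_rank :: "'e covector set \<Rightarrow> 'e covector \<Rightarrow> nat" where
  "cov_rank L X =
     Max {card K - 1 | K. K \<subseteq> {Y \<in> L. cov_le Y X} \<and> Complete_Partial_Order.chain cov_le K}"

definition om_rank :: "'e covector set \<Rightarrow> nat" where
  "om_rank L = Max (cov_rank L ` L)"

definition halfspace_plus :: "'e covector set \<Rightarrow> 'e \<Rightarrow> 'e covector set" where
  "halfspace_plus L e = {X \<in> L. X e \<in> {Plus, Zero}}"

definition halfspace_minus :: "'e covector set \<Rightarrow> 'e \<Rightarrow> 'e covector set" where
  "halfspace_minus L e = {X \<in> L. X e \<in> {Minus, Zero}}"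

definition hyperplane :: "'e covector set \<Rightarrow> 'e \<Rightarrow> 'e covector set" where
  "hyperplane L e = halfspace_plus L e \<inter> halfspace_minus L e"

(* The empty intersection is allowed, so L itself is a polyhedron. *)

definition polyhedron :: "'e set \<Rightarrow> 'e covector set \<Rightarrow> 'e covector set \<Rightarrow> bool" where
  "polyhedron E L P \<longleftrightarrow>
     (\<exists>HS \<subseteq> halfspace_plus L ` E \<union> halfspace_minus L ` E. P = L \<inter> \<Inter>HS)"

(* The common rank of all maximal covectors of P: if X and Y are maximal in a polyhedron P,
   then X o Y and Y o X lie in P, so X and Y have the same zero set and hence the same rank. *)

definition poly_rank :: "'e covector set \<Rightarrow> 'e covector set \<Rightarrow> nat" where
  "poly_rank L P =
     (THE r. \<forall>X\<in>P. (\<forall>Y\<in>P. cov_le X Y \<longrightarrow> Y = X) \<longrightarrow> cov_rank L X = r)"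

definition accessible_faces ::
  "'e set \<Rightarrow> 'e covector set \<Rightarrow> 'e covector set \<Rightarrow> 'e covector set set" where
  "accessible_faces E L P =
     {P \<inter> hyperplane L e | e. e \<in> E \<and> (P \<subseteq> halfspace_plus L e \<or> P \<subseteq> halfspace_minus L e)}"

definition faces ::
  "'e set \<Rightarrow> 'e covector set \<Rightarrow> 'e covector set \<Rightarrow> 'e covector set set" where
  "faces E L P = {P \<inter> \<Inter>A | A. A \<subseteq> accessible_faces E L P}"

definition polyhedral_complex :: "'e set \<Rightarrow> 'e covector set \<Rightarrow> 'e covector set set \<Rightarrow> bool" where
  "polyhedral_complex E L C \<longleftrightarrow>
     finite C \<and> C \<noteq> {} \<and>
     (\<forall>P\<in>C. polyhedron E L P) \<and>
     (\<forall>P\<in>C. faces E L P \<subseteq> C) \<and>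
     (\<forall>P\<in>C. \<forall>Q\<in>C. P \<inter> Q \<in> faces E L P \<and> P \<inter> Q \<in> faces E L Q)"

definition Supp :: "'e covector set set \<Rightarrow> 'e covector set" where
  "Supp C = \<Union>C"

definition coarsens :: "'e covector set set \<Rightarrow> 'e covector set set \<Rightarrow> bool" where
  "coarsens C' C \<longleftrightarrow> Supp C' = Supp C \<and> (\<forall>Q\<in>C'. \<exists>S\<subseteq>C. Q = \<Union>S)"

definition adj_vertices ::
  "'e covector set \<Rightarrow> nat \<Rightarrow> 'e covector set set \<Rightarrow> 'e covector set set" where
  "adj_vertices L n C = {M \<in> C. poly_rank L M = n}"

(* The edge M---N is the unordered pair {M, N}.  The rank condition forces M and N to differ.
   It is written additively because n - 1 would be truncated at n = 0. *)

definition adj_edges ::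
  "'e covector set \<Rightarrow> nat \<Rightarrow> 'e covector set set \<Rightarrow> 'e covector set set set" where
  "adj_edges L n C =
     {{M, N} | M N. M \<in> adj_vertices L n C \<and> N \<in> adj_vertices L n C \<and>
                    poly_rank L (M \<inter> N) + 1 = n}"

definition edge_set ::
  "'e covector set \<Rightarrow> nat \<Rightarrow> 'e covector set set \<Rightarrow> 'e covector set set \<Rightarrow> 'e covector set set set"
  where
  "edge_set L n C C' = {d \<in> adj_edges L n C. \<exists>Q\<in>C'. \<forall>M\<in>d. M \<subseteq> Q}"

definition ideal_boundary :: "'e covector set \<Rightarrow> 'e covector set \<Rightarrow> 'e covector set" where
  "ideal_boundary L U = {X \<in> U. \<not> {Y \<in> L. cov_le X Y} \<subseteq> U}"

definition perp_ground :: "'e set \<Rightarrow> 'e covector set \<Rightarrow> 'e covector set \<Rightarrow> 'e set" where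
  "perp_ground E L F = {e \<in> E. F \<subseteq> hyperplane L e}"

definition restr :: "'e set \<Rightarrow> 'e covector \<Rightarrow> 'e covector" where
  "restr D X = (\<lambda>e. if e \<in> D then X e else Zero)"

definition Perp :: "'e set \<Rightarrow> 'e covector set \<Rightarrow> 'e covector set \<Rightarrow> 'e covector set" where
  "Perp E L F = restr (perp_ground E L F) ` L"

definition polygon ::
  "'e covector set \<Rightarrow> nat \<Rightarrow> 'e covector set set \<Rightarrow> 'e covector set \<Rightarrow> 'e covector set set" where
  "polygon L n C F = {M \<in> adj_vertices L n C. F \<subseteq> M}"

definition local_cone ::
  "'e set \<Rightarrow> 'e covector set \<Rightarrow> 'e covector set \<Rightarrow> 'e covector set \<Rightarrow> 'e covector set" where
  "local_cone E L F M = restr (perp_ground E L F) ` M"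

definition local_complex ::
  "'e set \<Rightarrow> 'e covector set \<Rightarrow> nat \<Rightarrow> 'e covector set set \<Rightarrow> 'e covector set \<Rightarrow> 'e covector set set"
  where
  "local_complex E L n C F =
     (\<Union>M \<in> polygon L n C F. faces (perp_ground E L F) (Perp E L F) (local_cone E L F M))"

(* The edges of EE in the polygon of F, i.e. those with both ends in it, are transported to the
   adjacency graph of the local complex along M |-> local_cone E L F M.
   Perp E L F has rank 2, hence the argument 2 of edge_set. *)

definition polygon_property ::
  "'e set \<Rightarrow> 'e covector set \<Rightarrow> nat \<Rightarrow> 'e covector set set \<Rightarrow> 'e covector set set set \<Rightarrow> bool" where
  "polygon_property E L n C EE \<longleftrightarrow>
     (\<forall>F\<in>C. poly_rank L F + 2 = n \<and> \<not> F \<subseteq> ideal_boundary L (Supp C) \<longrightarrow>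
        (\<exists>D. polyhedral_complex (perp_ground E L F) (Perp E L F) D \<and>
             coarsens D (local_complex E L n C F) \<and>
             (\<lambda>d. local_cone E L F ` d) ` {d \<in> EE. d \<subseteq> polygon L n C F} =
               edge_set (Perp E L F) 2 (local_complex E L n C F) D))"

end

theory Submission
  imports Defs
begin

text \<open>
  The smallest face of a polyhedron \<open>P\<close> containing \<open>X\<close> consists of the \<open>Y \<in> P\<close> with
  \<open>X \<circ> (-Y) \<in> P\<close>, and a family of polyhedra closed under faces is a complex iff these smallest
  faces agree wherever members meet.  Hence complexes localize: restricting a coarsening of \<open>C\<close> to
  the star of a face of rank \<open>n - 2\<close> gives the polygon property.

  Conversely, call two adjacent topes open to each other if their cells coincide or span an edge of
  \<open>\<E>\<close>.  By the polygon property an open half-turn around a covector of corank 2 forces the whole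
  turn to be open.  Since the facets of a tope \<open>T\<close> separating it from another tope are connected
  through faces of corank 2, an open first step followed by an interval without walls yields an
  interval without walls.  So the classes of topes reachable through open steps are convex, and
  their unions are polyhedra.  Two classes sharing a facet meet in the same face on both sides, again
  by the local condition at corank 2, and walking around a common covector \<open>X\<close> shows that any two
  classes containing \<open>X\<close> have the same smallest face at \<open>X\<close>; thus the faces of the classes
  form a complex.
\<close>

section \<open>Covectors, flats and rank\<close>

text \<open>The polygon property speaks only about faces of rank n - 2, whereas the argument meets
  covectors of corank 2 anywhere in the support, possibly inside larger faces of \<open>C\<close>.
  Local information is therefore attached to covectors (\<open>star\<close>, \<open>model\<close>)
  instead of faces; a corank 2 covector inside a larger face lies in at most two cells and needs no
  hypothesis on \<open>EE\<close>. An open half-turn opens the full turn because a polyhedron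
  containing a tope and its opposite lies in no closed halfspace, so it is everything. That the
  support is a polyhedron enters here: a tope and its opposite around \<open>X\<close> put the whole
  star of \<open>X\<close> into the support, which makes the polygon property applicable at
  \<open>X\<close>. Openness is defined by intervals and not by paths; its transitivity is then the
  real content, and the halfspaces cutting out a class come from the walls through which galleries
  leave it. Ranks are chain lengths in the poset of covectors; they become comparable once read off
  the zero sets, the flats of the underlying matroid, which form a graded poset.\<close>

abbreviation comp_cov (infixl "\<odot>" 70) where "X \<odot> Y \<equiv> composition X Y"
abbreviation le_cov (infix "\<preceq>" 50) where "X \<preceq> Y \<equiv> cov_le X Y"

definition opp :: "'e covector \<Rightarrow> 'e covector" where
  "opp X = (\<lambda>e. sign_neg (X e))"

text \<open>Unlike \<open>separation\<close>, coordinates where only one entry vanishes count too;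
  for covectors with the same zero set both notions agree. The cardinality is the induction measure
  of the gallery arguments.\<close>

definition dis :: "'e covector \<Rightarrow> 'e covector \<Rightarrow> 'e set" where
  "dis X Y = {e. X e \<noteq> Y e}"

text \<open>For topes this is the interval between \<open>T\<close> and \<open>T'\<close> in the
  tope graph. The coordinatewise form also serves covectors inside a common hyperplane.\<close>

definition between :: "'e covector \<Rightarrow> 'e covector \<Rightarrow> 'e covector \<Rightarrow> bool" where
  "between T U T' \<longleftrightarrow> (\<forall>e. U e = T e \<or> U e = T' e)"

lemma sign_neg_simps [simp]:
  "sign_neg (sign_neg s) = s" "sign_neg s = Zero \<longleftrightarrow> s = Zero"
  "s = sign_neg s \<longleftrightarrow> s = Zero" "sign_neg s = s \<longleftrightarrow> s = Zero"
  "Zero = sign_neg s \<longleftrightarrow> s = Zero"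
  "sign_neg s = sign_neg t \<longleftrightarrow> s = t"
  by (cases s; cases t; simp)+

lemma sign_neq_neg: "s \<noteq> Zero \<Longrightarrow> t \<noteq> Zero \<Longrightarrow> s \<noteq> t \<Longrightarrow> t = sign_neg s"
  by (cases s; cases t; simp)

lemma comp_apply: "(X \<odot> Y) e = (if X e = Zero then Y e else X e)"
  by (simp add: composition_def)

lemma opp_apply [simp]: "opp X e = sign_neg (X e)"
  by (simp add: opp_def)

lemma opp_opp [simp]: "opp (opp X) = X"
  by (simp add: opp_def)

lemma cov_le_iff: "X \<preceq> Y \<longleftrightarrow> (\<forall>e. X e \<noteq> Zero \<longrightarrow> Y e = X e)"
  by (auto simp: cov_le_def)

lemma cov_le_refl [simp]: "X \<preceq> X"
  by (simp add: cov_le_iff)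

lemma cov_le_trans: "X \<preceq> Y \<Longrightarrow> Y \<preceq> Z \<Longrightarrow> X \<preceq> Z"
  by (metis cov_le_iff)

lemma cov_le_antisym: "X \<preceq> Y \<Longrightarrow> Y \<preceq> X \<Longrightarrow> X = Y"
  unfolding cov_le_iff by (metis ext)

lemma le_comp [simp]: "X \<preceq> X \<odot> Y"
  by (simp add: cov_le_iff comp_apply)

lemma comp_absorb: "X \<preceq> Y \<Longrightarrow> X \<odot> Y = Y"
  unfolding cov_le_iff by (rule ext) (auto simp: comp_apply)

lemma comp_assoc: "X \<odot> Y \<odot> Z = X \<odot> (Y \<odot> Z)"
  by (rule ext) (simp add: comp_apply)

lemma between_refl [simp]: "between T T T'" "between T T' T'"
  by (simp_all add: between_def)

lemma between_sym: "between T U T' \<Longrightarrow> between T' U T"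
  by (auto simp: between_def)

lemma between_above: "between T U T' \<Longrightarrow> X \<preceq> T \<Longrightarrow> X \<preceq> T' \<Longrightarrow> X \<preceq> U"
  unfolding between_def cov_le_iff by metis

lemma between_trans: "between T U T' \<Longrightarrow> between T V U \<Longrightarrow> between T V T'"
  unfolding between_def by metis

lemma between_extend: "between T U T' \<Longrightarrow> between U V T' \<Longrightarrow> between T V T'"
  unfolding between_def by metis

lemma between_dis: "between T U T' \<Longrightarrow> dis U T' \<subseteq> dis T T'"
  unfolding between_def dis_def by (auto, metis)

lemma between_dis_strict: "between T U T' \<Longrightarrow> U \<noteq> T \<Longrightarrow> dis U T' \<subset> dis T T'"
proof -
  assume b: "between T U T'" and "U \<noteq> T"
  then obtain e where e: "U e \<noteq> T e" by (meson ext)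
  then have "e \<in> dis T T'" "e \<notin> dis U T'" using b by (auto simp: between_def dis_def)
  with between_dis[OF b] show ?thesis by blast
qed

lemma dis_sym: "dis X Y = dis Y X"
  by (auto simp: dis_def)

lemma least_witness:
  fixes m :: "'a \<Rightarrow> nat"
  assumes "P x"
  obtains y where "P y" "\<And>z. P z \<Longrightarrow> m y \<le> m z"
  using ex_has_least_nat[of P x m] assms by blast

lemma between_comp:
  "(\<And>e. X e \<noteq> Zero \<Longrightarrow> X e = T e \<or> X e = T' e) \<Longrightarrow> between T (X \<odot> T') T'"
  by (auto simp: between_def comp_apply)

locale covectors =
  fixes E :: "'e set" and L :: "'e covector set"
  assumes om: "oriented_matroid E L"
begin

definition zs :: "'e covector \<Rightarrow> 'e set" where "zs X = {e \<in> E. X e = Zero}"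

text \<open>These are the flats of the underlying matroid; composition of covectors becomes
  intersection of flats.\<close>

definition flats :: "'e set set" where "flats = zs ` L"

definition covers :: "'e set \<Rightarrow> 'e set \<Rightarrow> bool" where
  "covers A B \<longleftrightarrow> A \<in> flats \<and> B \<in> flats \<and> A \<subset> B \<and> \<not> (\<exists>C\<in>flats. A \<subset> C \<and> C \<subset> B)"

lemma finE: "finite E"
  and outside: "X \<in> L \<Longrightarrow> e \<notin> E \<Longrightarrow> X e = Zero"
  and zero_in: "(\<lambda>e. Zero) \<in> L"
  and opp_in: "X \<in> L \<Longrightarrow> opp X \<in> L"
  and comp_in: "X \<in> L \<Longrightarrow> Y \<in> L \<Longrightarrow> X \<odot> Y \<in> L"
  using om by (auto simp: oriented_matroid_def opp_def)

lemma eliminate: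
  assumes "X \<in> L" "Y \<in> L" "X e \<noteq> Zero" "Y e = sign_neg (X e)"
  obtains Z where "Z \<in> L" "Z e = Zero"
    "\<And>f. X f = Zero \<or> Y f \<noteq> sign_neg (X f) \<Longrightarrow> Z f = (X \<odot> Y) f"
proof -
  have "e \<in> separation X Y" using assms by (simp add: separation_def)
  then obtain Z where Z: "Z \<in> L" "Z e = Zero" "\<forall>f\<in>E - separation X Y. Z f = (X \<odot> Y) f"
    using om assms(1,2) unfolding oriented_matroid_def by blast
  have "Z f = (X \<odot> Y) f" if "X f = Zero \<or> Y f \<noteq> sign_neg (X f)" for f
  proof (cases "f \<in> E")
    case True
    then show ?thesis using Z(3) that by (auto simp: separation_def)
  next
    case False
    then show ?thesis
      using outside[OF Z(1) False] outside[OF assms(1) False] outside[OF assms(2) False]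
      by (simp add: comp_apply)
  qed
  then show thesis using that Z by blast
qed

lemma finite_L: "finite L"
proof (rule finite_subset)
  have "(UNIV :: sign set) = {Zero, Plus, Minus}" using sign.exhaust by auto
  then have "finite (UNIV :: sign set)" by (metis finite.emptyI finite.insertI)
  then show "finite {f. \<forall>e. (e \<in> E \<longrightarrow> f e \<in> (UNIV :: sign set)) \<and> (e \<notin> E \<longrightarrow> f e = Zero)}"
    using finE by (intro finite_set_of_finite_funs)
qed (use outside in auto)

lemma zs_subset: "zs X \<subseteq> E"
  by (auto simp: zs_def)

lemma in_zs_iff: "X \<in> L \<Longrightarrow> e \<in> E \<Longrightarrow> e \<in> zs X \<longleftrightarrow> X e = Zero"
  by (simp add: zs_def)

lemma zs_comp: "zs (X \<odot> Y) = zs X \<inter> zs Y"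
  by (auto simp: zs_def comp_apply)

lemma zs_opp [simp]: "zs (opp X) = zs X"
  by (simp add: zs_def)

lemma zs_mono: "X \<preceq> Y \<Longrightarrow> zs Y \<subseteq> zs X"
  unfolding zs_def cov_le_iff by fastforce

lemma le_zs_eq: "X \<in> L \<Longrightarrow> Y \<in> L \<Longrightarrow> X \<preceq> Y \<Longrightarrow> zs X \<subseteq> zs Y \<Longrightarrow> X = Y"
  unfolding zs_def cov_le_iff using outside by (intro ext) (metis (mono_tags, lifting) mem_Collect_eq subsetD)

lemma le_neq_zs: "X \<in> L \<Longrightarrow> Y \<in> L \<Longrightarrow> X \<preceq> Y \<Longrightarrow> X \<noteq> Y \<Longrightarrow> zs Y \<subset> zs X"
  using le_zs_eq zs_mono by blast

lemma flats_sub: "A \<in> flats \<Longrightarrow> A \<subseteq> E"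
  using zs_subset by (auto simp: flats_def)

section \<open>The poset of flats and its rank function\<close>

lemma zs_flat [intro]: "X \<in> L \<Longrightarrow> zs X \<in> flats"
  by (simp add: flats_def)

lemma flat_Int: "A \<in> flats \<Longrightarrow> B \<in> flats \<Longrightarrow> A \<inter> B \<in> flats"
  unfolding flats_def using zs_comp comp_in by (auto simp: image_iff) metis

lemma E_flat: "E \<in> flats"
proof -
  have "zs (\<lambda>e. Zero) = E" by (auto simp: zs_def)
  then show ?thesis using zero_in by (metis zs_flat)
qed

lemma coversD: "covers A B \<Longrightarrow> A \<in> flats" "covers A B \<Longrightarrow> B \<in> flats" "covers A B \<Longrightarrow> A \<subset> B"
  unfolding covers_def by simp_all

lemma covers_card: "covers A B \<Longrightarrow> card (E - B) < card (E - A)"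
proof (intro psubset_card_mono)
  assume c: "covers A B"
  then have "A \<subset> B" "B \<subseteq> E" using flats_sub coversD by auto
  then show "E - B \<subset> E - A" by blast
qed (simp add: finE)

text \<open>\<open>B\<close> is the smallest flat containing \<open>A\<close> and \<open>e\<close>.
  A flat \<open>C\<close> strictly in between cannot contain \<open>e\<close>, so a covector of
  \<open>C\<close>, negated if necessary, can be eliminated at \<open>e\<close> against a covector
  of \<open>A\<close>. The result vanishes on \<open>A\<close> and at \<open>e\<close>, hence on
  \<open>B\<close>, yet not at any \<open>f\<close> in \<open>C - A\<close>: a
  contradiction.\<close>

lemma flat_closure:
  assumes A: "A \<in> flats" and e: "e \<in> E - A"
  obtains B where "covers A B" "e \<in> B" "\<And>C. C \<in> flats \<Longrightarrow> A \<subseteq> C \<Longrightarrow> e \<in> C \<Longrightarrow> B \<subseteq> C"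
proof -
  let ?P = "\<lambda>B. B \<in> flats \<and> A \<subseteq> B \<and> e \<in> B"
  have "?P E" using E_flat flats_sub[OF A] e by auto
  then obtain B where B: "?P B" and min: "\<And>C. ?P C \<Longrightarrow> card B \<le> card C"
    using ex_has_least_nat[of ?P E card] by blast
  have least: "B \<subseteq> C" if "?P C" for C
  proof -
    have "?P (B \<inter> C)" using B that flat_Int by auto
    then have "card B \<le> card (B \<inter> C)" by (rule min)
    moreover have "finite B" using B flats_sub finE finite_subset by blast
    ultimately show ?thesis by (metis Int_lower1 card_subset_eq card_mono le_antisym inf.absorb_iff1)
  qed
  have "\<not> (A \<subset> C \<and> C \<subset> B)" if C: "C \<in> flats" for C
  proof
    assume AC: "A \<subset> C \<and> C \<subset> B"
    then obtain f where f: "f \<in> C" "f \<notin> A" by blast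
    have eC: "e \<notin> C" using least[of C] AC C by blast
    obtain X Y where X: "X \<in> L" "A = zs X" and Y: "Y \<in> L" "C = zs Y"
      using A C by (auto simp: flats_def)
    have nz: "X e \<noteq> Zero" "Y e \<noteq> Zero" using e eC X Y by (auto simp: zs_def)
    define Y' where "Y' = (if X e = Y e then opp Y else Y)"
    have Y': "Y' \<in> L" "zs Y' = C" "Y' e = sign_neg (X e)"
      using Y opp_in nz sign_neq_neg by (auto simp: Y'_def)
    obtain Z where Z: "Z \<in> L" "Z e = Zero"
      "\<And>f. X f = Zero \<or> Y' f \<noteq> sign_neg (X f) \<Longrightarrow> Z f = (X \<odot> Y') f"
      using eliminate[OF X(1) Y'(1) nz(1) Y'(3)] by metis
    have "A \<subseteq> zs Z"
    proof
      fix a assume a: "a \<in> A"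
      then have "X a = Zero" "Y' a = Zero" "a \<in> E" using X AC Y' by (auto simp: zs_def)
      then show "a \<in> zs Z" using Z(3)[of a] by (simp add: zs_def comp_apply)
    qed
    then have "B \<subseteq> zs Z" using least[of "zs Z"] Z(1,2) e zs_flat by (simp add: in_zs_iff)
    moreover have "Y' f = Zero" "X f \<noteq> Zero" using f Y'(2) X flats_sub[OF C] by (auto simp: zs_def)
    then have "Z f \<noteq> Zero" using Z(3)[of f] by (simp add: comp_apply)
    ultimately show False using f AC by (auto simp: zs_def)
  qed
  then have "covers A B" using A B e unfolding covers_def by blast
  then show thesis using that B least by blast
qed

lemma covers_meet:
  assumes "covers A B" "C \<in> flats" "A \<subseteq> C" "e \<in> B" "e \<in> C" "e \<notin> A"
  shows "B \<subseteq> C"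
proof -
  have "B \<inter> C \<in> flats" using assms flat_Int by (auto simp: covers_def)
  moreover have "A \<subset> B \<inter> C" using assms coversD by blast+
  ultimately show ?thesis using assms(1) unfolding covers_def by blast
qed

text \<open>With \<open>e\<close> in \<open>B\<close> and \<open>e'\<close> in \<open>B'\<close>
  outside \<open>A\<close>, the closures of \<open>B\<close> with \<open>e'\<close> and of
  \<open>B'\<close> with \<open>e\<close> contain each other, because a flat above a cover's base
  that meets the cover in a new element contains the whole cover.\<close>

lemma covers_diamond:
  assumes AB: "covers A B" and AB': "covers A B'" and neq: "B \<noteq> B'"
  obtains D where "covers B D" "covers B' D"
proof -
  have fl: "B \<in> flats" "B' \<in> flats" "A \<subset> B" "A \<subset> B'" using assms coversD by blast+
  obtain e e' where e: "e \<in> B" "e \<notin> A" and e': "e' \<in> B'" "e' \<notin> A" using fl by blast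
  have disj: "e \<notin> B'" "e' \<notin> B"
    using covers_meet[OF AB fl(2) _ e(1) _ e(2)] covers_meet[OF AB' fl(1) _ e'(1) _ e'(2)]
      covers_meet[OF AB' fl(1) _ _ e(1) e(2)] covers_meet[OF AB fl(2) _ _ e'(1) e'(2)] fl neq by blast+
  have "e' \<in> E - B" "e \<in> E - B'" using disj e e' fl flats_sub by blast+
  then obtain D D' where D: "covers B D" "e' \<in> D" "\<And>C. C \<in> flats \<Longrightarrow> B \<subseteq> C \<Longrightarrow> e' \<in> C \<Longrightarrow> D \<subseteq> C"
    and D': "covers B' D'" "e \<in> D'" "\<And>C. C \<in> flats \<Longrightarrow> B' \<subseteq> C \<Longrightarrow> e \<in> C \<Longrightarrow> D' \<subseteq> C"
    using flat_closure[OF fl(1)] flat_closure[OF fl(2)] by metis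
  have flD: "D \<in> flats" "B \<subseteq> D" "D' \<in> flats" "B' \<subseteq> D'" using coversD[OF D(1)] coversD[OF D'(1)] by blast+
  have "B \<subseteq> D'" using covers_meet[OF AB flD(3) _ e(1) D'(2) e(2)] fl flD by blast
  then have "D \<subseteq> D'" using D(3) flD e' by blast
  moreover have "B' \<subseteq> D" using covers_meet[OF AB' flD(1) _ e'(1) D(2) e'(2)] fl flD by blast
  then have "D' \<subseteq> D" using D'(3) flD e by blast
  ultimately have "D = D'" by (rule equalityI)
  then show thesis using that D(1) D'(1) by blast
qed

text \<open>The length of a saturated chain of flats from \<open>A\<close> up to \<open>E\<close>; a
  relation, since independence of the chain (the Jordan-Dedekind condition) remains to be
  shown.\<close>

inductive flat_height :: "'e set \<Rightarrow> nat \<Rightarrow> bool" where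
  top: "flat_height E 0"
| cover: "covers A B \<Longrightarrow> flat_height B k \<Longrightarrow> flat_height A (Suc k)"

lemma flat_height_ex: "A \<in> flats \<Longrightarrow> \<exists>k. flat_height A k"
proof (induction "card (E - A)" arbitrary: A rule: less_induct)
  case less
  show ?case
  proof (cases "A = E")
    case False
    then obtain e where "e \<in> E - A" using flats_sub[OF less.prems] by blast
    then obtain B where B: "covers A B" using flat_closure[OF less.prems] by metis
    then have "\<exists>k. flat_height B k" using less.hyps covers_card covers_def by blast
    then show ?thesis using B flat_height.cover by blast
  qed (use flat_height.top in blast)
qed

text \<open>Two chains starting with different covers \<open>B\<close> and \<open>B'\<close> are
  compared through a third one that passes through a common cover \<open>D\<close> of both.\<close>

lemma flat_height_unique: "flat_height A k \<Longrightarrow> flat_height A k' \<Longrightarrow> k = k'"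
proof (induction "card (E - A)" arbitrary: A k k' rule: less_induct)
  case less
  have no: "\<not> covers E B" for B unfolding covers_def using flats_sub by blast
  show ?case
  proof (cases "A = E")
    case True
    then show ?thesis using less.prems no by (metis flat_height.cases)
  next
    case False
    obtain B j where B: "covers A B" "flat_height B j" "k = Suc j"
      using less.prems(1) False by (metis flat_height.cases)
    obtain B' j' where B': "covers A B'" "flat_height B' j'" "k' = Suc j'"
      using less.prems(2) False by (metis flat_height.cases)
    have "j = j'"
    proof (cases "B = B'")
      case True
      then show ?thesis using less.hyps[OF covers_card[OF B(1)] B(2), of j'] B'(2) by simp
    next
      case False
      then obtain D where D: "covers B D" "covers B' D" using covers_diamond B B' by metis
      then obtain i where "flat_height D i" using flat_height_ex coversD(2) by metis
      then have "flat_height B (Suc i)" "flat_height B' (Suc i)" using D flat_height.cover by auto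
      then have "j = Suc i" "j' = Suc i"
        using less.hyps[OF covers_card[OF B(1)] B(2), of "Suc i"]
          less.hyps[OF covers_card[OF B'(1)] B'(2), of "Suc i"] by auto
      then show ?thesis by simp
    qed
    then show ?thesis using B B' by simp
  qed
qed

definition frank :: "'e set \<Rightarrow> nat" where
  "frank A = (THE k. flat_height A k)"

lemma frank_eq: "flat_height A k \<Longrightarrow> frank A = k"
  unfolding frank_def using flat_height_unique by (intro the_equality) auto

lemma frank_height: "A \<in> flats \<Longrightarrow> flat_height A (frank A)"
  using flat_height_ex[of A] frank_eq by auto

lemma frank_E: "frank E = 0"
  by (rule frank_eq[OF flat_height.top])

lemma frank_covers: "covers A B \<Longrightarrow> frank A = Suc (frank B)"
  by (metis frank_eq flat_height.cover frank_height coversD(2))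

lemma frank_less: "A \<in> flats \<Longrightarrow> B \<in> flats \<Longrightarrow> A \<subset> B \<Longrightarrow> frank B < frank A"
proof (induction "card (E - A)" arbitrary: A rule: less_induct)
  case less
  then obtain e where e: "e \<in> B" "e \<in> E - A" using flats_sub by blast
  obtain B' where B': "covers A B'" "B' \<subseteq> B"
    using flat_closure[OF less.prems(1) e(2)] less.prems e by (metis psubset_imp_subset)
  then have "B' = B \<or> frank B < frank B'"
    using less.hyps[OF covers_card[OF B'(1)] coversD(2)[OF B'(1)]] less.prems(2) by blast
  then show ?case using frank_covers[OF B'(1)] by auto
qed

lemma covers_iff_frank:
  assumes "A \<in> flats" "B \<in> flats"
  shows "covers A B \<longleftrightarrow> A \<subset> B \<and> frank A = Suc (frank B)"
proof
  assume "A \<subset> B \<and> frank A = Suc (frank B)"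
  then have "False" if "C \<in> flats" "A \<subset> C" "C \<subset> B" for C
    using frank_less[of A C] frank_less[of C B] assms that by simp
  then show "covers A B" using assms \<open>A \<subset> B \<and> _\<close> unfolding covers_def by blast
qed (use frank_covers covers_def in blast)

text \<open>If a flat lies strictly between, choose \<open>V\<close> above \<open>Y\<close> whose
  flat lies strictly between and which opposes \<open>X\<close> in as few coordinates as possible.
  Without opposition \<open>V \<preceq> X\<close> contradicts \<open>cov\<close>; otherwise
  eliminating \<open>X\<close> against \<open>V\<close> yields a better candidate, still nonzero on
  \<open>zs V - zs X\<close> and hence not back at the flat of \<open>Y\<close>.\<close>

lemma le_cover_flat_cover:
  assumes X: "X \<in> L" and Y: "Y \<in> L" and YX: "Y \<preceq> X" "Y \<noteq> X"
    and cov: "\<And>V. V \<in> L \<Longrightarrow> Y \<preceq> V \<Longrightarrow> V \<preceq> X \<Longrightarrow> V = Y \<or> V = X"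
  shows "covers (zs X) (zs Y)"
proof (rule ccontr)
  assume "\<not> covers (zs X) (zs Y)"
  then obtain W where W: "W \<in> L" "zs X \<subset> zs W" "zs W \<subset> zs Y"
    using le_neq_zs[OF Y X YX] X Y unfolding covers_def flats_def by blast
  let ?P = "\<lambda>V. V \<in> L \<and> Y \<preceq> V \<and> zs X \<subset> zs V \<and> zs V \<subset> zs Y"
  let ?s = "\<lambda>V. {e \<in> E. X e \<noteq> Zero \<and> V e = sign_neg (X e)}"
  have "zs (Y \<odot> W) = zs W" using W zs_comp by auto
  then have start: "?P (Y \<odot> W)" using W Y comp_in by auto
  obtain V where V: "?P V" and min: "\<And>V'. ?P V' \<Longrightarrow> card (?s V) \<le> card (?s V')"
    by (rule least_witness[of ?P "Y \<odot> W" "\<lambda>V. card (?s V)", OF start]) (rule that)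
  show False
  proof (cases "?s V = {}")
    case True
    have "V \<preceq> X" unfolding cov_le_iff
    proof (intro allI impI)
      fix e assume nz: "V e \<noteq> Zero"
      then have "e \<in> E" using V outside by blast
      moreover from this have "X e \<noteq> Zero" using V nz by (auto simp: zs_def)
      ultimately show "X e = V e" using True nz sign_neq_neg by blast
    qed
    then show False using cov V by blast
  next
    case False
    then obtain e where e: "e \<in> E" "X e \<noteq> Zero" "V e = sign_neg (X e)" by blast
    obtain Z where Z: "Z \<in> L" "Z e = Zero"
      "\<And>f. X f = Zero \<or> V f \<noteq> sign_neg (X f) \<Longrightarrow> Z f = (X \<odot> V) f"
      using eliminate[of X V e] X V e by metis
    obtain f where f: "f \<in> zs V" "f \<notin> zs X" using V by blast
    have "Z f \<noteq> Zero" using Z(3)[of f] f by (auto simp: zs_def comp_apply)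
    moreover have "f \<in> zs Y" using f V by blast
    ultimately have ZY: "zs Z \<noteq> zs Y" by (auto simp: zs_def)
    have "Y \<preceq> Z" unfolding cov_le_iff
    proof (intro allI impI)
      fix g assume "Y g \<noteq> Zero"
      then have "X g = Y g" "V g = Y g" "Y g \<noteq> Zero" using YX V by (auto simp: cov_le_iff)
      then show "Z g = Y g" using Z(3)[of g] by (simp add: comp_apply)
    qed
    moreover have "zs X \<subset> zs Z"
    proof -
      have "zs X \<subseteq> zs Z"
      proof
        fix a assume "a \<in> zs X"
        moreover from this have "V a = Zero" using V by (auto simp: zs_def)
        ultimately show "a \<in> zs Z" using Z(3)[of a] by (auto simp: zs_def comp_apply)
      qed
      then show ?thesis using Z(2) e by (auto simp: zs_def)
    qed
    ultimately have "?P Z" using Z(1) ZY zs_mono by blast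
    moreover have "?s Z \<subset> ?s V"
    proof -
      have "V g = sign_neg (X g)" if "X g \<noteq> Zero" "Z g = sign_neg (X g)" for g
        using Z(3)[of g] that by (auto simp: comp_apply)
      then have "?s Z \<subseteq> ?s V" by blast
      moreover have "e \<in> ?s V" "e \<notin> ?s Z" using e Z(2) by auto
      ultimately show ?thesis by blast
    qed
    then have "card (?s Z) < card (?s V)" using finE by (intro psubset_card_mono) auto
    ultimately show False using min by fastforce
  qed
qed

lemma lower_cover:
  assumes X: "X \<in> L" and Y: "Y \<in> L" and YX: "Y \<preceq> X" "Y \<noteq> X"
  obtains V where "V \<in> L" "Y \<preceq> V" "V \<preceq> X" "covers (zs X) (zs V)"
proof -
  let ?P = "\<lambda>V. V \<in> L \<and> Y \<preceq> V \<and> V \<preceq> X \<and> V \<noteq> X"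
  obtain V where V: "?P V" and min: "\<And>V'. ?P V' \<Longrightarrow> card (zs V) \<le> card (zs V')"
    using ex_has_least_nat[of ?P Y "\<lambda>V. card (zs V)"] YX Y by auto
  have "V' = V \<or> V' = X" if "V' \<in> L" "V \<preceq> V'" "V' \<preceq> X" for V'
  proof (rule ccontr)
    assume "\<not> (V' = V \<or> V' = X)"
    then have "?P V'" "zs V' \<subset> zs V" using that V cov_le_trans le_neq_zs by blast+
    then show False using min finE zs_subset
      by (meson finite_subset leD psubset_card_mono)
  qed
  then show thesis using that V le_cover_flat_cover X by blast
qed

lemma chain_exists:
  "X \<in> L \<Longrightarrow> \<exists>K \<subseteq> {Y \<in> L. Y \<preceq> X}. Complete_Partial_Order.chain cov_le K \<and> card K = Suc (frank (zs X))"
proof (induction "frank (zs X)" arbitrary: X rule: less_induct)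
  case less
  show ?case
  proof (cases "X = (\<lambda>e. Zero)")
    case True
    then have "frank (zs X) = 0" using frank_E by (simp add: zs_def)
    then show ?thesis using less.prems by (intro exI[of _ "{X}"]) (auto simp: chain_def)
  next
    case False
    then obtain V where V: "V \<in> L" "V \<preceq> X" "covers (zs X) (zs V)"
      using lower_cover[OF less.prems zero_in] by (metis cov_le_iff)
    then have fr: "frank (zs X) = Suc (frank (zs V))" using frank_covers by blast
    then obtain K where K: "K \<subseteq> {Y \<in> L. Y \<preceq> V}" "Complete_Partial_Order.chain cov_le K"
      "card K = Suc (frank (zs V))"
      using less.hyps V by (metis lessI)
    have "V \<noteq> X" using V(3) by (auto simp: covers_def)
    then have "X \<notin> K" using K(1) V(2) cov_le_antisym by blast
    moreover have "finite K" using K(1) finite_L by (metis (no_types, lifting) finite_subset mem_Collect_eq subsetI subsetD)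
    moreover have "K \<subseteq> {Y \<in> L. Y \<preceq> X}" using K(1) V(2) cov_le_trans by blast
    ultimately show ?thesis using K less.prems fr
      by (intro exI[of _ "insert X K"]) (auto simp: chain_def)
  qed
qed

lemma chain_bound:
  assumes X: "X \<in> L" and K: "K \<subseteq> {Y \<in> L. Y \<preceq> X}" "Complete_Partial_Order.chain cov_le K"
  shows "card K \<le> Suc (frank (zs X))"
proof -
  have inj: "inj_on (\<lambda>Y. frank (zs Y)) K"
  proof (rule inj_onI, rule ccontr)
    fix Y Y' assume a: "Y \<in> K" "Y' \<in> K" "frank (zs Y) = frank (zs Y')" "Y \<noteq> Y'"
    then have "Y \<preceq> Y' \<or> Y' \<preceq> Y" "Y \<in> L" "Y' \<in> L" using K by (auto simp: chain_def)
    then have "zs Y \<subset> zs Y' \<or> zs Y' \<subset> zs Y" using a le_neq_zs by blast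
    then show False using a(3) frank_less \<open>Y \<in> L\<close> \<open>Y' \<in> L\<close> by (metis less_irrefl zs_flat)
  qed
  have "(\<lambda>Y. frank (zs Y)) ` K \<subseteq> {..frank (zs X)}"
  proof
    fix k assume "k \<in> (\<lambda>Y. frank (zs Y)) ` K"
    then obtain Y where Y: "Y \<in> L" "Y \<preceq> X" "k = frank (zs Y)" using K by blast
    then have "Y = X \<or> k < frank (zs X)" using le_neq_zs X frank_less by blast
    then show "k \<in> {..frank (zs X)}" using Y by auto
  qed
  then have "card K \<le> card {..frank (zs X)}" using inj card_inj_on_le by blast
  then show ?thesis by simp
qed

text \<open>A chain of covectors maps injectively to flats of distinct rank, which bounds its
  length; repeated lower covers attain the bound, since a cover among covectors is a cover among
  flats.\<close>

lemma cov_rank_frank: "X \<in> L \<Longrightarrow> cov_rank L X = frank (zs X)"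
  unfolding cov_rank_def
proof (rule Max_eqI)
  let ?S = "{card K - 1 | K. K \<subseteq> {Y \<in> L. Y \<preceq> X} \<and> Complete_Partial_Order.chain cov_le K}"
  assume X: "X \<in> L"
  have le: "k \<le> frank (zs X)" if k: "k \<in> ?S" for k
  proof -
    obtain K where "k = card K - 1" "K \<subseteq> {Y \<in> L. Y \<preceq> X}" "Complete_Partial_Order.chain cov_le K"
      using k by blast
    then show ?thesis using chain_bound[OF X, of K] by simp
  qed
  then show "\<And>k. k \<in> ?S \<Longrightarrow> k \<le> frank (zs X)" .
  have "?S \<subseteq> {..frank (zs X)}" using le by blast
  then show "finite ?S" by (rule finite_subset) simp
  obtain K where "K \<subseteq> {Y \<in> L. Y \<preceq> X}" "Complete_Partial_Order.chain cov_le K"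
    "card K = Suc (frank (zs X))" using chain_exists[OF X] by blast
  then show "frank (zs X) \<in> ?S" by (intro CollectI exI[of _ K]) simp
qed

lemma cov_rank_less: "X \<in> L \<Longrightarrow> Y \<in> L \<Longrightarrow> zs X \<subset> zs Y \<Longrightarrow> cov_rank L Y < cov_rank L X"
  using cov_rank_frank frank_less zs_flat by metis

lemma cov_rank_cong: "X \<in> L \<Longrightarrow> Y \<in> L \<Longrightarrow> zs X = zs Y \<Longrightarrow> cov_rank L X = cov_rank L Y"
  using cov_rank_frank by metis

lemma covers_iff_rank:
  "X \<in> L \<Longrightarrow> Y \<in> L \<Longrightarrow> covers (zs X) (zs Y) \<longleftrightarrow> zs X \<subset> zs Y \<and> cov_rank L X = Suc (cov_rank L Y)"
  using covers_iff_frank cov_rank_frank by (metis zs_flat)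

section \<open>Galleries\<close>

text \<open>The zero set is arbitrary because galleries inside a hyperplane are needed as well.\<close>

lemma gallery_step:
  assumes T: "T \<in> L" and T': "T' \<in> L" and zz: "zs T = zs T'" and neq: "T \<noteq> T'"
  obtains Y where "Y \<in> L" "Y \<preceq> T" "covers (zs T) (zs Y)" "zs Y - zs T \<subseteq> dis T T'"
proof -
  let ?P = "\<lambda>V. V \<in> L \<and> zs T \<subseteq> zs V \<and> (\<forall>f. T f = T' f \<longrightarrow> V f = T f) \<and> V \<noteq> T"
  let ?s = "\<lambda>V. {e \<in> E. T e \<noteq> Zero \<and> V e = sign_neg (T e)}"
  have start: "?P T'" using T' zz neq by auto
  \<comment> \<open>\<open>V\<close> has the fewest sign reversals against \<open>T\<close>.
    Elimination would remove one more, so there are none and \<open>V\<close> is a proper face of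
    \<open>T\<close> that keeps every sign shared by \<open>T\<close> and \<open>T'\<close>.\<close>
  obtain V where V: "?P V" and min: "\<And>V'. ?P V' \<Longrightarrow> card (?s V) \<le> card (?s V')"
    by (rule least_witness[of ?P T' "\<lambda>V. card (?s V)", OF start]) (rule that)
  have "?s V = {}"
  proof (rule ccontr)
    assume "?s V \<noteq> {}"
    then obtain e where e: "e \<in> E" "T e \<noteq> Zero" "V e = sign_neg (T e)" by blast
    obtain Z where Z: "Z \<in> L" "Z e = Zero"
      "\<And>f. T f = Zero \<or> V f \<noteq> sign_neg (T f) \<Longrightarrow> Z f = (T \<odot> V) f"
      using eliminate[of T V e] T V e by metis
    have "zs T \<subseteq> zs Z"
    proof
      fix a assume "a \<in> zs T"
      moreover from this have "V a = Zero" using V by (auto simp: zs_def)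
      ultimately show "a \<in> zs Z" using Z(3)[of a] by (auto simp: zs_def comp_apply)
    qed
    moreover have "Z f = T f" if "T f = T' f" for f
      using Z(3)[of f] V that by (auto simp: comp_apply)
    moreover have "Z \<noteq> T" using Z(2) e by auto
    ultimately have "?P Z" using Z(1) by blast
    moreover have "?s Z \<subset> ?s V"
    proof -
      have "V g = sign_neg (T g)" if "T g \<noteq> Zero" "Z g = sign_neg (T g)" for g
        using Z(3)[of g] that by (auto simp: comp_apply)
      then have "?s Z \<subseteq> ?s V" by blast
      moreover have "e \<in> ?s V" "e \<notin> ?s Z" using e Z(2) by auto
      ultimately show ?thesis by blast
    qed
    then have "card (?s Z) < card (?s V)" using finE by (intro psubset_card_mono) auto
    ultimately show False using min by fastforce
  qed
  have "V \<preceq> T" unfolding cov_le_iff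
  proof (intro allI impI)
    fix e assume nz: "V e \<noteq> Zero"
    then have "e \<in> E" using V outside by blast
    moreover from this have "T e \<noteq> Zero" using V nz by (auto simp: zs_def)
    ultimately show "T e = V e" using \<open>?s V = {}\<close> nz sign_neq_neg by blast
  qed
  then obtain Y where Y: "Y \<in> L" "V \<preceq> Y" "Y \<preceq> T" "covers (zs T) (zs Y)"
    using lower_cover[OF T] V by metis
  have "zs Y - zs T \<subseteq> dis T T'"
  proof
    fix e assume "e \<in> zs Y - zs T"
    then have "V e = Zero" "T e \<noteq> Zero" using zs_mono[OF Y(2)] by (auto simp: zs_def)
    then show "e \<in> dis T T'" using V by (auto simp: dis_def)
  qed
  then show thesis using that Y by blast
qed

text \<open>The elements of \<open>zs Y - zs T\<close> are parallel once \<open>zs T\<close> is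
  fixed as zero set: were \<open>T\<close> and \<open>U\<close> equal at \<open>e\<close> but
  opposite at \<open>f\<close>, eliminating \<open>Y \<odot> T\<close> against
  \<open>Y \<odot> U\<close> at \<open>f\<close> would give a flat containing \<open>f\<close> but
  not \<open>e\<close>, strictly inside the cover.\<close>

lemma cover_parallel:
  assumes Y: "Y \<in> L" and T: "T \<in> L" and U: "U \<in> L" and zz: "zs T = zs U"
    and cov: "covers (zs T) (zs Y)" and e: "e \<in> zs Y - zs T" and f: "f \<in> zs Y"
    and eq: "T e = U e"
  shows "T f = U f"
proof (rule ccontr)
  assume neq: "T f \<noteq> U f"
  have fE: "f \<in> E" using f by (auto simp: zs_def)
  have "f \<in> zs T \<longleftrightarrow> f \<in> zs U" using zz by simp
  then have nz: "T f \<noteq> Zero" "U f \<noteq> Zero" using neq fE by (auto simp: zs_def)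
  have "zs Y \<inter> zs T = zs T" using cov by (auto simp: covers_def)
  then have zYT: "zs (Y \<odot> T) = zs T" "zs (Y \<odot> U) = zs T" using zs_comp zz by auto
  have Yf: "Y f = Zero" "Y e = Zero" using f e by (auto simp: zs_def)
  have "(Y \<odot> T) f \<noteq> Zero" "(Y \<odot> U) f = sign_neg ((Y \<odot> T) f)"
    using Yf nz neq sign_neq_neg by (auto simp: comp_apply)
  then obtain Z where Z: "Z \<in> L" "Z f = Zero" "\<And>g. (Y \<odot> T) g = Zero \<or> (Y \<odot> U) g \<noteq> sign_neg ((Y \<odot> T) g)
      \<Longrightarrow> Z g = (Y \<odot> T \<odot> (Y \<odot> U)) g"
    using eliminate[OF comp_in[OF Y T] comp_in[OF Y U]] by metis
  have Te: "T e \<noteq> Zero" using e by (auto simp: zs_def)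
  have "Z e = T e" using Z(3)[of e] Yf eq Te by (simp add: comp_apply)
  then have "e \<notin> zs Z" using e by (auto simp: zs_def)
  moreover have "zs T \<subseteq> zs Z"
  proof
    fix a assume a: "a \<in> zs T"
    then have "(Y \<odot> T) a = Zero" "(Y \<odot> U) a = Zero" using zYT by (auto simp: zs_def)
    then show "a \<in> zs Z" using Z(3)[of a] a by (auto simp: zs_def comp_apply)
  qed
  moreover have "zs Z \<subseteq> zs Y"
  proof
    fix a assume a: "a \<in> zs Z"
    show "a \<in> zs Y"
    proof (rule ccontr)
      assume "a \<notin> zs Y"
      then have "Y a \<noteq> Zero" using a by (auto simp: zs_def)
      then have "Z a \<noteq> Zero" using Z(3)[of a] by (simp add: comp_apply)
      then show False using a by (auto simp: zs_def)
    qed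
  qed
  moreover have "f \<in> zs Z" "f \<notin> zs T" using Z(2) fE nz by (auto simp: zs_def)
  ultimately show False using cov Z(1) e unfolding covers_def by blast
qed

end

section \<open>Polyhedra and their faces\<close>

text \<open>For a polyhedron \<open>P\<close> and \<open>X \<in> P\<close>, this is the smallest face of \<open>P\<close> containing \<open>X\<close>: the
  covectors \<open>Y\<close> of \<open>P\<close> such that one can also move slightly from \<open>X\<close> in direction \<open>-Y\<close>.\<close>

definition relface :: "'e covector set \<Rightarrow> 'e covector \<Rightarrow> 'e covector set" where
  "relface P X = {Y \<in> P. X \<odot> opp Y \<in> P}"

lemma relface_subset: "relface P X \<subseteq> P"
  by (auto simp: relface_def)

lemma relface_self: "X \<in> P \<Longrightarrow> X \<in> relface P X"
proof -
  have "X \<odot> opp X = X" by (rule ext) (simp add: comp_apply)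
  then show "X \<in> P \<Longrightarrow> X \<in> relface P X" by (simp add: relface_def)
qed

lemma relface_mono: "P \<subseteq> Q \<Longrightarrow> relface P X \<subseteq> relface Q X"
  by (auto simp: relface_def)

lemma relface_opp: "Y \<in> relface P X \<Longrightarrow> X \<odot> Y \<in> P \<Longrightarrow> X \<odot> opp Y \<in> relface P X"
proof -
  have "X \<odot> opp (X \<odot> opp Y) = X \<odot> Y" by (rule ext) (simp add: comp_apply)
  then show "Y \<in> relface P X \<Longrightarrow> X \<odot> Y \<in> P \<Longrightarrow> X \<odot> opp Y \<in> relface P X"
    by (simp add: relface_def)
qed

lemma sign_both_bounded:
  "s = Zero \<or> s = t \<Longrightarrow> sign_neg s = Zero \<or> sign_neg s = t \<Longrightarrow> s = Zero"
  by (cases s; cases t; simp)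

context covectors
begin

text \<open>One predicate for both closed halfspaces of \<open>e\<close>: the nonzero sign
  \<open>s\<close> tells which of them contains \<open>P\<close>.\<close>

definition bounds :: "'e covector set \<Rightarrow> 'e \<Rightarrow> sign \<Rightarrow> bool" where
  "bounds P e s \<longleftrightarrow> e \<in> E \<and> s \<noteq> Zero \<and> (\<forall>Y\<in>P. Y e = Zero \<or> Y e = s)"

text \<open>The counterpart of a point in the relative interior; in a polyhedron these are exactly
  the maximal covectors.\<close>

definition generic :: "'e covector set \<Rightarrow> 'e covector \<Rightarrow> bool" where
  "generic P X \<longleftrightarrow> X \<in> P \<and> (\<forall>Y\<in>P. zs X \<subseteq> zs Y)"

lemma halfspace_simps:
  "halfspace_plus L e = {X \<in> L. X e = Zero \<or> X e = Plus}"
  "halfspace_minus L e = {X \<in> L. X e = Zero \<or> X e = Minus}"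
  "hyperplane L e = {X \<in> L. X e = Zero}"
  by (auto simp: halfspace_plus_def halfspace_minus_def hyperplane_def)

lemma bounds_iff:
  assumes "P \<subseteq> L"
  shows "(\<exists>s. bounds P e s) \<longleftrightarrow> e \<in> E \<and> (P \<subseteq> halfspace_plus L e \<or> P \<subseteq> halfspace_minus L e)"
proof
  assume "\<exists>s. bounds P e s"
  then obtain s where s: "bounds P e s" by blast
  then have "s = Plus \<or> s = Minus" by (cases s) (auto simp: bounds_def)
  then show "e \<in> E \<and> (P \<subseteq> halfspace_plus L e \<or> P \<subseteq> halfspace_minus L e)"
    using s assms by (auto simp: bounds_def halfspace_simps)
next
  assume a: "e \<in> E \<and> (P \<subseteq> halfspace_plus L e \<or> P \<subseteq> halfspace_minus L e)"
  then have "bounds P e Plus \<or> bounds P e Minus" by (auto simp: bounds_def halfspace_simps)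
  then show "\<exists>s. bounds P e s" by blast
qed

text \<open>An intersection of halfspaces equals the intersection of all halfspaces containing it,
  so no family has to be carried along: it suffices to separate each outside covector strictly from
  \<open>P\<close>.\<close>

lemma polyhedron_iff:
  "polyhedron E L P \<longleftrightarrow>
     P \<subseteq> L \<and> (\<forall>X\<in>L - P. \<exists>e s. bounds P e s \<and> X e = sign_neg s)"
proof
  assume "polyhedron E L P"
  then obtain HS where HS: "HS \<subseteq> halfspace_plus L ` E \<union> halfspace_minus L ` E" "P = L \<inter> \<Inter>HS"
    by (auto simp: polyhedron_def)
  have "\<exists>e s. bounds P e s \<and> X e = sign_neg s" if X: "X \<in> L - P" for X
  proof -
    obtain H where H: "H \<in> HS" "X \<notin> H" using X HS by blast
    then have PH: "P \<subseteq> H" using HS by blast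
    obtain e where e: "e \<in> E" "H = halfspace_plus L e \<or> H = halfspace_minus L e"
      using H HS by blast
    then show ?thesis
    proof (elim disjE)
      assume Hp: "H = halfspace_plus L e"
      then have "X e = Minus" using H X by (cases "X e") (auto simp: halfspace_simps)
      moreover have "bounds P e Plus" using PH Hp e(1) by (auto simp: bounds_def halfspace_simps)
      ultimately show ?thesis by (metis sign_neg.simps(2))
    next
      assume Hp: "H = halfspace_minus L e"
      then have "X e = Plus" using H X by (cases "X e") (auto simp: halfspace_simps)
      moreover have "bounds P e Minus" using PH Hp e(1) by (auto simp: bounds_def halfspace_simps)
      ultimately show ?thesis by (metis sign_neg.simps(3))
    qed
  qed
  then show "P \<subseteq> L \<and> (\<forall>X\<in>L - P. \<exists>e s. bounds P e s \<and> X e = sign_neg s)" using HS by blast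
next
  assume a: "P \<subseteq> L \<and> (\<forall>X\<in>L - P. \<exists>e s. bounds P e s \<and> X e = sign_neg s)"
  define HS where "HS = {H \<in> halfspace_plus L ` E \<union> halfspace_minus L ` E. P \<subseteq> H}"
  have "L \<inter> \<Inter>HS \<subseteq> P"
  proof
    fix X assume X: "X \<in> L \<inter> \<Inter>HS"
    show "X \<in> P"
    proof (rule ccontr)
      assume "X \<notin> P"
      then obtain e s where s: "bounds P e s" "X e = sign_neg s" using X a by blast
      then have "s = Plus \<or> s = Minus" by (cases s) (auto simp: bounds_def)
      then show False
      proof
        assume sp: "s = Plus"
        then have "halfspace_plus L e \<in> HS"
          using s a by (auto simp: HS_def bounds_def halfspace_simps)
        then show False using X s(2) sp by (auto simp: halfspace_simps)
      next
        assume sp: "s = Minus"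
        then have "halfspace_minus L e \<in> HS"
          using s a by (auto simp: HS_def bounds_def halfspace_simps)
        then show False using X s(2) sp by (auto simp: halfspace_simps)
      qed
    qed
  qed
  then have "P = L \<inter> \<Inter>HS" using a by (auto simp: HS_def)
  then show "polyhedron E L P" unfolding polyhedron_def by (intro exI[of _ HS]) (auto simp: HS_def)
qed

lemma polyhedron_sub: "polyhedron E L P \<Longrightarrow> P \<subseteq> L"
  by (simp add: polyhedron_iff)

lemma polyhedron_sep:
  assumes "polyhedron E L P" "X \<in> L" "X \<notin> P"
  obtains e s where "bounds P e s" "X e = sign_neg s"
  using assms by (metis Diff_iff polyhedron_iff)

lemma boundsD: "bounds P e s \<Longrightarrow> Y \<in> P \<Longrightarrow> Y e = Zero \<or> Y e = s" "bounds P e s \<Longrightarrow> s \<noteq> Zero"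
  by (simp_all add: bounds_def)

lemma polyhedron_mem:
  assumes "polyhedron E L P" "X \<in> P" "Y \<in> P" "Z \<in> L"
    and "\<And>e. Z e = Zero \<or> Z e = X e \<or> Z e = Y e"
  shows "Z \<in> P"
proof (rule ccontr)
  assume "Z \<notin> P"
  then obtain e s where s: "bounds P e s" "Z e = sign_neg s"
    using polyhedron_sep[OF assms(1,4)] by metis
  have "s \<noteq> Zero" "X e = Zero \<or> X e = s" "Y e = Zero \<or> Y e = s"
    using boundsD[OF s(1)] assms(2,3) by blast+
  then show False using assms(5)[of e] s(2) by (metis sign_neg_simps(2,4))
qed

lemma polyhedron_comp: "polyhedron E L P \<Longrightarrow> X \<in> P \<Longrightarrow> Y \<in> P \<Longrightarrow> X \<odot> Y \<in> P"
  by (rule polyhedron_mem[of P X Y]) (use comp_in polyhedron_sub in \<open>auto simp: comp_apply\<close>)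

lemma polyhedron_down: "polyhedron E L P \<Longrightarrow> Y \<in> P \<Longrightarrow> X \<in> L \<Longrightarrow> X \<preceq> Y \<Longrightarrow> X \<in> P"
  by (rule polyhedron_mem[of P Y Y]) (auto simp: cov_le_iff)

lemma polyhedron_between:
  "polyhedron E L P \<Longrightarrow> X \<in> P \<Longrightarrow> Y \<in> P \<Longrightarrow> Z \<in> L \<Longrightarrow> between X Z Y \<Longrightarrow> Z \<in> P"
  by (rule polyhedron_mem[of P X Y]) (auto simp: between_def)

lemma zero_in_polyhedron: "polyhedron E L P \<Longrightarrow> (\<lambda>e. Zero) \<in> P"
  by (rule ccontr, erule polyhedron_sep[OF _ zero_in]) (simp_all add: boundsD(2))

lemma polyhedron_Int:
  assumes P: "polyhedron E L P" and Q: "polyhedron E L Q"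
  shows "polyhedron E L (P \<inter> Q)"
  unfolding polyhedron_iff
proof (intro conjI ballI)
  show "P \<inter> Q \<subseteq> L" using polyhedron_sub[OF P] by blast
  fix X assume X: "X \<in> L - P \<inter> Q"
  have "bounds (P \<inter> Q) e s" if "bounds P e s \<or> bounds Q e s" for e s
    using that by (auto simp: bounds_def)
  moreover have "\<exists>e s. (bounds P e s \<or> bounds Q e s) \<and> X e = sign_neg s"
    using X P Q unfolding polyhedron_iff by blast
  ultimately show "\<exists>e s. bounds (P \<inter> Q) e s \<and> X e = sign_neg s" by blast
qed

lemma polyhedron_L: "polyhedron E L L"
  by (simp add: polyhedron_iff)

lemma generic_exists:
  assumes Q: "Q \<subseteq> L" "X0 \<in> Q" and comp: "\<And>X Y. X \<in> Q \<Longrightarrow> Y \<in> Q \<Longrightarrow> X \<odot> Y \<in> Q"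
  obtains X where "generic Q X" "X0 \<preceq> X"
proof -
  obtain X where X: "X \<in> Q" and min: "\<And>Y. Y \<in> Q \<Longrightarrow> card (zs X) \<le> card (zs Y)"
    by (rule least_witness[of "\<lambda>X. X \<in> Q" X0 "\<lambda>X. card (zs X)", OF Q(2)]) (rule that)
  have "zs X \<subseteq> zs Y" if "Y \<in> Q" for Y
  proof -
    have "card (zs X) \<le> card (zs X \<inter> zs Y)" using min comp[OF X that] zs_comp by metis
    then have "zs X \<inter> zs Y = zs X"
      using finite_subset[OF zs_subset finE] by (intro card_subset_eq) (auto intro: card_mono le_antisym)
    then show ?thesis by blast
  qed
  then have "generic Q (X0 \<odot> X)" using comp[OF Q(2) X] zs_comp by (auto simp: generic_def)
  then show thesis using that le_comp by blast
qed

lemma polyhedron_generic: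
  assumes "polyhedron E L P" "X0 \<in> P"
  obtains X where "generic P X" "X0 \<preceq> X"
  using generic_exists[OF polyhedron_sub[OF assms(1)] assms(2)] polyhedron_comp[OF assms(1)] by blast

lemma generic_absorb:
  assumes "P \<subseteq> L" "generic P X" "Y \<in> P"
  shows "X \<odot> opp Y = X" "X \<odot> Y = X"
proof -
  have "Y e = Zero" if "X e = Zero" for e
  proof (cases "e \<in> E")
    case True
    then have "e \<in> zs X" using that by (simp add: zs_def)
    then show ?thesis using assms by (auto simp: generic_def zs_def)
  qed (use assms outside in blast)
  then show "X \<odot> opp Y = X" "X \<odot> Y = X" by (auto simp: comp_apply intro!: ext)
qed

lemma relface_generic: "P \<subseteq> L \<Longrightarrow> generic P X \<Longrightarrow> relface P X = P"
  using generic_absorb(1)[of P X] by (auto simp: relface_def generic_def)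

lemma generic_le_eq: "P \<subseteq> L \<Longrightarrow> generic P X \<Longrightarrow> Y \<in> P \<Longrightarrow> X \<preceq> Y \<Longrightarrow> X = Y"
  by (metis comp_absorb generic_absorb(2))

text \<open>At a bound tight in \<open>X\<close>, the composition \<open>X \<odot> opp Y\<close> has
  the sign opposite to \<open>Y\<close>, so both can respect the bound only if \<open>Y\<close>
  vanishes there. Bounds that are not tight are decided by \<open>X\<close> alone.\<close>

lemma relface_iff:
  assumes P: "polyhedron E L P" and X: "X \<in> P"
  shows "Y \<in> relface P X \<longleftrightarrow> Y \<in> P \<and> (\<forall>e s. bounds P e s \<and> X e = Zero \<longrightarrow> Y e = Zero)"
proof
  assume "Y \<in> relface P X"
  then have Y: "Y \<in> P" "X \<odot> opp Y \<in> P" by (auto simp: relface_def)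
  have "Y e = Zero" if b: "bounds P e s" "X e = Zero" for e s
  proof (rule sign_both_bounded)
    show "Y e = Zero \<or> Y e = s" using boundsD(1)[OF b(1) Y(1)] .
    have "(X \<odot> opp Y) e = sign_neg (Y e)" using b(2) by (simp add: comp_apply)
    then show "sign_neg (Y e) = Zero \<or> sign_neg (Y e) = s" using boundsD(1)[OF b(1) Y(2)] by metis
  qed
  then show "Y \<in> P \<and> (\<forall>e s. bounds P e s \<and> X e = Zero \<longrightarrow> Y e = Zero)" using Y(1) by blast
next
  assume a: "Y \<in> P \<and> (\<forall>e s. bounds P e s \<and> X e = Zero \<longrightarrow> Y e = Zero)"
  have L: "X \<odot> opp Y \<in> L" 
    using comp_in[of X "opp Y"] opp_in a X polyhedron_sub[OF P] by (meson subsetD)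
  have "X \<odot> opp Y \<in> P"
  proof (rule ccontr)
    assume "X \<odot> opp Y \<notin> P"
    then obtain e s where s: "bounds P e s" "(X \<odot> opp Y) e = sign_neg s"
      using polyhedron_sep[OF P L] by metis
    then have "s \<noteq> Zero" "X e = Zero \<or> X e = s" using boundsD X by blast+
    moreover from this have "X e = Zero" using s(2) by (auto simp: comp_apply)
    moreover from this have "Y e = Zero" using a s(1) by blast
    ultimately show False using s(2) by (simp add: comp_apply)
  qed
  then show "Y \<in> relface P X" using a by (simp add: relface_def)
qed

lemma relface_trans:
  assumes P: "polyhedron E L P" and X: "X \<in> P" and Y: "Y \<in> relface P X"
  shows "relface P Y \<subseteq> relface P X"
proof -
  have "Y \<in> P" using Y by (simp add: relface_def)
  then show ?thesis using relface_iff[OF P X] relface_iff[OF P, of Y] Y by blast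
qed

text \<open>The smallest face at \<open>Y\<close> is the same whether taken in \<open>P\<close> or
  in a face of \<open>P\<close>; complexes can thus be handled through their large members.\<close>

lemma relface_relface:
  assumes P: "polyhedron E L P" and X: "X \<in> P" and Y: "Y \<in> relface P X"
  shows "relface (relface P X) Y = relface P Y"
proof
  show "relface (relface P X) Y \<subseteq> relface P Y" by (intro relface_mono relface_subset)
  have YP: "Y \<in> P" using Y by (simp add: relface_def)
  show "relface P Y \<subseteq> relface (relface P X) Y"
  proof
    fix Z assume Z: "Z \<in> relface P Y"
    then have "Y \<odot> opp Z \<in> relface P Y"
      using relface_opp polyhedron_comp[OF P YP] relface_subset by blast
    then show "Z \<in> relface (relface P X) Y"
      using relface_trans[OF P X Y] Z unfolding relface_def[of "relface P X"] by blast
  qed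
qed

lemma relface_polyhedron:
  assumes P: "polyhedron E L P" and X: "X \<in> P"
  shows "polyhedron E L (relface P X)"
  unfolding polyhedron_iff
proof (intro conjI ballI)
  show "relface P X \<subseteq> L" using relface_subset polyhedron_sub[OF P] by blast
  fix Y assume Y: "Y \<in> L - relface P X"
  show "\<exists>e s. bounds (relface P X) e s \<and> Y e = sign_neg s"
  proof (cases "Y \<in> P")
    case False
    then obtain e s where "bounds P e s" "Y e = sign_neg s" using polyhedron_sep[OF P] Y by blast
    moreover from this have "bounds (relface P X) e s" using relface_subset by (auto simp: bounds_def)
    ultimately show ?thesis by blast
  next
    case True
    then obtain e s where s: "bounds P e s" "X e = Zero" "Y e \<noteq> Zero"
      using relface_iff[OF P X] Y by blast
    then have "bounds (relface P X) e (sign_neg (Y e))"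
      using relface_iff[OF P X] by (auto simp: bounds_def)
    then show ?thesis by (metis sign_neg_simps(1))
  qed
qed

text \<open>An intersection of accessible faces contains zero and is closed under composition, so it
  has a generic member \<open>X\<close>, and it is the smallest face at this
  \<open>X\<close>.\<close>

lemma faces_eq:
  assumes P: "polyhedron E L P"
  shows "faces E L P = relface P ` P"
proof
  have acc: "accessible_faces E L P = {P \<inter> hyperplane L e | e. \<exists>s. bounds P e s}"
    using bounds_iff[OF polyhedron_sub[OF P]] by (auto simp: accessible_faces_def)
  show "relface P ` P \<subseteq> faces E L P"
  proof
    fix F assume "F \<in> relface P ` P"
    then obtain X where X: "X \<in> P" "F = relface P X" by blast
    define A where "A = {P \<inter> hyperplane L e | e. X e = Zero \<and> (\<exists>s. bounds P e s)}"
    have "Y \<in> P \<inter> \<Inter>A \<longleftrightarrow> Y \<in> P \<and> (\<forall>e s. bounds P e s \<and> X e = Zero \<longrightarrow> Y e = Zero)" for Y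
      using polyhedron_sub[OF P] unfolding A_def halfspace_simps by blast
    then have "F = P \<inter> \<Inter>A" using relface_iff[OF P X(1)] X(2) by blast
    moreover have "A \<subseteq> accessible_faces E L P" by (auto simp: A_def acc)
    ultimately show "F \<in> faces E L P" by (auto simp: faces_def)
  qed
  show "faces E L P \<subseteq> relface P ` P"
  proof
    fix F assume "F \<in> faces E L P"
    then obtain A where A: "A \<subseteq> accessible_faces E L P" "F = P \<inter> \<Inter>A" by (auto simp: faces_def)
    define B where "B = {e. (\<exists>s. bounds P e s) \<and> P \<inter> hyperplane L e \<in> A}"
    have AB: "A = (\<lambda>e. P \<inter> hyperplane L e) ` B"
      using A(1) unfolding B_def acc by blast
    have F: "F = {Y \<in> P. \<forall>e\<in>B. Y e = Zero}"
      using A(2) polyhedron_sub[OF P] by (auto simp: AB halfspace_simps)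
    have "(\<lambda>e. Zero) \<in> F" using F zero_in_polyhedron[OF P] by simp
    moreover have "X \<odot> Y \<in> F" if "X \<in> F" "Y \<in> F" for X Y
      using that polyhedron_comp[OF P] by (auto simp: F comp_apply)
    moreover have FL: "F \<subseteq> L" using F polyhedron_sub[OF P] by blast
    ultimately obtain X where X: "generic F X" using generic_exists[of F "\<lambda>e. Zero"] by metis
    have XP: "X \<in> P" "X \<in> F" using X F by (auto simp: generic_def)
    have "F \<subseteq> relface P X"
      using generic_absorb(1)[OF FL X] XP F by (auto simp: relface_def)
    moreover have "relface P X \<subseteq> F"
    proof
      fix Y assume Y: "Y \<in> relface P X"
      have "Y e = Zero" if "e \<in> B" for e
        using Y relface_iff[OF P XP(1)] that XP(2) F by (auto simp: B_def)
      then show "Y \<in> F" using F Y relface_subset by blast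
    qed
    ultimately show "F \<in> relface P ` P" using XP by blast
  qed
qed

text \<open>A maximal covector \<open>Y\<close> absorbs composition with \<open>X\<close>, so its
  zero set is also the smallest one; this makes the definite description in \<open>poly_rank\<close>
  meaningful.\<close>

lemma poly_rank_eq:
  assumes P: "polyhedron E L P" and X: "generic P X"
  shows "poly_rank L P = cov_rank L X"
proof -
  have PL: "P \<subseteq> L" using polyhedron_sub[OF P] .
  have XP: "X \<in> P" using X by (simp add: generic_def)
  have max: "\<forall>Y\<in>P. X \<preceq> Y \<longrightarrow> Y = X" using generic_le_eq[OF PL X] by blast
  have "cov_rank L Y = cov_rank L X" if Y: "Y \<in> P" "\<forall>Z\<in>P. Y \<preceq> Z \<longrightarrow> Z = Y" for Y
  proof -
    have "Y \<odot> X = Y" using Y le_comp polyhedron_comp[OF P Y(1) XP] by blast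
    then have "zs Y \<subseteq> zs X" using zs_comp by (metis inf_le2)
    then have "zs Y = zs X" using X Y by (auto simp: generic_def)
    then show ?thesis using cov_rank_cong Y XP PL by blast
  qed
  then show ?thesis unfolding poly_rank_def using max XP by (intro the_equality) blast+
qed

section \<open>Polyhedral complexes\<close>

text \<open>The smallest face of \<open>P\<close> at a generic member of \<open>P \<inter> Q\<close>
  contains the intersection by genericity and is contained in it by agreement.\<close>

lemma relface_agree_Int_face:
  assumes P: "polyhedron E L P" and Q: "polyhedron E L Q"
    and agree: "\<And>X. X \<in> P \<Longrightarrow> X \<in> Q \<Longrightarrow> relface P X = relface Q X"
  shows "P \<inter> Q \<in> faces E L P"
proof -
  obtain X where X: "generic (P \<inter> Q) X"
    using polyhedron_generic[OF polyhedron_Int[OF P Q] zero_in_polyhedron[OF polyhedron_Int[OF P Q]]]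
    by metis
  have XP: "X \<in> P" "X \<in> Q" using X by (auto simp: generic_def)
  have "P \<inter> Q \<subseteq> relface P X"
    using generic_absorb(1)[OF polyhedron_sub[OF polyhedron_Int[OF P Q]] X] XP by (auto simp: relface_def)
  moreover have "relface P X \<subseteq> P \<inter> Q" using agree[OF XP] relface_subset by blast
  ultimately show ?thesis using XP faces_eq[OF P] by blast
qed

lemma polyhedral_complexI:
  assumes "finite C" "C \<noteq> {}" and poly: "\<And>P. P \<in> C \<Longrightarrow> polyhedron E L P"
    and relf: "\<And>P X. P \<in> C \<Longrightarrow> X \<in> P \<Longrightarrow> relface P X \<in> C"
    and agree: "\<And>P Q X. P \<in> C \<Longrightarrow> Q \<in> C \<Longrightarrow> X \<in> P \<Longrightarrow> X \<in> Q \<Longrightarrow> relface P X = relface Q X"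
  shows "polyhedral_complex E L C"
proof -
  have 1: "P \<inter> Q \<in> faces E L P" if "P \<in> C" "Q \<in> C" for P Q
    by (rule relface_agree_Int_face[OF poly[OF that(1)] poly[OF that(2)] agree[OF that]])
  have 2: "P \<inter> Q \<in> faces E L Q" if "P \<in> C" "Q \<in> C" for P Q
    using 1[OF that(2,1)] by (simp only: Int_commute)
  have 3: "faces E L P \<subseteq> C" if "P \<in> C" for P
    using relf[OF that] faces_eq[OF poly[OF that]] by (simp add: image_subset_iff)
  show ?thesis unfolding polyhedral_complex_def
    using assms(1,2) poly 1 2 3 by (intro conjI ballI)
qed

lemma complexD:
  assumes "polyhedral_complex E L C"
  shows "finite C" "C \<noteq> {}" "P \<in> C \<Longrightarrow> polyhedron E L P"
  using assms by (auto simp: polyhedral_complex_def)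

lemma complex_relface: "polyhedral_complex E L C \<Longrightarrow> P \<in> C \<Longrightarrow> X \<in> P \<Longrightarrow> relface P X \<in> C"
proof -
  assume C: "polyhedral_complex E L C" and P: "P \<in> C" and X: "X \<in> P"
  have "faces E L P \<subseteq> C" using C P by (simp add: polyhedral_complex_def)
  then show ?thesis using faces_eq[OF complexD(3)[OF C P]] X by blast
qed

text \<open>\<open>P \<inter> Q\<close> is a face of \<open>P\<close> containing \<open>X\<close>,
  so the smallest face of \<open>P\<close> at \<open>X\<close> can be computed inside the
  intersection, where it is at most that of \<open>Q\<close>.\<close>

lemma complex_agree:
  assumes C: "polyhedral_complex E L C" and PQ: "P \<in> C" "Q \<in> C" "X \<in> P" "X \<in> Q"
  shows "relface P X = relface Q X"
proof -
  have sub: "relface P X \<subseteq> relface Q X" if PQ: "P \<in> C" "Q \<in> C" "X \<in> P" "X \<in> Q" for P Q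
  proof -
    have poly: "polyhedron E L P" using complexD(3)[OF C PQ(1)] .
    have "P \<inter> Q \<in> relface P ` P"
      using C PQ(1,2) faces_eq[OF poly] by (auto simp: polyhedral_complex_def)
    then obtain Z where Z: "Z \<in> P" "P \<inter> Q = relface P Z" by blast
    have "X \<in> relface P Z" using PQ(3,4) Z(2) by blast
    then have "relface P X = relface (P \<inter> Q) X" using relface_relface[OF poly Z(1)] Z(2) by metis
    then show ?thesis using relface_mono[of "P \<inter> Q" Q X] by blast
  qed
  show ?thesis using sub[OF PQ] sub[OF PQ(2,1,4,3)] by (rule equalityI)
qed

lemma faces_complex:
  assumes fin: "finite K" "K \<noteq> {}" and poly: "\<And>P. P \<in> K \<Longrightarrow> polyhedron E L P"
    and agree: "\<And>P Q X. P \<in> K \<Longrightarrow> Q \<in> K \<Longrightarrow> X \<in> P \<Longrightarrow> X \<in> Q \<Longrightarrow> relface P X = relface Q X"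
  shows "polyhedral_complex E L (\<Union>P\<in>K. faces E L P)"
proof -
  let ?C = "\<Union>P\<in>K. faces E L P"
  have mem: "F \<in> ?C \<longleftrightarrow> (\<exists>P\<in>K. \<exists>X\<in>P. F = relface P X)" for F
    using faces_eq poly by auto
  have finP: "finite P" if "P \<in> K" for P
    using poly[OF that] polyhedron_sub finite_L finite_subset by blast
  show ?thesis
  proof (rule polyhedral_complexI)
    show "finite ?C" using fin(1) finP faces_eq poly by auto
    obtain P where "P \<in> K" using fin(2) by blast
    moreover from this have "(\<lambda>e. Zero) \<in> P" using poly zero_in_polyhedron by blast
    ultimately show "?C \<noteq> {}" using mem by blast
  next
    fix F assume "F \<in> ?C"
    then obtain P Z where P: "P \<in> K" "Z \<in> P" "F = relface P Z" using mem by metis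
    then show "polyhedron E L F" using relface_polyhedron[OF poly] by simp
  next
    fix F X assume F: "F \<in> ?C" "X \<in> F"
    then obtain P Z where P: "P \<in> K" "Z \<in> P" "F = relface P Z" using mem by metis
    then have "relface F X = relface P X" using relface_relface[OF poly P(2)] F(2) by simp
    moreover have "X \<in> P" using F(2) P(3) relface_subset by blast
    ultimately show "relface F X \<in> ?C" using P(1) mem by metis
  next
    fix F F' X assume F: "F \<in> ?C" "F' \<in> ?C" and X: "X \<in> F" "X \<in> F'"
    obtain P Z where P: "P \<in> K" "Z \<in> P" "F = relface P Z" using mem F(1) by metis
    obtain P' Z' where P': "P' \<in> K" "Z' \<in> P'" "F' = relface P' Z'" using mem F(2) by metis
    have "relface F X = relface P X" using relface_relface[OF poly P(2)] X(1) P by simp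
    moreover have "relface F' X = relface P' X" using relface_relface[OF poly P'(2)] X(2) P' by simp
    moreover have "X \<in> P" "X \<in> P'" using X P(3) P'(3) relface_subset by blast+
    then have "relface P X = relface P' X" by (rule agree[OF P(1) P'(1)])
    ultimately show "relface F X = relface F' X" by simp
  qed
qed

end

section \<open>Loopless oriented matroids\<close>

locale loopless = covectors +
  assumes nl: "no_loops E L"
begin

definition tope :: "'a covector \<Rightarrow> bool" where
  "tope T \<longleftrightarrow> T \<in> L \<and> zs T = {}"

lemma tope_in: "tope T \<Longrightarrow> T \<in> L"
  by (simp add: tope_def)

lemma tope_nonzero: "tope T \<Longrightarrow> e \<in> E \<Longrightarrow> T e \<noteq> Zero"
  by (auto simp: tope_def zs_def)

lemma tope_exists: "\<exists>T. tope T"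
proof -
  obtain X where X: "generic L X" using polyhedron_generic[OF polyhedron_L zero_in] by metis
  have "zs X = {}"
  proof (rule ccontr)
    assume "zs X \<noteq> {}"
    then obtain e where e: "e \<in> zs X" by blast
    then obtain Y where "Y \<in> L" "Y e \<noteq> Zero" using nl zs_subset unfolding no_loops_def by blast
    then show False using X e by (auto simp: generic_def zs_def)
  qed
  then show ?thesis using X by (auto simp: generic_def tope_def)
qed

lemma tope_comp: "X \<in> L \<Longrightarrow> tope T \<Longrightarrow> tope (X \<odot> T)"
  using zs_comp comp_in by (auto simp: tope_def)

lemma om_rank_tope: "tope T \<Longrightarrow> cov_rank L T = om_rank L"
proof -
  assume T: "tope T"
  have "cov_rank L X \<le> cov_rank L T" if "X \<in> L" for X
    using cov_rank_less[of T X] cov_rank_cong[of T X] T that unfolding tope_def by fastforce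
  then show ?thesis unfolding om_rank_def using T finite_L
    by (intro Max_eqI[symmetric]) (auto dest: tope_in)
qed

lemma rank_eq_iff: "X \<in> L \<Longrightarrow> cov_rank L X = om_rank L \<longleftrightarrow> tope X"
  using om_rank_tope tope_exists cov_rank_less[of _ X]
  by (metis bot.not_eq_extremum nat_neq_iff tope_def)

text \<open>Without loops the empty set is the flat of the topes; \<open>covers {} (zs Y)\<close> is
  therefore used throughout to say that \<open>Y\<close> has corank 1.\<close>

lemma covers_empty_iff: "X \<in> L \<Longrightarrow> covers {} (zs X) \<longleftrightarrow> cov_rank L X + 1 = om_rank L"
proof -
  assume X: "X \<in> L"
  obtain T where T: "tope T" using tope_exists by blast
  then have "covers (zs T) (zs X) \<longleftrightarrow> zs T \<subset> zs X \<and> cov_rank L T = Suc (cov_rank L X)"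
    using covers_iff_rank[OF tope_in X] by blast
  moreover have "zs T = {}" using T by (simp add: tope_def)
  moreover have "zs X \<noteq> {}" if "cov_rank L X + 1 = om_rank L"
    using rank_eq_iff[OF X] X that by (auto simp: tope_def)
  ultimately show ?thesis using om_rank_tope[OF T] by auto
qed

lemma generic_tope: "P \<subseteq> L \<Longrightarrow> T \<in> P \<Longrightarrow> tope T \<Longrightarrow> generic P T"
  by (simp add: generic_def tope_def)

lemma poly_rank_full_iff:
  assumes P: "polyhedron E L P"
  shows "poly_rank L P = om_rank L \<longleftrightarrow> (\<exists>T\<in>P. tope T)"
proof -
  obtain X where X: "generic P X" using polyhedron_generic[OF P zero_in_polyhedron[OF P]] by metis
  then have XP: "X \<in> P" "X \<in> L" using polyhedron_sub[OF P] by (auto simp: generic_def)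
  have "(\<exists>T\<in>P. tope T) \<longleftrightarrow> tope X" using X XP by (auto simp: generic_def tope_def)
  then show ?thesis using poly_rank_eq[OF P X] rank_eq_iff[OF XP(2)] by simp
qed

lemma no_bounds_opposite: "tope T \<Longrightarrow> T \<in> P \<Longrightarrow> opp T \<in> P \<Longrightarrow> \<not> bounds P e s"
  using tope_nonzero[of T e] boundsD(1)[of P e s T] boundsD(1)[of P e s "opp T"]
    sign_both_bounded[of "T e" s] unfolding bounds_def opp_apply by blast

text \<open>A bounding \<open>e\<close> would force \<open>T e\<close> and its negative into the
  same halfspace, hence \<open>T e = Zero\<close>. This is what turns an open half-turn into an open
  full turn.\<close>

lemma polyhedron_opposite:
  assumes P: "polyhedron E L P" and T: "tope T" "T \<in> P" "opp T \<in> P"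
  shows "P = L"
  using no_bounds_opposite[OF T] polyhedron_sep[OF P] polyhedron_sub[OF P] by blast

text \<open>A tope is generic in every member that contains it, so its smallest face there is the
  whole member.\<close>

lemma complex_tope_unique:
  assumes C: "polyhedral_complex E L C" and M: "M \<in> C" "N \<in> C" and T: "tope T" "T \<in> M" "T \<in> N"
  shows "M = N"
proof -
  have "relface M T = relface N T" using complex_agree[OF C M T(2,3)] .
  moreover have full: "relface Q T = Q" if "Q \<in> C" "T \<in> Q" for Q
    using polyhedron_sub[OF complexD(3)[OF C that(1)]] that(2) T(1) by (intro relface_generic generic_tope)
  ultimately show ?thesis using full[OF M(1) T(2)] full[OF M(2) T(3)] by simp
qed

section \<open>Walls and separating facets\<close>

definition wall :: "'a covector \<Rightarrow> 'a covector \<Rightarrow> 'a covector \<Rightarrow> bool" where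
  "wall T U Y \<longleftrightarrow> tope T \<and> tope U \<and> T \<noteq> U \<and> Y \<in> L \<and> Y \<preceq> T \<and> Y \<preceq> U \<and> covers {} (zs Y)"

text \<open>\<open>Y\<close> is a facet of \<open>T\<close> whose crossing leads towards
  \<open>T'\<close>; the tope reached is \<open>Y \<odot> T'\<close>.\<close>

definition visible :: "'a covector \<Rightarrow> 'a covector \<Rightarrow> 'a covector \<Rightarrow> bool" where
  "visible T T' Y \<longleftrightarrow> Y \<in> L \<and> Y \<preceq> T \<and> covers {} (zs Y) \<and> zs Y \<subseteq> dis T T'"

lemma wall_sym: "wall T U Y \<Longrightarrow> wall U T Y"
  by (auto simp: wall_def)

lemma wallD:
  assumes "wall T U Y"
  shows "tope T" "tope U" "T \<noteq> U" "Y \<in> L" "Y \<preceq> T" "Y \<preceq> U" "covers {} (zs Y)"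
  using assms by (auto simp: wall_def)

lemma covers_nonempty: "covers A B \<Longrightarrow> \<exists>e. e \<in> B - A"
  using coversD(3) by blast

lemma eq_off_zs: "X \<in> L \<Longrightarrow> T \<in> L \<Longrightarrow> X \<preceq> T \<Longrightarrow> e \<notin> zs X \<Longrightarrow> T e = X e"
  unfolding zs_def cov_le_iff using outside[of X e] outside[of T e] by (cases "e \<in> E") auto

lemma visible_wall:
  assumes "tope T" "tope T'" "visible T T' Y"
  shows "wall T (Y \<odot> T') Y" "between T (Y \<odot> T') T'"
proof -
  have Y: "Y \<in> L" "Y \<preceq> T" "covers {} (zs Y)" "zs Y \<subseteq> dis T T'" using assms(3) by (auto simp: visible_def)
  obtain e where "e \<in> zs Y" using covers_nonempty[OF Y(3)] by blast
  then have "T e \<noteq> (Y \<odot> T') e" using Y(4) by (auto simp: dis_def zs_def comp_apply)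
  then have "T \<noteq> Y \<odot> T'" by metis
  then show "wall T (Y \<odot> T') Y" using Y assms tope_comp by (auto simp: wall_def)
  show "between T (Y \<odot> T') T'" using Y(2) by (intro between_comp) (auto simp: cov_le_iff)
qed

lemma visible_exists:
  assumes "tope T" "tope T'" "T \<noteq> T'"
  obtains Y where "visible T T' Y"
proof -
  have z: "zs T = {}" "zs T' = {}" "T \<in> L" "T' \<in> L" using assms by (auto simp: tope_def)
  obtain Y where "Y \<in> L" "Y \<preceq> T" "covers (zs T) (zs Y)" "zs Y - zs T \<subseteq> dis T T'"
    by (rule gallery_step[OF z(3,4) _ assms(3)]) (use z in auto)
  then show thesis using that z by (auto simp: visible_def)
qed

lemma wall_step:
  assumes "tope T" "tope T'" "T \<noteq> T'"
  obtains U Y where "wall T U Y" "between T U T'"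
  using visible_exists[OF assms] visible_wall[OF assms(1,2)] by metis

text \<open>All elements of \<open>zs Y\<close> are parallel: agreement at one of them would be
  agreement at all, and off \<open>zs Y\<close> both topes follow \<open>Y\<close>.\<close>

lemma wall_zs:
  assumes w: "wall T U Y" and e: "e \<in> zs Y"
  shows "T e \<noteq> U e"
proof
  assume eq: "T e = U e"
  have z: "zs T = {}" "zs U = {}" using wallD(1,2)[OF w] by (auto simp: tope_def)
  have "T f = U f" for f
  proof (cases "f \<in> zs Y")
    case True
    then show ?thesis using cover_parallel[of Y T U e f] wallD[OF w] z e eq tope_in by simp
  next
    case False
    then show ?thesis using eq_off_zs wallD[OF w] tope_in by metis
  qed
  then show False using wallD(3)[OF w] by blast
qed

lemma wall_dis: "wall T U Y \<Longrightarrow> dis T U = zs Y"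
proof -
  assume w: "wall T U Y"
  have "T e = U e" if "e \<notin> zs Y" for e
    using eq_off_zs wallD[OF w] tope_in that by metis
  then show ?thesis using wall_zs[OF w] by (auto simp: dis_def)
qed

text \<open>By parallelism a single \<open>e\<close> decides on which side of the wall
  \<open>A\<close> lies.\<close>

lemma wall_between:
  assumes w: "wall T U Y" and A: "tope A" and e: "e \<in> zs Y" "A e = U e"
  shows "between T U A"
  unfolding between_def
proof
  fix f
  show "U f = T f \<or> U f = A f"
  proof (cases "f \<in> zs Y")
    case True
    have z: "zs U = {}" "zs A = {}" using wallD(2)[OF w] A by (auto simp: tope_def)
    have "A f = U f" using cover_parallel[of Y A U e f] wallD[OF w] z e True A tope_in by simp
    then show ?thesis by simp
  next
    case False
    then have "f \<notin> dis T U" using wall_dis[OF w] by simp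
    then show ?thesis by (simp add: dis_def)
  qed
qed

lemma sign_two: "s \<noteq> Zero \<Longrightarrow> t \<noteq> Zero \<Longrightarrow> u \<noteq> Zero \<Longrightarrow> s \<noteq> t \<Longrightarrow> u = s \<or> u = t"
  by (cases s; cases t; cases u) simp_all

lemma wall_cases:
  assumes w: "wall T U Y" and A: "tope A" and e: "e \<in> zs Y"
  shows "A e = T e \<or> A e = U e"
proof -
  have "e \<in> E" using e zs_subset by blast
  then show ?thesis
    using sign_two[of "T e" "U e" "A e"] wall_zs[OF w e] tope_nonzero A wallD(1,2)[OF w] by metis
qed

lemma wall_side:
  assumes w: "wall T U Y" and A: "tope A"
  shows "between T U A \<or> between U T A"
proof -
  obtain e where e: "e \<in> zs Y" using covers_nonempty wallD(7)[OF w] by blast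
  then show ?thesis using wall_cases[OF w A e] wall_between[OF w A e] wall_between[OF wall_sym[OF w] A e]
    by blast
qed

lemma wall_topes:
  assumes w: "wall T U Y" and V: "tope V" "Y \<preceq> V"
  shows "V = T \<or> V = U"
proof -
  have off: "V f = T f" "V f = U f" if "f \<notin> zs Y" for f
    using eq_off_zs[OF wallD(4)[OF w]] tope_in wallD[OF w] V that by metis+
  have "V = T" if "between U T V"
  proof
    fix f show "V f = T f"
      using off that wall_zs[OF w] unfolding between_def by (cases "f \<in> zs Y") metis+
  qed
  moreover have "V = U" if "between T U V"
  proof
    fix f show "V f = U f"
      using off that wall_zs[OF w] unfolding between_def by (cases "f \<in> zs Y") metis+
  qed
  ultimately show ?thesis using wall_side[OF w V(1)] by blast
qed

lemma atoms_disjoint: "covers {} A \<Longrightarrow> covers {} B \<Longrightarrow> A \<noteq> B \<Longrightarrow> A \<inter> B = {}"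
proof (rule ccontr)
  assume a: "covers {} A" "covers {} B" "A \<noteq> B" "A \<inter> B \<noteq> {}"
  then obtain e where "e \<in> A" "e \<in> B" by blast
  then have "A \<subseteq> B" "B \<subseteq> A"
    using covers_meet[OF a(1) coversD(2)[OF a(2)]] covers_meet[OF a(2) coversD(2)[OF a(1)]] by auto
  then show False using a(3) by blast
qed

text \<open>The facets of \<open>T\<close> separating it from \<open>T'\<close> are connected through faces of corank 2.  Moving
  \<open>T'\<close> one step towards \<open>T\<close> loses at most one facet \<open>Y\<close>; the first step of a gallery inside the
  hyperplane of \<open>Y\<close> yields a face of \<open>Y\<close> linking it to a facet that is still separating.\<close>

lemma visible_connected:
  assumes T: "tope T" and "tope T'"
    and "\<And>Y Z X. visible T T' Y \<Longrightarrow> visible T T' Z \<Longrightarrow> X \<in> L \<Longrightarrow> X \<preceq> Y \<Longrightarrow> X \<preceq> Z \<Longrightarrow>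
      covers (zs Y) (zs X) \<Longrightarrow> covers (zs Z) (zs X) \<Longrightarrow> zs X \<subseteq> dis T T' \<Longrightarrow> P Y \<Longrightarrow> P Z"
    and "visible T T' Y0" "visible T T' Z0" "P Y0"
  shows "P Z0"
  using assms(2-)
proof (induction "card (dis T T')" arbitrary: T' Y0 Z0 rule: less_induct)
  case less
  note T' = less.prems(1) and link = less.prems(2)
  have Yv: "Y \<in> L" "Y \<preceq> T" "covers {} (zs Y)" "zs Y \<subseteq> dis T T'" if "visible T T' Y" for Y
    using that by (auto simp: visible_def)
  have neq: "T' \<noteq> T"
    using covers_nonempty[OF Yv(3)[OF less.prems(3)]] Yv(4)[OF less.prems(3)] by (auto simp: dis_def)
  obtain W where W: "visible T' T W" using visible_exists[OF T' T neq] by metis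
  \<comment> \<open>\<open>V\<close> is the tope reached from \<open>T'\<close> by crossing a facet
    \<open>W\<close> towards \<open>T\<close>. Only the class \<open>zs W\<close> leaves the
    separation set, so every visible facet with another zero set stays visible towards
    \<open>V\<close>.\<close>
  define V where "V = W \<odot> T"
  have wW: "wall T' V W" and btV: "between T' V T" using visible_wall[OF T' T W] by (auto simp: V_def)
  have V: "tope V" using wallD(2)[OF wW] .
  have disV: "dis T V = dis T T' - zs W"
  proof -
    have on: "V e = T e" if "e \<in> zs W" for e using that by (simp add: V_def zs_def comp_apply)
    have off: "V e = T' e" if "e \<notin> zs W" for e
    proof -
      have "e \<notin> dis T' V" using that wall_dis[OF wW] by simp
      then show ?thesis by (simp add: dis_def)
    qed
    show ?thesis
    proof (rule set_eqI)
      fix e show "e \<in> dis T V \<longleftrightarrow> e \<in> dis T T' - zs W"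
        using on[of e] off[of e] by (cases "e \<in> zs W") (simp_all add: dis_def)
    qed
  qed
  have zW: "zs W \<subseteq> dis T T'" using W by (simp add: visible_def dis_sym[of T])
  have "dis T V \<subset> dis T T'" using disV zW covers_nonempty[OF wallD(7)[OF wW]] by blast
  moreover have "finite (dis T T')"
  proof -
    have "T e = T' e" if "e \<notin> E" for e using outside[OF _ that] tope_in T T' by metis
    then have "dis T T' \<subseteq> E" by (auto simp: dis_def)
    then show ?thesis using finE finite_subset by blast
  qed
  ultimately have smaller: "card (dis T V) < card (dis T T')" by (rule psubset_card_mono[rotated])
  have visV: "visible T V Y" if "visible T T' Y" "zs Y \<noteq> zs W" for Y
    using Yv[OF that(1)] atoms_disjoint[OF Yv(3)[OF that(1)] wallD(7)[OF wW] that(2)] disV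
    by (auto simp: visible_def)
  have vis_mono: "visible T T' Y" if "visible T V Y" for Y
    using that disV by (auto simp: visible_def)
  have IH: "P Z" if YZ: "visible T V Y" "visible T V Z" "P Y" for Y Z
  proof (rule less.hyps[OF smaller V _ YZ])
    fix Y Z X
    assume "visible T V Y" "visible T V Z" "X \<in> L" "X \<preceq> Y" "X \<preceq> Z"
      "covers (zs Y) (zs X)" "covers (zs Z) (zs X)" "zs X \<subseteq> dis T V" "P Y"
    then show "P Z" using link[of Y Z X] vis_mono disV by blast
  qed
  \<comment> \<open>This treats a facet \<open>Y\<close> in the hyperplane of \<open>W\<close>, the
    one that is lost on passing to \<open>V\<close>.\<close>
  have new: "\<exists>X Z. visible T V Z \<and> X \<in> L \<and> X \<preceq> Y \<and> X \<preceq> Z \<and> covers (zs Y) (zs X) \<and>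
      covers (zs Z) (zs X) \<and> zs X \<subseteq> dis T T'"
    if Y: "visible T T' Y" and zY: "zs Y = zs W" and TV: "T \<noteq> V" for Y
  proof -
    note YL = Yv[OF Y]
    have WL: "W \<in> L" "W \<preceq> V" using wallD[OF wW] by auto
    have "\<not> W \<preceq> T" using wall_topes[OF wW T] TV neq by blast
    then have "Y \<noteq> W" using YL(2) by blast
    then obtain X where X: "X \<in> L" "X \<preceq> Y" "covers (zs Y) (zs X)" "zs X - zs Y \<subseteq> dis Y W"
      using gallery_step[OF YL(1) WL(1) zY] by metis
    have XT: "X \<preceq> T" using cov_le_trans X(2) YL(2) by blast
    have YX: "zs Y \<subset> zs X" using coversD(3)[OF X(3)] .
    \<comment> \<open>Reflecting \<open>Y\<close> through its face \<open>X\<close> and filling up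
      with \<open>T\<close> changes \<open>T\<close> only on \<open>zs X - zs Y\<close>. A facet
      \<open>Z\<close> of \<open>T\<close> towards \<open>U\<close> is therefore the other facet of
      \<open>T\<close> at \<open>X\<close>.\<close>
    define U where "U = X \<odot> opp Y \<odot> T"
    have U: "tope U" using X(1) YL(1) T comp_in opp_in tope_comp by (simp add: U_def)
    have Ueq: "U e = T e" if "e \<notin> zs X - zs Y" for e
    proof (cases "e \<in> zs X")
      case True
      then have "X e = Zero" "Y e = Zero" using that by (auto simp: zs_def)
      then show ?thesis by (simp add: U_def comp_apply)
    next
      case False
      then have "T e = X e" using eq_off_zs[OF X(1) tope_in[OF T] XT] by blast
      moreover have "X e = Zero \<Longrightarrow> Y e = Zero" using eq_off_zs[OF X(1) YL(1) X(2) False] by simp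
      ultimately show ?thesis by (simp add: U_def comp_apply)
    qed
    then have disU: "dis T U \<subseteq> zs X - zs Y" by (auto simp: dis_def) metis+
    obtain e where e: "e \<in> zs X - zs Y" using covers_nonempty[OF X(3)] by blast
    have "T \<noteq> U"
    proof
      assume "T = U"
      have "X e = Zero" "Y e \<noteq> Zero" "e \<in> E" using e by (auto simp: zs_def)
      moreover from this have "T e = Y e" using YL(2) by (simp add: cov_le_iff)
      ultimately show False using fun_cong[OF \<open>T = U\<close>, of e] by (simp add: U_def comp_apply)
    qed
    then obtain Z where "visible T U Z" using visible_exists[OF T U] by metis
    then have Z: "Z \<in> L" "Z \<preceq> T" "covers {} (zs Z)" "zs Z \<subseteq> zs X - zs Y"
      using disU by (auto simp: visible_def)
    have "X \<preceq> Z" unfolding cov_le_iff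
    proof (intro allI impI)
      fix f assume f: "X f \<noteq> Zero"
      then have "f \<notin> zs Z" using Z(4) by (auto simp: zs_def)
      then have "T f = Z f" using eq_off_zs[OF Z(1) tope_in[OF T] Z(2)] by blast
      then show "Z f = X f" using XT f by (simp add: cov_le_iff)
    qed
    moreover have "covers (zs Z) (zs X)"
    proof -
      have "cov_rank L Z + 1 = om_rank L" "cov_rank L Y + 1 = om_rank L"
        using covers_empty_iff Z YL by blast+
      moreover have "cov_rank L Y = Suc (cov_rank L X)"
        using covers_iff_rank[OF YL(1) X(1)] X(3) by blast
      moreover have "zs Z \<subset> zs X" using Z(4) YX covers_nonempty[OF YL(3)] by blast
      ultimately show ?thesis using covers_iff_rank[OF Z(1) X(1)] by linarith
    qed
    \<comment> \<open>Off \<open>zs Y\<close> the topes \<open>T\<close> and \<open>V\<close> carry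
      the signs of \<open>Y\<close> and \<open>W\<close>, and \<open>X\<close> was chosen so that
      these differ on \<open>zs X - zs Y\<close>.\<close>
    moreover have far: "zs X - zs Y \<subseteq> dis T V"
    proof
      fix f assume f: "f \<in> zs X - zs Y"
      then have "T f = Y f" "V f = W f"
        using eq_off_zs[OF YL(1) tope_in[OF T] YL(2)] eq_off_zs[OF WL(1) tope_in[OF V] WL(2)] zY by auto
      moreover have "Y f \<noteq> W f" using X(4) f by (auto simp: dis_def)
      ultimately show "f \<in> dis T V" by (simp add: dis_def)
    qed
    then have "visible T V Z" using Z by (auto simp: visible_def)
    moreover have "zs X \<subseteq> dis T T'" using far disV YL(4) by blast
    ultimately show ?thesis using X by blast
  qed
  have zs_unique: "Y = Z" if "visible T T' Y" "visible T T' Z" "zs Y = zs Z" for Y Z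
  proof
    fix e show "Y e = Z e"
    proof (cases "e \<in> zs Y")
      case False
      then show ?thesis
        using eq_off_zs[OF _ tope_in[OF T], of Y e] eq_off_zs[OF _ tope_in[OF T], of Z e] Yv[OF that(1)] Yv[OF that(2)] that(3)
        by simp
    next
      case True
      then have "e \<in> zs Z" using that(3) by simp
      then show ?thesis using True by (simp add: zs_def)
    qed
  qed
  have nV: "T \<noteq> V" if "visible T V Y" for Y
    using covers_nonempty that by (auto simp: visible_def dis_def)
  note pr = less.prems(3,4,5)
  show ?case
  proof (cases "zs Y0 = zs W")
    case True
    show ?thesis
    proof (cases "zs Z0 = zs W")
      case Z: True
      then show ?thesis using zs_unique[OF pr(1,2)] True pr(3) by simp
    next
      case False
      then have vZ: "visible T V Z0" using visV pr(2) by blast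
      obtain X Z where XZ: "visible T V Z" "X \<in> L" "X \<preceq> Y0" "X \<preceq> Z" "covers (zs Y0) (zs X)"
        "covers (zs Z) (zs X)" "zs X \<subseteq> dis T T'" using new[OF pr(1) True nV[OF vZ]] by metis
      have "P Z" using link[OF pr(1) vis_mono[OF XZ(1)] XZ(2-7) pr(3)] .
      then show ?thesis using IH[OF XZ(1) vZ] by blast
    qed
  next
    case False
    then have vY: "visible T V Y0" using visV pr(1) by blast
    show ?thesis
    proof (cases "zs Z0 = zs W")
      case True
      obtain X Z where XZ: "visible T V Z" "X \<in> L" "X \<preceq> Z0" "X \<preceq> Z" "covers (zs Z0) (zs X)"
        "covers (zs Z) (zs X)" "zs X \<subseteq> dis T T'" using new[OF pr(2) True nV[OF vY]] by metis
      have "P Z" using IH[OF vY XZ(1) pr(3)] .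
      then show ?thesis
        using link[OF vis_mono[OF XZ(1)] pr(2) XZ(2,4,3,6,5,7)] by blast
    next
      case False
      then show ?thesis using IH[OF vY _ pr(3)] visV[OF pr(2)] by blast
    qed
  qed
qed

end

section \<open>The star of a covector\<close>

lemma restr_comp: "restr D (X \<odot> Y) = restr D X \<odot> restr D Y"
  by (rule ext) (simp add: restr_def comp_apply)

lemma restr_opp: "restr D (opp X) = opp (restr D X)"
  by (rule ext) (simp add: restr_def)

lemma restr_mono: "X \<preceq> Y \<Longrightarrow> restr D X \<preceq> restr D Y"
  by (auto simp: restr_def cov_le_iff)

lemma restr_between: "between T U V \<Longrightarrow> between (restr D T) (restr D U) (restr D V)"
  by (auto simp: restr_def between_def)

context loopless
begin

lemma restr_loopless:
  assumes D: "D \<subseteq> E"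
  shows "loopless D (restr D ` L)"
proof unfold_locales
  have "restr D (\<lambda>e. Zero) = (\<lambda>e. Zero)" by (rule ext) (simp add: restr_def)
  then have zero: "(\<lambda>e. Zero) \<in> restr D ` L" using zero_in by (metis image_eqI)
  have neg: "(\<lambda>e. sign_neg (X e)) \<in> restr D ` L" if X: "X \<in> restr D ` L" for X
  proof -
    obtain X' where X': "X' \<in> L" "X = restr D X'" using X by blast
    then have "(\<lambda>e. sign_neg (X e)) = restr D (opp X')" by (simp add: restr_def fun_eq_iff)
    then show ?thesis using opp_in[OF X'(1)] by blast
  qed
  have comp: "X \<odot> Y \<in> restr D ` L" if XY: "X \<in> restr D ` L" "Y \<in> restr D ` L" for X Y
  proof -
    obtain X' Y' where X': "X' \<in> L" "X = restr D X'" "Y' \<in> L" "Y = restr D Y'" using XY by blast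
    then have "X \<odot> Y = restr D (X' \<odot> Y')" by (simp add: restr_comp)
    then show ?thesis using comp_in[OF X'(1,3)] by blast
  qed
  have elim: "\<exists>Z\<in>restr D ` L. Z e = Zero \<and> (\<forall>f\<in>D - separation X Y. Z f = (X \<odot> Y) f)"
    if XY: "X \<in> restr D ` L" "Y \<in> restr D ` L" "e \<in> separation X Y" for X Y e
  proof -
    obtain X' Y' where X': "X' \<in> L" "X = restr D X'" and Y': "Y' \<in> L" "Y = restr D Y'" using XY by blast
    have e: "X' e \<noteq> Zero" "Y' e = sign_neg (X' e)"
      using XY(3) X' Y' by (auto simp: separation_def restr_def split: if_splits)
    obtain Z where Z: "Z \<in> L" "Z e = Zero"
      "\<And>f. X' f = Zero \<or> Y' f \<noteq> sign_neg (X' f) \<Longrightarrow> Z f = (X' \<odot> Y') f"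
      by (rule eliminate[OF X'(1) Y'(1) e]) (rule that)
    have "restr D Z f = (X \<odot> Y) f" if "f \<in> D - separation X Y" for f
      using Z(3)[of f] that X' Y' by (auto simp: restr_def separation_def comp_apply)
    moreover have "restr D Z e = Zero" using Z(2) by (simp add: restr_def)
    ultimately show ?thesis using Z(1) by blast
  qed
  have fin: "finite D" using D finE finite_subset by blast
  have out: "X e = Zero" if "X \<in> restr D ` L" "e \<notin> D" for X e
    using that by (auto simp: restr_def)
  show "oriented_matroid D (restr D ` L)"
    unfolding oriented_matroid_def
    by (intro conjI ballI allI impI) (fact fin, erule (1) out, fact zero, erule neg, erule (1) comp, erule (2) elim)
  show "no_loops D (restr D ` L)" unfolding no_loops_def
  proof
    fix e assume e: "e \<in> D"
    then obtain X where "X \<in> L" "X e \<noteq> Zero" using nl D unfolding no_loops_def by blast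
    then show "\<exists>X\<in>restr D ` L. X e \<noteq> Zero" using e by (auto simp: restr_def)
  qed
qed

text \<open>Restricting to \<open>zs X\<close> is localizing at \<open>X\<close>: composition with
  \<open>X\<close> selects the representative above \<open>X\<close>.\<close>

lemma restr_zs_eq_iff:
  assumes "X \<in> L" "Y \<in> L" "Z \<in> L"
  shows "restr (zs X) Y = restr (zs X) Z \<longleftrightarrow> X \<odot> Y = X \<odot> Z"
proof -
  have "restr (zs X) Y e = restr (zs X) Z e \<longleftrightarrow> (X \<odot> Y) e = (X \<odot> Z) e" for e
    using outside[OF assms(1), of e] outside[OF assms(2), of e] outside[OF assms(3), of e]
    by (cases "e \<in> E") (auto simp: restr_def zs_def comp_apply)
  then show ?thesis by (simp add: fun_eq_iff)
qed

lemma restr_zs_comp: "X \<in> L \<Longrightarrow> restr (zs X) (X \<odot> Z) = restr (zs X) Z"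
  by (rule ext) (simp add: restr_def zs_def comp_apply)

lemma star_mem:
  assumes X: "X \<in> L" "X \<in> P" and P: "polyhedron E L P" and Z: "Z \<in> L"
  shows "restr (zs X) Z \<in> restr (zs X) ` P \<longleftrightarrow> X \<odot> Z \<in> P"
proof
  assume "restr (zs X) Z \<in> restr (zs X) ` P"
  then obtain Y where Y: "Y \<in> P" "restr (zs X) Z = restr (zs X) Y" by blast
  then have "X \<odot> Z = X \<odot> Y" using restr_zs_eq_iff X(1) Z polyhedron_sub[OF P] by blast
  then show "X \<odot> Z \<in> P" using polyhedron_comp[OF P X(2) Y(1)] by simp
next
  assume "X \<odot> Z \<in> P"
  then show "restr (zs X) Z \<in> restr (zs X) ` P" using restr_zs_comp[OF X(1), of Z] by (metis image_eqI)
qed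

lemma star_mem_above:
  assumes "X \<in> L" "X \<in> P" "polyhedron E L P" "Z \<in> L" "X \<preceq> Z"
  shows "restr (zs X) Z \<in> restr (zs X) ` P \<longleftrightarrow> Z \<in> P"
  using star_mem[OF assms(1-4)] comp_absorb[OF assms(5)] by simp

lemma star_sub:
  assumes X: "X \<in> L" "X \<in> P" and P: "polyhedron E L P" and Q: "Q \<subseteq> L"
    and sub: "restr (zs X) ` Q \<subseteq> restr (zs X) ` P" and Z: "Z \<in> Q" "X \<preceq> Z"
  shows "Z \<in> P"
  using star_mem_above[OF X P _ Z(2)] Z Q sub by blast

lemma star_Int:
  assumes X: "X \<in> L" "X \<in> P" "X \<in> Q" and P: "polyhedron E L P" and Q: "polyhedron E L Q"
  shows "restr (zs X) ` P \<inter> restr (zs X) ` Q = restr (zs X) ` (P \<inter> Q)"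
proof
  show "restr (zs X) ` P \<inter> restr (zs X) ` Q \<subseteq> restr (zs X) ` (P \<inter> Q)"
  proof
    fix W assume W: "W \<in> restr (zs X) ` P \<inter> restr (zs X) ` Q"
    then obtain Z where Z: "Z \<in> P" "W = restr (zs X) Z" by blast
    have ZL: "Z \<in> L" using Z(1) polyhedron_sub[OF P] by blast
    have "restr (zs X) Z \<in> restr (zs X) ` P" "restr (zs X) Z \<in> restr (zs X) ` Q"
      using W unfolding Z(2) by simp_all
    then have "X \<odot> Z \<in> P \<inter> Q"
      unfolding star_mem[OF X(1,2) P ZL] star_mem[OF X(1,3) Q ZL] by simp
    then show "W \<in> restr (zs X) ` (P \<inter> Q)"
      unfolding Z(2) restr_zs_comp[OF X(1), of Z, symmetric] by (rule imageI)
  qed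
qed blast

text \<open>A bound violated by \<open>X \<odot> Z\<close> but respected by \<open>X\<close> must be
  tight at \<open>X\<close>, so its element lies in \<open>zs X\<close> and survives the
  restriction.\<close>

lemma star_polyhedron:
  assumes X: "X \<in> L" "X \<in> P" and P: "polyhedron E L P"
  shows "polyhedron (zs X) (restr (zs X) ` L) (restr (zs X) ` P)"
proof -
  interpret S: loopless "zs X" "restr (zs X) ` L" using restr_loopless[OF zs_subset] .
  show ?thesis unfolding S.polyhedron_iff
  proof (intro conjI ballI)
    show "restr (zs X) ` P \<subseteq> restr (zs X) ` L" using polyhedron_sub[OF P] by blast
    fix W assume W: "W \<in> restr (zs X) ` L - restr (zs X) ` P"
    then obtain Z where Z: "Z \<in> L" "W = restr (zs X) Z" by blast
    then have "X \<odot> Z \<notin> P" using star_mem[OF X P, of Z] W by simp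
    then obtain e s where e: "bounds P e s" "(X \<odot> Z) e = sign_neg s"
      using polyhedron_sep[OF P comp_in[OF X(1) Z(1)]] by metis
    have s: "s \<noteq> Zero" "X e = Zero \<or> X e = s" using boundsD[OF e(1)] X(2) by blast+
    then have Xe: "X e = Zero" using e(2) by (auto simp: comp_apply)
    moreover have "e \<in> E" using e(1) by (simp add: bounds_def)
    ultimately have eX: "e \<in> zs X" by (simp add: zs_def)
    have "S.bounds (restr (zs X) ` P) e s"
      using boundsD(1)[OF e(1)] s(1) eX by (auto simp: S.bounds_def restr_def)
    moreover have "W e = sign_neg s" using Z(2) eX Xe e(2) by (simp add: restr_def comp_apply)
    ultimately show "\<exists>e s. S.bounds (restr (zs X) ` P) e s \<and> W e = sign_neg s" by blast
  qed
qed

text \<open>Above \<open>X\<close>, moving from \<open>Z\<close> against \<open>V\<close> or against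
  \<open>X \<odot> V\<close> is the same, and \<open>X\<close> itself lies in the smallest face at
  \<open>Z\<close>; membership can thus be tested on representatives above \<open>X\<close>.\<close>

lemma star_relface:
  assumes X: "X \<in> L" and P: "polyhedron E L P" and Z: "Z \<in> P" "X \<preceq> Z"
  shows "relface (restr (zs X) ` P) (restr (zs X) Z) = restr (zs X) ` relface P Z"
    and "X \<in> relface P Z" and "X \<in> P"
proof -
  show XP: "X \<in> P" using polyhedron_down[OF P Z(1) X Z(2)] .
  have ZX: "Z \<odot> opp X = Z"
    using Z(2) by (intro ext) (auto simp: comp_apply cov_le_iff)
  then show XF: "X \<in> relface P Z" using XP Z(1) by (simp add: relface_def)
  have ZL: "Z \<in> L" using Z(1) polyhedron_sub[OF P] by blast
  have eq: "restr (zs X) V \<in> relface (restr (zs X) ` P) (restr (zs X) Z) \<longleftrightarrow>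
      restr (zs X) V \<in> restr (zs X) ` relface P Z" if V: "V \<in> L" for V
  proof -
    have "Z \<odot> opp (X \<odot> V) = Z \<odot> opp V"
      using Z(2) by (intro ext) (auto simp: comp_apply cov_le_iff)
    moreover have "X \<odot> (Z \<odot> opp V) = Z \<odot> opp V"
      using comp_assoc[of X Z "opp V"] comp_absorb[OF Z(2)] by simp
    moreover have "restr (zs X) Z \<odot> opp (restr (zs X) V) = restr (zs X) (Z \<odot> opp V)"
      by (simp add: restr_comp restr_opp)
    ultimately have "restr (zs X) V \<in> relface (restr (zs X) ` P) (restr (zs X) Z) \<longleftrightarrow>
        X \<odot> V \<in> relface P Z"
      using star_mem[OF X XP P V] star_mem[OF X XP P comp_in[OF ZL opp_in[OF V]]]
      by (simp add: relface_def)
    then show ?thesis using star_mem[OF X XF relface_polyhedron[OF P Z(1)] V] by simp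
  qed
  have sub: "relface (restr (zs X) ` P) (restr (zs X) Z) \<subseteq> restr (zs X) ` L"
    using relface_subset polyhedron_sub[OF P] by blast
  have sub': "restr (zs X) ` relface P Z \<subseteq> restr (zs X) ` L"
    using relface_subset polyhedron_sub[OF P] by blast
  show "relface (restr (zs X) ` P) (restr (zs X) Z) = restr (zs X) ` relface P Z"
  proof (rule set_eqI)
    fix W
    show "W \<in> relface (restr (zs X) ` P) (restr (zs X) Z) \<longleftrightarrow> W \<in> restr (zs X) ` relface P Z"
    proof (cases "W \<in> restr (zs X) ` L")
      case True
      then obtain V where "V \<in> L" "W = restr (zs X) V" by (rule imageE)
      then show ?thesis using eq by simp
    next
      case False
      then show ?thesis using subsetD[OF sub] subsetD[OF sub'] by metis
    qed
  qed
qed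

text \<open>This is the complex \<open>C\<close> seen from \<open>X\<close>. It is indexed by a
  covector and not by a face, since it is also needed where \<open>X\<close> is not generic in a
  face of corank 2.\<close>

definition star :: "'a covector set set \<Rightarrow> 'a covector \<Rightarrow> 'a covector set set" where
  "star C X = {restr (zs X) ` R | R. R \<in> C \<and> X \<in> R}"

lemma star_complex:
  assumes C: "polyhedral_complex E L C" and X: "X \<in> Supp C"
  shows "polyhedral_complex (zs X) (restr (zs X) ` L) (star C X)"
proof -
  interpret S: loopless "zs X" "restr (zs X) ` L" using restr_loopless[OF zs_subset] .
  let ?r = "restr (zs X)"
  obtain R0 where R0: "R0 \<in> C" "X \<in> R0" using X by (auto simp: Supp_def)
  have XL: "X \<in> L" using R0 complexD(3)[OF C] polyhedron_sub by blast
  have rep: "\<exists>Z. Z \<in> R \<and> X \<preceq> Z \<and> W = ?r Z" if R: "R \<in> C" "X \<in> R" "W \<in> ?r ` R" for R W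
  proof -
    obtain Z where "Z \<in> R" "W = ?r Z" using R(3) by blast
    then have "X \<odot> Z \<in> R" "W = ?r (X \<odot> Z)"
      using polyhedron_comp[OF complexD(3)[OF C R(1)] R(2)] restr_zs_comp[OF XL, of Z] by simp_all
    then show ?thesis using le_comp by blast
  qed
  show ?thesis
  proof (rule S.polyhedral_complexI)
    have "star C X = (\<lambda>R. ?r ` R) ` {R \<in> C. X \<in> R}" by (auto simp: star_def)
    then show "finite (star C X)" using complexD(1)[OF C] by simp
    show "star C X \<noteq> {}" using R0 by (auto simp: star_def)
  next
    fix Q assume "Q \<in> star C X"
    then obtain R where "R \<in> C" "X \<in> R" "Q = ?r ` R" by (auto simp: star_def)
    then show "polyhedron (zs X) (?r ` L) Q" using star_polyhedron[OF XL _ complexD(3)[OF C]] by simp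
  next
    fix Q W assume Q: "Q \<in> star C X" and W: "W \<in> Q"
    obtain R where R: "R \<in> C" "X \<in> R" "Q = ?r ` R" using Q by (auto simp: star_def)
    obtain Z where Z: "Z \<in> R" "X \<preceq> Z" "W = ?r Z" using rep[OF R(1,2)] W R(3) by blast
    have "relface Q W = ?r ` relface R Z" "X \<in> relface R Z"
      using star_relface[OF XL complexD(3)[OF C R(1)] Z(1,2)] R(3) Z(3) by simp_all
    then show "relface Q W \<in> star C X" using complex_relface[OF C R(1) Z(1)] by (auto simp: star_def)
  next
    fix Q Q' W assume Q: "Q \<in> star C X" "Q' \<in> star C X" and W: "W \<in> Q" "W \<in> Q'"
    obtain R where R: "R \<in> C" "X \<in> R" "Q = ?r ` R" using Q(1) by (auto simp: star_def)
    obtain R' where R': "R' \<in> C" "X \<in> R'" "Q' = ?r ` R'" using Q(2) by (auto simp: star_def)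
    obtain Z where Z: "Z \<in> R" "X \<preceq> Z" "W = ?r Z" using rep[OF R(1,2)] W(1) R(3) by blast
    have "Z \<in> L" using Z(1) polyhedron_sub[OF complexD(3)[OF C R(1)]] by blast
    then have Z': "Z \<in> R'"
      using star_mem_above[OF XL R'(2) complexD(3)[OF C R'(1)] _ Z(2)] W(2) R'(3) Z(3) by simp
    have "relface Q W = ?r ` relface R Z"
      using star_relface(1)[OF XL complexD(3)[OF C R(1)] Z(1,2)] R(3) Z(3) by simp
    moreover have "relface Q' W = ?r ` relface R' Z"
      using star_relface(1)[OF XL complexD(3)[OF C R'(1)] Z' Z(2)] R'(3) Z(3) by simp
    moreover have "relface R Z = relface R' Z" by (rule complex_agree[OF C R(1) R'(1) Z(1) Z'])
    ultimately show "relface Q W = relface Q' W" by simp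
  qed
qed

text \<open>The flats of the restriction are the flats of \<open>L\<close> inside
  \<open>zs X\<close>; a saturated chain there ends at \<open>zs X\<close> and continues in
  \<open>L\<close> up to \<open>E\<close>.\<close>

lemma star_rank:
  assumes X: "X \<in> L" and Z: "Z \<in> L" "X \<preceq> Z"
  shows "cov_rank (restr (zs X) ` L) (restr (zs X) Z) + cov_rank L X = cov_rank L Z"
proof -
  interpret S: loopless "zs X" "restr (zs X) ` L" using restr_loopless[OF zs_subset] .
  have Szs: "S.zs (restr (zs X) V) = zs X \<inter> zs V" for V
    unfolding S.zs_def by (auto simp: zs_def restr_def)
  have Sflats: "S.flats = {B \<in> flats. B \<subseteq> zs X}"
  proof
    show "S.flats \<subseteq> {B \<in> flats. B \<subseteq> zs X}"
      using flat_Int[OF zs_flat[OF X] zs_flat] by (auto simp: S.flats_def Szs)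
    show "{B \<in> flats. B \<subseteq> zs X} \<subseteq> S.flats"
    proof
      fix B assume B: "B \<in> {B \<in> flats. B \<subseteq> zs X}"
      then obtain V where "V \<in> L" "B = zs V" by (auto simp: flats_def)
      moreover from this have "S.zs (restr (zs X) V) = B" using B Szs by auto
      ultimately show "B \<in> S.flats" using S.zs_flat by (metis imageI)
    qed
  qed
  have covers: "covers B D" if "S.covers B D" for B D
    using that unfolding S.covers_def covers_def Sflats by blast
  have height: "flat_height B (k + frank (zs X))" if "S.flat_height B k" for B k
    using that
  proof (induction rule: S.flat_height.induct)
    case top
    then show ?case using frank_height[OF zs_flat[OF X]] by simp
  next
    case (cover B D k)
    then show ?case using flat_height.cover[OF covers] by simp
  qed
  have zZ: "S.zs (restr (zs X) Z) = zs Z" using Szs zs_mono[OF Z(2)] by auto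
  have "S.flat_height (zs Z) (S.frank (zs Z))"
    using S.frank_height S.zs_flat[of "restr (zs X) Z"] Z(1) zZ by simp
  then have "frank (zs Z) = S.frank (zs Z) + frank (zs X)" using frank_eq height by blast
  then show ?thesis using cov_rank_frank X Z(1) S.cov_rank_frank[of "restr (zs X) Z"] zZ by simp
qed

lemma star_poly_rank:
  assumes X: "X \<in> L" "X \<in> P" and P: "polyhedron E L P"
  shows "poly_rank (restr (zs X) ` L) (restr (zs X) ` P) + cov_rank L X = poly_rank L P"
proof -
  interpret S: loopless "zs X" "restr (zs X) ` L" using restr_loopless[OF zs_subset] .
  obtain W where W: "generic P W" "X \<preceq> W" using polyhedron_generic[OF P X(2)] by metis
  have WP: "W \<in> P" "W \<in> L" using W(1) polyhedron_sub[OF P] by (auto simp: generic_def)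
  have "S.generic (restr (zs X) ` P) (restr (zs X) W)"
    unfolding S.generic_def
  proof (intro conjI ballI)
    show "restr (zs X) W \<in> restr (zs X) ` P" using WP by blast
    fix V assume "V \<in> restr (zs X) ` P"
    then obtain Y where Y: "Y \<in> P" "V = restr (zs X) Y" by blast
    have "zs W \<subseteq> zs Y" using W(1) Y(1) by (simp add: generic_def)
    then show "S.zs (restr (zs X) W) \<subseteq> S.zs V"
      unfolding S.zs_def Y(2) by (auto simp: zs_def restr_def)
  qed
  then show ?thesis
    using S.poly_rank_eq[OF star_polyhedron[OF X P]] poly_rank_eq[OF P W(1)]
      star_rank[OF X(1) WP(2) W(2)] by simp
qed

end

section \<open>Adjacency edges as walls, and their behaviour in stars\<close>

lemma adj_edges_iff:
  "{M, N} \<in> adj_edges L n C \<longleftrightarrow>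
     M \<in> adj_vertices L n C \<and> N \<in> adj_vertices L n C \<and> poly_rank L (M \<inter> N) + 1 = n"
proof
  assume "{M, N} \<in> adj_edges L n C"
  then obtain M' N' where d: "{M, N} = {M', N'}" "M' \<in> adj_vertices L n C"
    "N' \<in> adj_vertices L n C" "poly_rank L (M' \<inter> N') + 1 = n" by (auto simp: adj_edges_def)
  then have "(M = M' \<and> N = N') \<or> (M = N' \<and> N = M')" by (simp add: doubleton_eq_iff)
  then show "M \<in> adj_vertices L n C \<and> N \<in> adj_vertices L n C \<and> poly_rank L (M \<inter> N) + 1 = n"
    using d(2-4) by (auto simp: Int_commute)
qed (auto simp: adj_edges_def)

lemma adj_edgesE:
  assumes "d \<in> adj_edges L n C"
  obtains M N where "d = {M, N}"
  using assms by (auto simp: adj_edges_def)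

context loopless
begin

lemma generic_perp_ground:
  assumes "F \<subseteq> L" "generic F X"
  shows "perp_ground E L F = zs X"
  using assms by (auto simp: perp_ground_def generic_def halfspace_simps zs_def)

lemma generic_sub_iff:
  assumes C: "polyhedral_complex E L C" and F: "F \<in> C" "generic F X" and M: "M \<in> C"
  shows "F \<subseteq> M \<longleftrightarrow> X \<in> M"
proof
  assume "X \<in> M"
  then have "relface F X = relface M X" using complex_agree[OF C F(1) M] F(2) by (auto simp: generic_def)
  then show "F \<subseteq> M"
    using relface_generic[OF polyhedron_sub[OF complexD(3)[OF C F(1)]] F(2)] relface_subset by metis
qed (use F(2) in \<open>auto simp: generic_def\<close>)

lemma member_is_face:
  assumes C: "polyhedral_complex E L C" and R: "R \<in> C" "generic R W" and M: "M \<in> C" "W \<in> M"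
  shows "R = relface M W"
proof -
  have "relface R W = relface M W" using complex_agree[OF C R(1) M(1) _ M(2)] R(2) by (auto simp: generic_def)
  then show ?thesis using relface_generic[OF polyhedron_sub[OF complexD(3)[OF C R(1)]] R(2)] by simp
qed

lemma coarse_cell:
  assumes C: "polyhedral_complex E L C" and co: "coarsens C' C"
    and M: "M \<in> C" "tope T" "T \<in> M" and Q: "Q \<in> C'" "T \<in> Q"
  shows "M \<subseteq> Q"
proof -
  obtain R where R: "R \<in> C" "T \<in> R" "R \<subseteq> Q" using co Q by (fastforce simp: coarsens_def)
  then show ?thesis using complex_tope_unique[OF C M(1) R(1) M(2,3)] by blast
qed

lemma adj_vertices_iff:
  assumes "polyhedral_complex E L C"
  shows "M \<in> adj_vertices L (om_rank L) C \<longleftrightarrow> M \<in> C \<and> (\<exists>T\<in>M. tope T)"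
  using poly_rank_full_iff[OF complexD(3)[OF assms]] by (auto simp: adj_vertices_def)

text \<open>A generic covector of \<open>M \<inter> N\<close> has its flat between the empty set and
  \<open>zs Y\<close>. It is no tope because \<open>M \<noteq> N\<close>, so the flat is
  \<open>zs Y\<close> and the rank is that of \<open>Y\<close>.\<close>

lemma wall_adj_edge:
  assumes C: "polyhedral_complex E L C" and M: "M \<in> C" "T \<in> M" and N: "N \<in> C" "U \<in> N"
    and neq: "M \<noteq> N" and w: "wall T U Y"
  shows "{M, N} \<in> adj_edges L (om_rank L) C"
proof -
  note wd = wallD[OF w]
  have pM: "polyhedron E L M" and pN: "polyhedron E L N" using complexD(3)[OF C] M N by auto
  have pI: "polyhedron E L (M \<inter> N)" using polyhedron_Int[OF pM pN] .
  have Y: "Y \<in> M \<inter> N"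
    using polyhedron_down[OF pM M(2) wd(4,5)] polyhedron_down[OF pN N(2) wd(4,6)] by blast
  obtain X where X: "generic (M \<inter> N) X" using polyhedron_generic[OF pI Y] by metis
  then have XI: "X \<in> M" "X \<in> N" "zs X \<subseteq> zs Y" using Y by (auto simp: generic_def)
  have XL: "X \<in> L" using XI(1) polyhedron_sub[OF pM] by blast
  have "zs X \<noteq> {}" using complex_tope_unique[OF C M(1) N(1) _ XI(1,2)] XL neq by (auto simp: tope_def)
  then have "zs X = zs Y" using wd(7) zs_flat[OF XL] XI(3) unfolding covers_def by blast
  then have "cov_rank L X = cov_rank L Y" using cov_rank_cong XL wd(4) by blast
  then have "poly_rank L (M \<inter> N) + 1 = om_rank L"
    using poly_rank_eq[OF pI X] covers_empty_iff[OF wd(4)] wd(7) by simp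
  moreover have "M \<in> adj_vertices L (om_rank L) C" "N \<in> adj_vertices L (om_rank L) C"
    using adj_vertices_iff[OF C] M N wd by blast+
  ultimately show ?thesis by (simp add: adj_edges_iff)
qed

text \<open>Take \<open>Y\<close> generic in \<open>M \<inter> N\<close> and compose it with a tope
  of each cell.\<close>

lemma adj_edge_wall:
  assumes C: "polyhedral_complex E L C" and e: "{M, N} \<in> adj_edges L (om_rank L) C"
  obtains T U Y where "wall T U Y" "T \<in> M" "U \<in> N" "M \<noteq> N" "M \<in> C" "N \<in> C"
proof -
  have V: "M \<in> adj_vertices L (om_rank L) C" "N \<in> adj_vertices L (om_rank L) C"
    and r: "poly_rank L (M \<inter> N) + 1 = om_rank L"
    using e by (simp_all add: adj_edges_iff)
  have MN: "M \<in> C" "N \<in> C" using V adj_vertices_iff[OF C] by auto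
  obtain A B where A: "A \<in> M" "tope A" and B: "B \<in> N" "tope B"
    using V adj_vertices_iff[OF C] by auto
  have pM: "polyhedron E L M" and pN: "polyhedron E L N" using complexD(3)[OF C] MN by auto
  have pI: "polyhedron E L (M \<inter> N)" using polyhedron_Int[OF pM pN] .
  obtain Y where Y: "generic (M \<inter> N) Y" using polyhedron_generic[OF pI zero_in_polyhedron[OF pI]] by metis
  then have YI: "Y \<in> M" "Y \<in> N" by (auto simp: generic_def)
  have YL: "Y \<in> L" using YI(1) polyhedron_sub[OF pM] by blast
  have cY: "covers {} (zs Y)" using covers_empty_iff[OF YL] r poly_rank_eq[OF pI Y] by simp
  have neq: "M \<noteq> N"
  proof
    assume "M = N"
    then have "poly_rank L (M \<inter> N) = om_rank L" using V(1) by (simp add: adj_vertices_def)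
    then show False using r by simp
  qed
  have t: "tope (Y \<odot> A)" "tope (Y \<odot> B)" using tope_comp YL A B by auto
  have m: "Y \<odot> A \<in> M" "Y \<odot> B \<in> N" using polyhedron_comp pM pN YI A B by auto
  have "Y \<odot> A \<noteq> Y \<odot> B" using complex_tope_unique[OF C MN t(1) m(1)] m(2) neq by metis
  then have "wall (Y \<odot> A) (Y \<odot> B) Y" using t YL cY by (simp add: wall_def)
  then show thesis using that m neq MN by metis
qed

lemma star_tope: "tope T \<Longrightarrow> loopless.tope (zs X) (restr (zs X) ` L) (restr (zs X) T)"
proof -
  assume T: "tope T"
  interpret S: loopless "zs X" "restr (zs X) ` L" using restr_loopless[OF zs_subset] .
  have "S.zs (restr (zs X) T) = {}" unfolding S.zs_def
    using tope_nonzero[OF T] zs_subset[of X] by (auto simp: restr_def)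
  then show ?thesis using tope_in[OF T] by (simp add: S.tope_def)
qed

lemma star_Supp:
  assumes C: "polyhedral_complex E L C" and X: "X \<in> L" and int: "\<And>Z. Z \<in> L \<Longrightarrow> X \<preceq> Z \<Longrightarrow> Z \<in> Supp C"
  shows "Supp (star C X) = restr (zs X) ` L"
proof
  show "Supp (star C X) \<subseteq> restr (zs X) ` L"
    using polyhedron_sub[OF complexD(3)[OF C]] by (auto simp: Supp_def star_def)
  show "restr (zs X) ` L \<subseteq> Supp (star C X)"
  proof
    fix W assume "W \<in> restr (zs X) ` L"
    then obtain Z where Z: "Z \<in> L" "W = restr (zs X) Z" by blast
    have "X \<odot> Z \<in> Supp C" using int[OF comp_in[OF X Z(1)]] le_comp by blast
    then obtain R where R: "R \<in> C" "X \<odot> Z \<in> R" by (auto simp: Supp_def)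
    then have "X \<in> R" using polyhedron_down[OF complexD(3)[OF C R(1)] R(2) X] le_comp by blast
    moreover have "W \<in> restr (zs X) ` R" using R(2) Z(2) restr_zs_comp[OF X, of Z] by (metis imageI)
    ultimately show "W \<in> Supp (star C X)" using R(1) by (auto simp: Supp_def star_def)
  qed
qed

lemma star_coarsens:
  assumes C: "polyhedral_complex E L C" and C': "polyhedral_complex E L C'"
    and co: "coarsens C' C" and X: "X \<in> L" and int: "\<And>Z. Z \<in> L \<Longrightarrow> X \<preceq> Z \<Longrightarrow> Z \<in> Supp C"
  shows "coarsens (star C' X) (star C X)"
  unfolding coarsens_def
proof (intro conjI ballI)
  have SC: "Supp C' = Supp C" using co by (simp add: coarsens_def)
  show "Supp (star C' X) = Supp (star C X)"
    using star_Supp[OF C X int] star_Supp[OF C' X] int SC by simp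
  fix Q assume "Q \<in> star C' X"
  then obtain Q' where Q': "Q' \<in> C'" "X \<in> Q'" "Q = restr (zs X) ` Q'" by (auto simp: star_def)
  obtain T where T: "T \<subseteq> C" "Q' = \<Union>T" using co Q'(1) by (auto simp: coarsens_def)
  let ?T = "{restr (zs X) ` R | R. R \<in> T \<and> X \<in> R}"
  have "Q \<subseteq> \<Union>?T"
  proof
    fix W assume "W \<in> Q"
    then obtain Z where Z: "Z \<in> Q'" "W = restr (zs X) Z" using Q'(3) by blast
    have "X \<odot> Z \<in> Q'" using polyhedron_comp[OF complexD(3)[OF C' Q'(1)] Q'(2) Z(1)] .
    then obtain R where R: "R \<in> T" "X \<odot> Z \<in> R" using T(2) by blast
    then have "X \<in> R" using polyhedron_down[OF complexD(3)[OF C] R(2) X] T(1) le_comp by blast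
    moreover have "W \<in> restr (zs X) ` R" using R(2) Z(2) restr_zs_comp[OF X, of Z] by (metis imageI)
    ultimately show "W \<in> \<Union>?T" using R(1) by blast
  qed
  moreover have "\<Union>?T \<subseteq> Q" using T(2) Q'(3) by blast
  ultimately have "Q = \<Union>?T" by (rule equalityI)
  moreover have "?T \<subseteq> star C X" using T(1) by (auto simp: star_def)
  ultimately show "\<exists>S\<subseteq>star C X. Q = \<Union>S" by blast
qed

text \<open>A tope of \<open>M\<close> pushed above \<open>X\<close> also lies in \<open>N\<close>,
  and topes determine their cell. Hence transported edges determine the original ones.\<close>

lemma star_cell_inj:
  assumes C: "polyhedral_complex E L C" and X: "X \<in> L"
    and M: "M \<in> adj_vertices L (om_rank L) C" "X \<in> M" and N: "N \<in> C" "X \<in> N"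
    and sub: "restr (zs X) ` M \<subseteq> restr (zs X) ` N"
  shows "M = N"
proof -
  obtain T where T: "T \<in> M" "tope T" "M \<in> C" using M(1) adj_vertices_iff[OF C] by auto
  have t: "X \<odot> T \<in> M" "tope (X \<odot> T)"
    using polyhedron_comp[OF complexD(3)[OF C T(3)] M(2) T(1)] tope_comp[OF X T(2)] by auto
  have "X \<odot> T \<in> N"
    using star_sub[OF X N(2) complexD(3)[OF C N(1)] polyhedron_sub[OF complexD(3)[OF C T(3)]] sub t(1)] le_comp
    by blast
  then show ?thesis using complex_tope_unique[OF C T(3) N(1) t(2,1)] by simp
qed

lemma star_adj_vertices:
  assumes C: "polyhedral_complex E L C" and X: "X \<in> L" and r: "cov_rank L X + k = n"
  shows "adj_vertices (restr (zs X) ` L) k (star C X) =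
    (`) (restr (zs X)) ` {M \<in> adj_vertices L n C. X \<in> M}"
proof -
  have "poly_rank (restr (zs X) ` L) (restr (zs X) ` R) = k \<longleftrightarrow> poly_rank L R = n"
    if "R \<in> C" "X \<in> R" for R
    using star_poly_rank[OF X that(2) complexD(3)[OF C that(1)]] r by auto
  then show ?thesis unfolding adj_vertices_def star_def by auto
qed

lemma star_adj_edges:
  assumes C: "polyhedral_complex E L C" and X: "X \<in> L" and r: "cov_rank L X + 2 = om_rank L"
    and M: "M \<in> adj_vertices L (om_rank L) C" "X \<in> M" and N: "N \<in> adj_vertices L (om_rank L) C" "X \<in> N"
  shows "{restr (zs X) ` M, restr (zs X) ` N} \<in> adj_edges (restr (zs X) ` L) 2 (star C X) \<longleftrightarrow>
    {M, N} \<in> adj_edges L (om_rank L) C"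
proof -
  have p: "polyhedron E L M" "polyhedron E L N" using M(1) N(1) adj_vertices_iff[OF C] complexD(3)[OF C] by auto
  have "poly_rank (restr (zs X) ` L) (restr (zs X) ` M \<inter> restr (zs X) ` N) + cov_rank L X = poly_rank L (M \<inter> N)"
    using star_Int[OF X M(2) N(2) p] star_poly_rank[OF X _ polyhedron_Int[OF p]] M(2) N(2) by simp
  then show ?thesis using M N r by (auto simp: adj_edges_iff star_adj_vertices[OF C X r])
qed

text \<open>The condition that the polygon property imposes at a face \<open>F\<close>, expressed through a covector
  \<open>X\<close> in the relative interior of \<open>F\<close>.\<close>

definition local_coarsening ::
  "'a covector set set \<Rightarrow> 'a covector set set set \<Rightarrow> 'a covector \<Rightarrow> 'a covector set set \<Rightarrow> bool" where
  "local_coarsening C EE X D \<longleftrightarrow>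
     polyhedral_complex (zs X) (restr (zs X) ` L) D \<and> coarsens D (star C X) \<and>
     (`) ((`) (restr (zs X))) ` {d \<in> EE. d \<subseteq> {M \<in> adj_vertices L (om_rank L) C. X \<in> M}} =
       edge_set (restr (zs X) ` L) 2 (star C X) D"

lemma local_coarsening_star:
  assumes C: "polyhedral_complex E L C" and C': "polyhedral_complex E L C'" and co: "coarsens C' C"
    and X: "X \<in> L" and r: "cov_rank L X + 2 = om_rank L"
    and int: "\<And>Z. Z \<in> L \<Longrightarrow> X \<preceq> Z \<Longrightarrow> Z \<in> Supp C"
  shows "local_coarsening C (edge_set L (om_rank L) C C') X (star C' X)"
  unfolding local_coarsening_def
proof (intro conjI)
  let ?r = "restr (zs X)" and ?n = "om_rank L"
  have "X \<in> Supp C'" using int[OF X] co by (simp add: coarsens_def)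
  then show "polyhedral_complex (zs X) (?r ` L) (star C' X)" by (rule star_complex[OF C'])
  show "coarsens (star C' X) (star C X)" by (rule star_coarsens[OF C C' co X int])
  let ?V = "{M \<in> adj_vertices L ?n C. X \<in> M}"
  show "(`) ((`) ?r) ` {d \<in> edge_set L ?n C C'. d \<subseteq> ?V} = edge_set (?r ` L) 2 (star C X) (star C' X)"
  proof (rule set_eqI, rule iffI)
    fix d' assume "d' \<in> (`) ((`) ?r) ` {d \<in> edge_set L ?n C C'. d \<subseteq> ?V}"
    then obtain d where d: "d \<in> edge_set L ?n C C'" "d \<subseteq> ?V" "d' = (`) ?r ` d" by blast
    then obtain Q where Q: "Q \<in> C'" "\<forall>M\<in>d. M \<subseteq> Q" and dE: "d \<in> adj_edges L ?n C"
      by (auto simp: edge_set_def)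
    obtain M N where MN: "d = {M, N}" using adj_edgesE[OF dE] by metis
    have "d' = {?r ` M, ?r ` N}" using d(3) MN by simp
    moreover have "{?r ` M, ?r ` N} \<in> adj_edges (?r ` L) 2 (star C X)"
      using star_adj_edges[OF C X r, of M N] d(2) dE MN by simp
    moreover have "?r ` Q \<in> star C' X" "?r ` M \<subseteq> ?r ` Q" "?r ` N \<subseteq> ?r ` Q"
      using Q d(2) MN by (auto simp: star_def)
    ultimately show "d' \<in> edge_set (?r ` L) 2 (star C X) (star C' X)"
      by (auto simp: edge_set_def)
  next
    fix d' assume "d' \<in> edge_set (?r ` L) 2 (star C X) (star C' X)"
    then obtain Q where Q: "Q \<in> star C' X" "\<forall>m\<in>d'. m \<subseteq> Q" and
      dE: "d' \<in> adj_edges (?r ` L) 2 (star C X)" by (auto simp: edge_set_def)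
    obtain m k where mk: "d' = {m, k}" using adj_edgesE[OF dE] by metis
    then have "m \<in> adj_vertices (?r ` L) 2 (star C X)" "k \<in> adj_vertices (?r ` L) 2 (star C X)"
      using dE by (simp_all add: adj_edges_iff)
    then obtain M N where M: "M \<in> adj_vertices L ?n C" "X \<in> M" "m = ?r ` M"
      and N: "N \<in> adj_vertices L ?n C" "X \<in> N" "k = ?r ` N"
      unfolding star_adj_vertices[OF C X r] by blast
    have e: "{M, N} \<in> adj_edges L ?n C"
      using star_adj_edges[OF C X r M(1,2) N(1,2)] dE mk M(3) N(3) by simp
    obtain Q' where Q': "Q' \<in> C'" "X \<in> Q'" "Q = ?r ` Q'" using Q(1) by (auto simp: star_def)
    \<comment> \<open>Local containment yields a tope above \<open>X\<close> common to
      \<open>R\<close> and \<open>Q'\<close>; the coarse member \<open>Q'\<close> then swallows the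
      whole cell.\<close>
    have sub: "R \<subseteq> Q'" if R: "R \<in> adj_vertices L ?n C" "X \<in> R" "?r ` R \<subseteq> Q" for R
    proof -
      obtain T where T: "T \<in> R" "tope T" "R \<in> C" using R(1) adj_vertices_iff[OF C] by auto
      have t: "X \<odot> T \<in> R" "tope (X \<odot> T)"
        using polyhedron_comp[OF complexD(3)[OF C T(3)] R(2) T(1)] tope_comp[OF X T(2)] by auto
      have "X \<odot> T \<in> Q'"
        using star_sub[OF X Q'(2) complexD(3)[OF C' Q'(1)] polyhedron_sub[OF complexD(3)[OF C T(3)]] _ t(1)]
          R(3) Q'(3) le_comp by blast
      then show ?thesis using coarse_cell[OF C co T(3) t(2,1) Q'(1)] by blast
    qed
    have "M \<subseteq> Q'" "N \<subseteq> Q'" using sub M N Q(2) mk by auto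
    then have "{M, N} \<in> edge_set L ?n C C'" using e Q'(1) by (auto simp: edge_set_def)
    moreover have "{M, N} \<subseteq> ?V" using M N by auto
    moreover have "d' = (`) ?r ` {M, N}" using mk M(3) N(3) by simp
    ultimately show "d' \<in> (`) ((`) ?r) ` {d \<in> edge_set L ?n C C'. d \<subseteq> ?V}" by blast
  qed
qed

end

section \<open>Complexes of full rank and the polygon property at covectors\<close>

locale full_complex = loopless +
  fixes C
  assumes C: "polyhedral_complex E L C" and S: "polyhedron E L (Supp C)"
    and full: "\<exists>T\<in>Supp C. tope T"
begin

abbreviation "cells \<equiv> adj_vertices L (om_rank L) C"

lemma cells_iff: "M \<in> cells \<longleftrightarrow> M \<in> C \<and> (\<exists>T\<in>M. tope T)"
  by (rule adj_vertices_iff[OF C])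

lemma poly: "M \<in> C \<Longrightarrow> polyhedron E L M"
  by (rule complexD(3)[OF C])

lemma cell_exists:
  assumes X: "X \<in> Supp C"
  obtains M where "M \<in> cells" "X \<in> M"
proof -
  obtain T where T: "T \<in> Supp C" "tope T" using full by blast
  have XL: "X \<in> L" using X polyhedron_sub[OF S] by blast
  have "X \<odot> T \<in> Supp C" using polyhedron_comp[OF S X T(1)] .
  then obtain M where M: "M \<in> C" "X \<odot> T \<in> M" by (auto simp: Supp_def)
  then have "X \<in> M" using polyhedron_down[OF poly[OF M(1)] M(2) XL] le_comp by blast
  then show thesis using that cells_iff M tope_comp[OF XL T(2)] by blast
qed

text \<open>The local complex consists of faces of cones of full cells. Nothing of the star is
  missed: a generic \<open>W\<close> of a member lies in some cell, and the member is the smallest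
  face of that cell at \<open>W\<close>.\<close>

lemma local_complex_star:
  assumes F: "F \<in> C" "generic F X"
  shows "local_complex E L (om_rank L) C F = star C X"
    and "polygon L (om_rank L) C F = {M \<in> cells. X \<in> M}"
    and "perp_ground E L F = zs X"
proof -
  have XF: "X \<in> F" using F(2) by (simp add: generic_def)
  have XS: "X \<in> Supp C" using F XF by (auto simp: Supp_def)
  have XL: "X \<in> L" using XF polyhedron_sub[OF poly[OF F(1)]] by blast
  show pg: "perp_ground E L F = zs X" by (rule generic_perp_ground[OF polyhedron_sub[OF poly[OF F(1)]] F(2)])
  show poly_eq: "polygon L (om_rank L) C F = {M \<in> cells. X \<in> M}"
    using generic_sub_iff[OF C F] by (auto simp: polygon_def cells_iff)
  interpret S: loopless "zs X" "restr (zs X) ` L" using restr_loopless[OF zs_subset] .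
  have sC: "polyhedral_complex (zs X) (restr (zs X) ` L) (star C X)" by (rule star_complex[OF C XS])
  have "local_complex E L (om_rank L) C F =
      (\<Union>M \<in> {M \<in> cells. X \<in> M}. faces (zs X) (restr (zs X) ` L) (restr (zs X) ` M))"
    by (simp add: local_complex_def poly_eq pg Perp_def local_cone_def)
  also have "\<dots> = star C X"
  proof
    show "(\<Union>M \<in> {M \<in> cells. X \<in> M}. faces (zs X) (restr (zs X) ` L) (restr (zs X) ` M)) \<subseteq> star C X"
    proof (rule UN_least)
      fix M assume "M \<in> {M \<in> cells. X \<in> M}"
      then have "restr (zs X) ` M \<in> star C X" by (auto simp: star_def cells_iff)
      then show "faces (zs X) (restr (zs X) ` L) (restr (zs X) ` M) \<subseteq> star C X"
        using sC by (simp add: polyhedral_complex_def)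
    qed
    show "star C X \<subseteq> (\<Union>M \<in> {M \<in> cells. X \<in> M}. faces (zs X) (restr (zs X) ` L) (restr (zs X) ` M))"
    proof
      fix Q assume "Q \<in> star C X"
      then obtain R where R: "R \<in> C" "X \<in> R" "Q = restr (zs X) ` R" by (auto simp: star_def)
      obtain W where W: "generic R W" "X \<preceq> W" using polyhedron_generic[OF poly[OF R(1)] R(2)] by metis
      have "W \<in> R" using W(1) by (simp add: generic_def)
      then obtain M where M: "M \<in> cells" "W \<in> M" using cell_exists R(1) by (metis UnionI Supp_def)
      then have MC: "M \<in> C" by (simp add: cells_iff)
      have "R = relface M W" by (rule member_is_face[OF C R(1) W(1) MC M(2)])
      then have Q: "Q = relface (restr (zs X) ` M) (restr (zs X) W)" and XM: "X \<in> M"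
        using star_relface[OF XL poly[OF MC] M(2) W(2)] R(3) by simp_all
      have "Q \<in> faces (zs X) (restr (zs X) ` L) (restr (zs X) ` M)"
        unfolding Q S.faces_eq[OF star_polyhedron[OF XL XM poly[OF MC]]] using M(2) by blast
      then show "Q \<in> (\<Union>M \<in> {M \<in> cells. X \<in> M}. faces (zs X) (restr (zs X) ` L) (restr (zs X) ` M))"
        using M(1) XM by blast
    qed
  qed
  finally show "local_complex E L (om_rank L) C F = star C X" .
qed

text \<open>A face outside the boundary has some covector whose filter stays in the support. Filters
  shrink upwards, so a generic covector above it does as well.\<close>

lemma polygon_property_iff:
  "polygon_property E L (om_rank L) C EE \<longleftrightarrow>
    (\<forall>F\<in>C. \<forall>X. generic F X \<and> cov_rank L X + 2 = om_rank L \<and> (\<forall>Z\<in>L. X \<preceq> Z \<longrightarrow> Z \<in> Supp C) \<longrightarrow>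
      (\<exists>D. local_coarsening C EE X D))"
proof -
  have loc: "(polyhedral_complex (perp_ground E L F) (Perp E L F) D \<and>
             coarsens D (local_complex E L (om_rank L) C F) \<and>
             (\<lambda>d. local_cone E L F ` d) ` {d \<in> EE. d \<subseteq> polygon L (om_rank L) C F} =
               edge_set (Perp E L F) 2 (local_complex E L (om_rank L) C F) D) \<longleftrightarrow> local_coarsening C EE X D"
    if F: "F \<in> C" "generic F X" for F X D
  proof -
    have "local_cone E L F = (`) (restr (zs X))" by (rule ext) (simp add: local_cone_def local_complex_star[OF F])
    then show ?thesis unfolding local_coarsening_def by (simp add: local_complex_star[OF F] Perp_def)
  qed
  have rank: "poly_rank L F = cov_rank L X" if "F \<in> C" "generic F X" for F X
    using poly_rank_eq[OF poly] that by blast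
  have bd: "\<not> F \<subseteq> ideal_boundary L (Supp C) \<longleftrightarrow>
      (\<exists>X. generic F X \<and> (\<forall>Z\<in>L. X \<preceq> Z \<longrightarrow> Z \<in> Supp C))" if F: "F \<in> C" for F
  proof
    assume "\<not> F \<subseteq> ideal_boundary L (Supp C)"
    then obtain X0 where X0: "X0 \<in> F" "\<And>Z. Z \<in> L \<Longrightarrow> X0 \<preceq> Z \<Longrightarrow> Z \<in> Supp C"
      using F unfolding ideal_boundary_def Supp_def by blast
    obtain X where "generic F X" "X0 \<preceq> X" using polyhedron_generic[OF poly[OF F] X0(1)] by metis
    then show "\<exists>X. generic F X \<and> (\<forall>Z\<in>L. X \<preceq> Z \<longrightarrow> Z \<in> Supp C)" using X0(2) cov_le_trans by blast
  next
    assume "\<exists>X. generic F X \<and> (\<forall>Z\<in>L. X \<preceq> Z \<longrightarrow> Z \<in> Supp C)"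
    then show "\<not> F \<subseteq> ideal_boundary L (Supp C)"
      by (auto simp: ideal_boundary_def generic_def)
  qed
  show ?thesis unfolding polygon_property_def
  proof (intro iffI ballI allI impI)
    fix F X
    assume all: "\<forall>F\<in>C. poly_rank L F + 2 = om_rank L \<and> \<not> F \<subseteq> ideal_boundary L (Supp C) \<longrightarrow>
        (\<exists>D. polyhedral_complex (perp_ground E L F) (Perp E L F) D \<and>
             coarsens D (local_complex E L (om_rank L) C F) \<and>
             (\<lambda>d. local_cone E L F ` d) ` {d \<in> EE. d \<subseteq> polygon L (om_rank L) C F} =
               edge_set (Perp E L F) 2 (local_complex E L (om_rank L) C F) D)"
      and F: "F \<in> C"
      and X: "generic F X \<and> cov_rank L X + 2 = om_rank L \<and> (\<forall>Z\<in>L. X \<preceq> Z \<longrightarrow> Z \<in> Supp C)"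
    have g: "generic F X" using X by blast
    have "poly_rank L F + 2 = om_rank L" using rank[OF F g] X by simp
    moreover have "\<not> F \<subseteq> ideal_boundary L (Supp C)" using bd[OF F] X by blast
    ultimately show "\<exists>D. local_coarsening C EE X D" using bspec[OF all F] unfolding loc[OF F g] by simp
  next
    fix F
    assume all: "\<forall>F\<in>C. \<forall>X. generic F X \<and> cov_rank L X + 2 = om_rank L \<and>
        (\<forall>Z\<in>L. X \<preceq> Z \<longrightarrow> Z \<in> Supp C) \<longrightarrow> (\<exists>D. local_coarsening C EE X D)"
      and F: "F \<in> C" and r: "poly_rank L F + 2 = om_rank L \<and> \<not> F \<subseteq> ideal_boundary L (Supp C)"
    obtain X where X: "generic F X" "\<forall>Z\<in>L. X \<preceq> Z \<longrightarrow> Z \<in> Supp C" using bd[OF F] r by blast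
    then have "\<exists>D. local_coarsening C EE X D" using all F r rank[OF F X(1)] by auto
    then show "\<exists>D. polyhedral_complex (perp_ground E L F) (Perp E L F) D \<and>
             coarsens D (local_complex E L (om_rank L) C F) \<and>
             (\<lambda>d. local_cone E L F ` d) ` {d \<in> EE. d \<subseteq> polygon L (om_rank L) C F} =
               edge_set (Perp E L F) 2 (local_complex E L (om_rank L) C F) D"
      unfolding loc[OF F X(1)] .
  qed
qed

lemma coarsening_polygon_property:
  assumes "polyhedral_complex E L C'" "coarsens C' C"
  shows "polygon_property E L (om_rank L) C (edge_set L (om_rank L) C C')"
  unfolding polygon_property_iff
proof (intro ballI allI impI)
  fix F X
  assume F: "F \<in> C"
    and X: "generic F X \<and> cov_rank L X + 2 = om_rank L \<and> (\<forall>Z\<in>L. X \<preceq> Z \<longrightarrow> Z \<in> Supp C)"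
  have "X \<in> L" using X polyhedron_sub[OF poly[OF F]] by (auto simp: generic_def)
  then show "\<exists>D. local_coarsening C (edge_set L (om_rank L) C C') X D"
    using local_coarsening_star[OF C assms, of X] X by blast
qed

end

section \<open>From local to global convexity\<close>

context loopless
begin

lemma finite_dis: "T \<in> L \<Longrightarrow> U \<in> L \<Longrightarrow> finite (dis T U)"
proof -
  assume "T \<in> L" "U \<in> L"
  then have "T e = U e" if "e \<notin> E" for e using outside[OF _ that] by metis
  then have "dis T U \<subseteq> E" by (auto simp: dis_def)
  then show ?thesis using finE finite_subset by blast
qed

lemma between_card_less:
  "T \<in> L \<Longrightarrow> T' \<in> L \<Longrightarrow> between T U T' \<Longrightarrow> U \<noteq> T \<Longrightarrow> card (dis U T') < card (dis T T')"
  by (intro psubset_card_mono finite_dis between_dis_strict)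

text \<open>A minimal gallery from \<open>T\<close> to \<open>U\<close> as an induction rule:
  \<open>P\<close> starts at \<open>U\<close> and is carried back to \<open>T\<close>, the distance
  to \<open>U\<close> being the measure.\<close>

lemma gallery_induct [consumes 2, case_names base step]:
  assumes "tope T" "tope U" and base: "P U"
    and step: "\<And>V W Y. wall V W Y \<Longrightarrow> between T V U \<Longrightarrow> between T W U \<Longrightarrow> between V W U \<Longrightarrow> P W \<Longrightarrow> P V"
  shows "P T"
proof -
  have "P V" if "tope V" "between T V U" for V
    using that
  proof (induction "card (dis V U)" arbitrary: V rule: less_induct)
    case less
    show ?case
    proof (cases "V = U")
      case False
      obtain W Y where W: "wall V W Y" "between V W U" using wall_step[OF less.prems(1) assms(2) False] by metis
      have TW: "between T W U" using between_extend[OF less.prems(2) W(2)] .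
      have "card (dis W U) < card (dis V U)"
        using between_card_less[OF tope_in tope_in W(2)] less.prems(1) assms(2) wallD(3)[OF W(1)] by metis
      then have "P W" using less.hyps wallD(2)[OF W(1)] TW by blast
      then show ?thesis using step[OF W(1) less.prems(2) TW W(2)] by blast
    qed (use base in simp)
  qed
  then show ?thesis using assms(1) between_refl(1) by blast
qed

lemma wall_flip:
  assumes w: "wall T U Y" and b: "between T U T'" and T': "T' \<in> L"
  shows "U = Y \<odot> T'" and "visible T T' Y"
proof -
  show "U = Y \<odot> T'"
  proof
    fix e show "U e = (Y \<odot> T') e"
    proof (cases "e \<in> zs Y")
      case True
      then have "U e = T' e" using wall_zs[OF w] b unfolding between_def by metis
      then show ?thesis using True by (simp add: zs_def comp_apply)
    next
      case False
      then have "U e = Y e" using eq_off_zs[OF wallD(4)[OF w] tope_in[OF wallD(2)[OF w]] wallD(6)[OF w]] by blast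
      moreover have "Y e = Zero \<Longrightarrow> T' e = Zero"
        using False outside[OF T', of e] by (auto simp: zs_def)
      ultimately show ?thesis by (simp add: comp_apply)
    qed
  qed
  have "zs Y \<subseteq> dis T T'"
  proof
    fix e assume "e \<in> zs Y"
    then have "T e \<noteq> U e" "U e = T e \<or> U e = T' e" using wall_zs[OF w] b by (auto simp: between_def)
    then show "e \<in> dis T T'" by (auto simp: dis_def)
  qed
  then show "visible T T' Y" using wallD[OF w] by (simp add: visible_def)
qed

lemma cov_rank_le: "X \<in> L \<Longrightarrow> cov_rank L X \<le> om_rank L"
proof -
  assume X: "X \<in> L"
  obtain T where T: "tope T" using tope_exists by blast
  have "zs X = {} \<or> zs T \<subset> zs X" using T by (auto simp: tope_def)
  then show ?thesis
    using cov_rank_less[OF tope_in[OF T] X] om_rank_tope[OF T] rank_eq_iff[OF X] X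
    unfolding tope_def by linarith
qed

text \<open>\<open>T\<close> and \<open>T'\<close> are opposite around \<open>X\<close>, so on
  \<open>zs X\<close> every nonzero sign is one of theirs.\<close>

lemma opposite_between:
  assumes X: "X \<in> L" "X \<preceq> T" "X \<preceq> T'" and opp: "zs X \<subseteq> dis T T'" and T: "tope T" "tope T'"
    and V: "tope V" "X \<preceq> V"
  shows "between T V T'"
  unfolding between_def
proof
  fix e show "V e = T e \<or> V e = T' e"
  proof (cases "e \<in> zs X")
    case True
    then have "e \<in> E" "T e \<noteq> T' e" using opp zs_subset by (auto simp: dis_def)
    then show ?thesis using sign_two[of "T e" "T' e" "V e"] tope_nonzero T V(1) by blast
  next
    case False
    then show ?thesis using eq_off_zs[OF X(1) tope_in] X T V by metis
  qed
qed

end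

section \<open>Passable walls and local models\<close>

locale polygon_edges = full_complex +
  fixes EE
  assumes EE: "EE \<subseteq> adj_edges L (om_rank L) C"
    and pp: "polygon_property E L (om_rank L) C EE"
begin

text \<open>Stated for topes, so that galleries may also move inside one cell; a tope lies in at
  most one cell, so the witnesses are determined.\<close>

definition passable :: "'a covector \<Rightarrow> 'a covector \<Rightarrow> bool" where
  "passable T U \<longleftrightarrow> (\<exists>M\<in>C. \<exists>N\<in>C. T \<in> M \<and> U \<in> N \<and> (M = N \<or> {M, N} \<in> EE))"

definition interior :: "'a covector \<Rightarrow> bool" where
  "interior X \<longleftrightarrow> X \<in> L \<and> (\<forall>Z\<in>L. X \<preceq> Z \<longrightarrow> Z \<in> Supp C)"

text \<open>A complete local complex at \<open>X\<close> whose members contain two adjacent topes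
  together exactly when the wall between them is passable. It mentions no edge set, so it can also
  be supplied where the polygon property gives none.\<close>

definition model :: "'a covector \<Rightarrow> 'a covector set set \<Rightarrow> bool" where
  "model X D \<longleftrightarrow> polyhedral_complex (zs X) (restr (zs X) ` L) D \<and> Supp D = restr (zs X) ` L \<and>
     (\<forall>T U Y. wall T U Y \<and> X \<preceq> T \<and> X \<preceq> U \<longrightarrow>
        (passable T U \<longleftrightarrow> (\<exists>Q\<in>D. restr (zs X) T \<in> Q \<and> restr (zs X) U \<in> Q)))"

lemma passable_sym: "passable T U \<Longrightarrow> passable U T"
  unfolding passable_def by (metis insert_commute)

lemma tope_cell:
  assumes "tope T" "T \<in> Supp C"
  obtains M where "M \<in> cells" "T \<in> M" "M \<in> C"
  using cell_exists[OF assms(2)] cells_iff by metis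

lemma passable_iff:
  assumes T: "tope T" "T \<in> M" "M \<in> C" and U: "tope U" "U \<in> N" "N \<in> C"
  shows "passable T U \<longleftrightarrow> M = N \<or> {M, N} \<in> EE"
proof
  assume "passable T U"
  then obtain M' N' where M': "M' \<in> C" "N' \<in> C" "T \<in> M'" "U \<in> N'" "M' = N' \<or> {M', N'} \<in> EE"
    unfolding passable_def by blast
  then have "M' = M" "N' = N" using complex_tope_unique[OF C] T U by metis+
  then show "M = N \<or> {M, N} \<in> EE" using M'(5) by simp
qed (use assms in \<open>auto simp: passable_def\<close>)

lemma below_in_cell: "M \<in> C \<Longrightarrow> T \<in> M \<Longrightarrow> X \<in> L \<Longrightarrow> X \<preceq> T \<Longrightarrow> X \<in> M"
  using polyhedron_down[OF poly] by blast

lemma model_all_passable: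
  assumes all: "\<And>T U Y. wall T U Y \<Longrightarrow> X \<preceq> T \<Longrightarrow> X \<preceq> U \<Longrightarrow> passable T U"
  shows "model X {restr (zs X) ` L}"
proof -
  interpret S: loopless "zs X" "restr (zs X) ` L" using restr_loopless[OF zs_subset] .
  have rel: "relface (restr (zs X) ` L) W = restr (zs X) ` L" if "W \<in> restr (zs X) ` L" for W
    using S.comp_in S.opp_in that by (auto simp: relface_def)
  have "polyhedral_complex (zs X) (restr (zs X) ` L) {restr (zs X) ` L}"
  proof (rule S.polyhedral_complexI)
    show "polyhedron (zs X) (restr (zs X) ` L) P" if "P \<in> {restr (zs X) ` L}" for P
      using that S.polyhedron_L by simp
  qed (use rel in auto)
  moreover have "\<exists>Q\<in>{restr (zs X) ` L}. restr (zs X) T \<in> Q \<and> restr (zs X) U \<in> Q" if "wall T U Y" for T U Y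
    using wallD(1,2)[OF that] tope_in by blast
  ultimately show ?thesis using all unfolding model_def Supp_def by (simp, blast)
qed

lemma model_local_coarsening:
  assumes X: "interior X" and r: "cov_rank L X + 2 = om_rank L" and D: "local_coarsening C EE X D"
  shows "model X D"
proof -
  let ?r = "restr (zs X)"
  interpret S: loopless "zs X" "restr (zs X) ` L" using restr_loopless[OF zs_subset] .
  have XL: "X \<in> L" and int: "\<And>Z. Z \<in> L \<Longrightarrow> X \<preceq> Z \<Longrightarrow> Z \<in> Supp C" using X by (auto simp: interior_def)
  let ?V = "{M \<in> cells. X \<in> M}"
  have Dc: "polyhedral_complex (zs X) (?r ` L) D" and co: "coarsens D (star C X)"
    and edges: "(`) ((`) ?r) ` {d \<in> EE. d \<subseteq> ?V} = edge_set (?r ` L) 2 (star C X) D"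
    using D by (auto simp: local_coarsening_def)
  have Supp: "Supp D = ?r ` L" using co star_Supp[OF C XL int] by (simp add: coarsens_def)
  have sC: "polyhedral_complex (zs X) (?r ` L) (star C X)"
    by (rule star_complex[OF C int[OF XL]]) simp
  have inside: "?r ` M \<subseteq> Q" if M: "M \<in> C" "X \<in> M" "T \<in> M" "tope T" and Q: "Q \<in> D" "?r T \<in> Q" for M T Q
  proof (rule S.coarse_cell[OF sC co _ star_tope[OF M(4)] _ Q])
    show "?r ` M \<in> star C X" using M by (auto simp: star_def)
  qed (use M in auto)
  have "passable T U \<longleftrightarrow> (\<exists>Q\<in>D. ?r T \<in> Q \<and> ?r U \<in> Q)" if w: "wall T U Y" and XT: "X \<preceq> T" "X \<preceq> U" for T U Y
  proof -
    have T: "tope T" "tope U" "T \<in> L" "U \<in> L" using wallD[OF w] tope_in by auto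
    obtain M where M: "M \<in> cells" "T \<in> M" "M \<in> C" using tope_cell[OF T(1) int[OF T(3) XT(1)]] by metis
    obtain N where N: "N \<in> cells" "U \<in> N" "N \<in> C" using tope_cell[OF T(2) int[OF T(4) XT(2)]] by metis
    have XM: "X \<in> M" "X \<in> N" using below_in_cell M N XL XT by auto
    have p: "passable T U \<longleftrightarrow> M = N \<or> {M, N} \<in> EE" using passable_iff T M N by blast
    show ?thesis
    proof
      assume "passable T U"
      then consider "M = N" | "{M, N} \<in> EE" using p by blast
      then show "\<exists>Q\<in>D. ?r T \<in> Q \<and> ?r U \<in> Q"
      proof cases
        case 1
        obtain Q where Q: "Q \<in> D" "?r T \<in> Q" using Supp T(3) by (auto simp: Supp_def)
        then have "?r ` M \<subseteq> Q" using inside[OF M(3) XM(1) M(2) T(1)] by blast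
        then show ?thesis using Q N(2) 1 by blast
      next
        case 2
        then have "(`) ?r ` {M, N} \<in> edge_set (?r ` L) 2 (star C X) D"
          unfolding edges[symmetric] using M N XM by (intro imageI) simp
        then obtain Q where "Q \<in> D" "?r ` M \<subseteq> Q" "?r ` N \<subseteq> Q" by (auto simp: edge_set_def)
        then show ?thesis using M(2) N(2) by blast
      qed
    next
      assume "\<exists>Q\<in>D. ?r T \<in> Q \<and> ?r U \<in> Q"
      then obtain Q where Q: "Q \<in> D" "?r T \<in> Q" "?r U \<in> Q" by blast
      show "passable T U"
      proof (cases "M = N")
        case False
        have "{M, N} \<in> adj_edges L (om_rank L) C" by (rule wall_adj_edge[OF C M(3,2) N(3,2) False w])
        then have "{?r ` M, ?r ` N} \<in> adj_edges (?r ` L) 2 (star C X)"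
          using star_adj_edges[OF C XL r M(1) XM(1) N(1) XM(2)] by simp
        moreover have "?r ` M \<subseteq> Q" "?r ` N \<subseteq> Q" using inside M N XM T Q by blast+
        ultimately have "{?r ` M, ?r ` N} \<in> edge_set (?r ` L) 2 (star C X) D"
          using Q(1) by (auto simp: edge_set_def)
        then obtain d where d: "d \<in> EE" "d \<subseteq> ?V" "{?r ` M, ?r ` N} = (`) ?r ` d"
          unfolding edges[symmetric] by blast
        obtain M' N' where d': "d = {M', N'}" using adj_edgesE[OF subsetD[OF EE d(1)]] by metis
        then have V': "M' \<in> cells" "X \<in> M'" "N' \<in> cells" "X \<in> N'" using d(2) by auto
        then have C': "M' \<in> C" "N' \<in> C" using cells_iff by auto
        have "?r ` M = ?r ` M' \<and> ?r ` N = ?r ` N' \<or> ?r ` M = ?r ` N' \<and> ?r ` N = ?r ` M'"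
          using d(3) d' by (auto simp: doubleton_eq_iff)
        then have "{M, N} = d"
        proof
          assume a: "?r ` M = ?r ` M' \<and> ?r ` N = ?r ` N'"
          have "M = M'" using star_cell_inj[OF C XL M(1) XM(1) C'(1) V'(2)] a by simp
          moreover have "N = N'" using star_cell_inj[OF C XL N(1) XM(2) C'(2) V'(4)] a by simp
          ultimately show ?thesis using d' by simp
        next
          assume a: "?r ` M = ?r ` N' \<and> ?r ` N = ?r ` M'"
          have "M = N'" using star_cell_inj[OF C XL M(1) XM(1) C'(2) V'(4)] a by simp
          moreover have "N = M'" using star_cell_inj[OF C XL N(1) XM(2) C'(1) V'(2)] a by simp
          ultimately show ?thesis using d' by (simp add: insert_commute)
        qed
        then show ?thesis using p d(1) by simp
      qed (use p in simp)
    qed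
  qed
  then show ?thesis unfolding model_def using Dc Supp by blast
qed

text \<open>If no edge of \<open>EE\<close> is crossed around \<open>X\<close>, passing a wall means
  staying in one cell, which the unmodified star records.\<close>

lemma model_star:
  assumes X: "interior X" and sep: "\<And>T U Y M N. wall T U Y \<Longrightarrow> X \<preceq> T \<Longrightarrow> X \<preceq> U \<Longrightarrow>
      M \<in> C \<Longrightarrow> N \<in> C \<Longrightarrow> T \<in> M \<Longrightarrow> U \<in> N \<Longrightarrow> {M, N} \<in> EE \<Longrightarrow> M = N"
  shows "model X (star C X)"
proof -
  let ?r = "restr (zs X)"
  have XL: "X \<in> L" and int: "\<And>Z. Z \<in> L \<Longrightarrow> X \<preceq> Z \<Longrightarrow> Z \<in> Supp C" using X by (auto simp: interior_def)
  have "polyhedral_complex (zs X) (?r ` L) (star C X)" by (rule star_complex[OF C int[OF XL]]) simp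
  moreover have "passable T U \<longleftrightarrow> (\<exists>Q\<in>star C X. ?r T \<in> Q \<and> ?r U \<in> Q)"
    if w: "wall T U Y" and XT: "X \<preceq> T" "X \<preceq> U" for T U Y
  proof
    assume "passable T U"
    then obtain M where "M \<in> C" "T \<in> M" "U \<in> M" using sep[OF w XT] unfolding passable_def by metis
    moreover from this have "X \<in> M" using below_in_cell XL XT by blast
    ultimately show "\<exists>Q\<in>star C X. ?r T \<in> Q \<and> ?r U \<in> Q" unfolding star_def by blast
  next
    assume "\<exists>Q\<in>star C X. ?r T \<in> Q \<and> ?r U \<in> Q"
    then obtain R where R: "R \<in> C" "X \<in> R" "?r T \<in> ?r ` R" "?r U \<in> ?r ` R" by (auto simp: star_def)
    have "T \<in> L" "U \<in> L" using wallD[OF w] tope_in by auto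
    then have "T \<in> R" "U \<in> R"
      using star_mem_above[OF XL R(2) poly[OF R(1)]] R(3,4) XT by simp_all
    then show "passable T U" using R(1) by (auto simp: passable_def)
  qed
  ultimately show ?thesis unfolding model_def using star_Supp[OF C XL int] by blast
qed

text \<open>The cells around an interior covector \<open>X\<close> of corank 2 fit together like a complex in rank 2.
  If \<open>X\<close> lies in the relative interior of a face of rank \<open>n - 2\<close>, this is the polygon property;
  otherwise at most two cells contain \<open>X\<close>.\<close>

lemma model_exists:
  assumes X: "interior X" and r: "cov_rank L X + 2 = om_rank L"
  shows "\<exists>D. model X D"
proof (cases "\<forall>T U Y. wall T U Y \<longrightarrow> X \<preceq> T \<longrightarrow> X \<preceq> U \<longrightarrow> passable T U")
  case True
  then show ?thesis using model_all_passable by blast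
next
  case not_all: False
  have XL: "X \<in> L" and int: "\<And>Z. Z \<in> L \<Longrightarrow> X \<preceq> Z \<Longrightarrow> Z \<in> Supp C" using X by (auto simp: interior_def)
  obtain R where R: "R \<in> cells" "X \<in> R" using cell_exists[OF int[OF XL]] by auto
  then have RC: "R \<in> C" by (simp add: cells_iff)
  define F where "F = relface R X"
  have FC: "F \<in> C" using complex_relface[OF C RC R(2)] by (simp add: F_def)
  have XF: "X \<in> F" using relface_self[OF R(2)] by (simp add: F_def)
  obtain W where W: "generic F W" "X \<preceq> W" using polyhedron_generic[OF poly[OF FC] XF] by metis
  have WF: "W \<in> F" using W(1) by (simp add: generic_def)
  then have WL: "W \<in> L" using polyhedron_sub[OF poly[OF FC]] by blast
  show ?thesis
  proof (cases "W = X")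
    case True
    then have "generic F X" using W(1) by simp
    then obtain D where "local_coarsening C EE X D"
      using pp[unfolded polygon_property_iff] FC r X unfolding interior_def by blast
    then show ?thesis using model_local_coarsening[OF X r] by blast
  next
    case False
    \<comment> \<open>All cells containing \<open>X\<close> share the same smallest face
      \<open>F\<close> at \<open>X\<close>, hence contain \<open>W\<close>.\<close>
    have Wcell: "W \<in> K" if K: "K \<in> C" "X \<in> K" for K
      using complex_agree[OF C RC K(1) R(2) K(2)] WF relface_subset[of K X] unfolding F_def by blast
    have top: "\<exists>V. tope V \<and> W \<preceq> V \<and> V \<in> K" if K: "K \<in> cells" "X \<in> K" for K
    proof -
      obtain A where A: "K \<in> C" "A \<in> K" "tope A" using K(1) cells_iff by auto
      have "W \<odot> A \<in> K" using polyhedron_comp[OF poly[OF A(1)] Wcell[OF A(1) K(2)] A(2)] .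
      then show ?thesis using tope_comp[OF WL A(3)] le_comp by blast
    qed
    \<comment> \<open>\<open>W\<close> lies strictly above \<open>X\<close>, so its corank is at
      most 1. Two different cells exclude corank 0, and only two topes lie above a covector of
      corank 1.\<close>
    have two: "K = M \<or> K = N" if M: "M \<in> cells" "X \<in> M" and N: "N \<in> cells" "X \<in> N"
      and neq: "M \<noteq> N" and K: "K \<in> cells" "X \<in> K" for M N K
    proof -
      have CC: "M \<in> C" "N \<in> C" "K \<in> C" using M N K cells_iff by auto
      obtain A where A: "tope A" "W \<preceq> A" "A \<in> M" using top[OF M] by blast
      obtain B where B: "tope B" "W \<preceq> B" "B \<in> N" using top[OF N] by blast
      obtain V where V: "tope V" "W \<preceq> V" "V \<in> K" using top[OF K] by blast
      have AB: "A \<noteq> B" using complex_tope_unique[OF C CC(1,2) A(1,3)] B(3) neq by blast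
      have "cov_rank L X < cov_rank L W" using cov_rank_less[OF WL XL] le_neq_zs[OF XL WL W(2)] False by blast
      moreover have "cov_rank L W \<noteq> om_rank L"
      proof
        assume "cov_rank L W = om_rank L"
        then have "zs W = {}" using rank_eq_iff[OF WL] by (simp add: tope_def)
        then have "W = A" "W = B" using le_zs_eq[OF WL tope_in] A B by simp_all
        then show False using AB by simp
      qed
      ultimately have "cov_rank L W + 1 = om_rank L" using cov_rank_le[OF WL] r by linarith
      then have "wall A B W" using A B AB WL covers_empty_iff[OF WL] by (simp add: wall_def)
      then have "V = A \<or> V = B" using wall_topes V by blast
      then show ?thesis using complex_tope_unique[OF C CC(3,1) V(1,3)]
          complex_tope_unique[OF C CC(3,2) V(1,3)] A(3) B(3) by blast
    qed
    have "model X (star C X)"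
    proof (rule model_star[OF X], rule ccontr)
      fix T U Y M N
      assume w: "wall T U Y" and XT: "X \<preceq> T" "X \<preceq> U" and M: "M \<in> C" "T \<in> M" and N: "N \<in> C" "U \<in> N"
        and e: "{M, N} \<in> EE" and neq: "M \<noteq> N"
      have MN: "M \<in> cells" "X \<in> M" "N \<in> cells" "X \<in> N"
        using M N wallD(1,2)[OF w] below_in_cell XL XT by (auto simp: cells_iff)
      \<comment> \<open>If the only two cells at \<open>X\<close> are joined by an edge of
        \<open>EE\<close>, every wall at \<open>X\<close> is passable, against
        \<open>not_all\<close>.\<close>
      have "passable T' U'" if w': "wall T' U' Y'" and XT': "X \<preceq> T'" "X \<preceq> U'" for T' U' Y'
      proof -
        have T': "tope T'" "tope U'" "T' \<in> L" "U' \<in> L" using wallD[OF w'] tope_in by auto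
        obtain M' where M': "M' \<in> cells" "T' \<in> M'" "M' \<in> C" using tope_cell[OF T'(1) int[OF T'(3) XT'(1)]] by metis
        obtain N' where N': "N' \<in> cells" "U' \<in> N'" "N' \<in> C" using tope_cell[OF T'(2) int[OF T'(4) XT'(2)]] by metis
        have XM': "X \<in> M'" "X \<in> N'" using below_in_cell M' N' XL XT' by auto
        have "M' = M \<or> M' = N" "N' = M \<or> N' = N" using two[OF MN neq] M'(1) N'(1) XM' by blast+
        then have "M' = N' \<or> {M', N'} \<in> EE" using e by (auto simp: insert_commute)
        then show ?thesis using passable_iff[OF T'(1) M'(2,3) T'(2) N'(2,3)] by blast
      qed
      then show False using not_all by blast
    qed
    then show ?thesis by blast
  qed
qed

text \<open>Each tope lies in a single member of \<open>D\<close>, so the members of consecutive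
  steps coincide along the gallery.\<close>

lemma model_gallery:
  assumes D: "model X D" and X: "X \<in> L" and T: "tope T" "X \<preceq> T" and U: "tope U" "X \<preceq> U"
    and pass: "\<And>V W Y. wall V W Y \<Longrightarrow> between T V U \<Longrightarrow> between T W U \<Longrightarrow> passable V W"
  shows "\<exists>Q\<in>D. restr (zs X) T \<in> Q \<and> restr (zs X) U \<in> Q"
  using T(1) U(1)
proof (induction rule: gallery_induct)
  case base
  have "restr (zs X) U \<in> Supp D" using D tope_in[OF U(1)] by (simp add: model_def)
  then show ?case by (auto simp: Supp_def)
next
  case (step V W Y)
  interpret S: loopless "zs X" "restr (zs X) ` L" using restr_loopless[OF zs_subset] .
  have Dc: "polyhedral_complex (zs X) (restr (zs X) ` L) D" using D by (simp add: model_def)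
  have "X \<preceq> V" "X \<preceq> W" using between_above step(2,3) T(2) U(2) by auto
  moreover have "passable V W" using pass step(1-3) by blast
  ultimately obtain Q where Q: "Q \<in> D" "restr (zs X) V \<in> Q" "restr (zs X) W \<in> Q"
    using D step(1) unfolding model_def by blast
  obtain Q' where Q': "Q' \<in> D" "restr (zs X) W \<in> Q'" "restr (zs X) U \<in> Q'" using step(5) by blast
  have "Q = Q'"
    using S.complex_tope_unique[OF Dc Q(1) Q'(1) star_tope[OF wallD(2)[OF step(1)]] Q(3) Q'(2)] .
  then show ?case using Q Q' by blast
qed

text \<open>The interval from \<open>T\<close> to \<open>U\<close> contains no impassable wall; all
  its galleries are allowed, not just one.\<close>

definition full_open :: "'a covector \<Rightarrow> 'a covector \<Rightarrow> bool" where
  "full_open T U \<longleftrightarrow> (\<forall>V W Y. wall V W Y \<and> between T V U \<and> between T W U \<longrightarrow> passable V W)"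

lemma full_openD: "full_open T U \<Longrightarrow> wall V W Y \<Longrightarrow> between T V U \<Longrightarrow> between T W U \<Longrightarrow> passable V W"
  by (auto simp: full_open_def)

lemma full_open_sym: "full_open T U \<Longrightarrow> full_open U T"
  using between_sym unfolding full_open_def by metis

lemma full_open_sub:
  assumes "full_open T U" "between T V U" "between T W U"
  shows "full_open V W"
proof -
  have "between T Z U" if "between V Z W" for Z
    using that assms(2,3) unfolding between_def by metis
  then show ?thesis using assms(1) unfolding full_open_def by blast
qed

lemma full_open_refl: "full_open T T"
proof -
  have "V = T" if "between T V T" for V using that unfolding between_def by (metis ext)
  then show ?thesis using wallD(3) unfolding full_open_def by metis
qed

text \<open>If the first step of one minimal gallery from \<open>T\<close> to \<open>T'\<close> can be taken and everything
  behind it is open, then around each corank 2 face linking two separating facets of \<open>T\<close> an open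
  half-turn exists.  Locally the cells are convex, so the full turn is open, and the property
  spreads to the other facets.\<close>

lemma full_open_step:
  assumes "tope T" "T \<in> Supp C" "tope T'" "T' \<in> Supp C" "wall T T1 Y1" "between T T1 T'"
    "passable T T1" "full_open T1 T'"
  shows "full_open T T'"
  using assms
proof (induction "card (dis T T')" arbitrary: T T1 Y1 rule: less_induct)
  case less
  note T = less.prems(1,2) and T' = less.prems(3,4)
  \<comment> \<open>\<open>P Y\<close> says that crossing \<open>Y\<close> first is allowed and
    leaves an open interval. Once it holds for every visible facet, the whole interval from
    \<open>T\<close> is open.\<close>
  define P where "P Y \<longleftrightarrow> passable T (Y \<odot> T') \<and> full_open (Y \<odot> T') T'" for Y
  have vis1: "visible T T' Y1" and "P Y1"
    using wall_flip[OF less.prems(5,6) tope_in[OF T'(1)]] less.prems(7,8) by (simp_all add: P_def)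
  have link: "P Z" if Y: "visible T T' Y" and Z: "visible T T' Z" and X: "X \<in> L" "X \<preceq> Y" "X \<preceq> Z"
    and cov: "covers (zs Y) (zs X)" "covers (zs Z) (zs X)" and zX: "zs X \<subseteq> dis T T'" and PY: "P Y"
    for Y Z X
  proof -
    interpret S: loopless "zs X" "restr (zs X) ` L" using restr_loopless[OF zs_subset] .
    \<comment> \<open>\<open>T2\<close> and \<open>T3\<close> are the topes across \<open>Y\<close>
      and \<open>Z\<close>; \<open>To\<close> is opposite to \<open>T\<close> around
      \<open>X\<close>, since \<open>T\<close> and \<open>T'\<close> differ on all of
      \<open>zs X\<close>.\<close>
    define T2 T3 To where "T2 = Y \<odot> T'" and "T3 = Z \<odot> T'" and "To = X \<odot> T'"
    have wY: "wall T T2 Y" "between T T2 T'" and wZ: "wall T T3 Z" "between T T3 T'"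
      using visible_wall[OF T(1) T'(1)] Y Z by (simp_all add: T2_def T3_def)
    have YL: "Y \<in> L" "covers {} (zs Y)" using Y by (auto simp: visible_def)
    have To: "tope To" "X \<preceq> To" using tope_comp[OF X(1) T'(1)] le_comp by (simp_all add: To_def)
    have t2: "tope T2" "tope T3" using wallD(2) wY wZ by blast+
    have XT: "X \<preceq> T" "X \<preceq> T2" "X \<preceq> T3"
      using cov_le_trans X(2,3) wallD(5,6)[OF wY(1)] wallD(6)[OF wZ(1)] by blast+
    have b2: "between T2 To T'" and b3: "between T3 To T'" and bT: "between T To T'"
      using XT unfolding To_def by (auto intro!: between_comp simp: cov_le_iff)
    have disTo: "zs X \<subseteq> dis T To"
      using zX by (auto simp: dis_def To_def zs_def comp_apply)
    have bet: "between T V To" if "tope V" "X \<preceq> V" for V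
      using opposite_between[OF X(1) XT(1) To(2) disTo T(1) To(1) that] .
    have ToS: "To \<in> Supp C" using polyhedron_between[OF S T(2) T'(2) tope_in[OF To(1)] bT] .
    \<comment> \<open>Every tope above \<open>X\<close> lies between \<open>T\<close> and
      \<open>To\<close>, both in the support, and the support is convex.\<close>
    have int: "interior X" unfolding interior_def
    proof (intro conjI ballI impI)
      fix V assume V: "V \<in> L" "X \<preceq> V"
      have "tope (V \<odot> T)" "X \<preceq> V \<odot> T" using tope_comp[OF V(1) T(1)] cov_le_trans[OF V(2) le_comp] by auto
      then have "V \<odot> T \<in> Supp C"
        using polyhedron_between[OF S T(2) ToS tope_in] bet by blast
      then show "V \<in> Supp C" using polyhedron_down[OF S _ V(1) le_comp] by blast
    qed (fact X(1))
    have "cov_rank L Y = Suc (cov_rank L X)" using covers_iff_rank[OF YL(1) X(1)] cov(1) by blast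
    then have "cov_rank L X + 2 = om_rank L" using covers_empty_iff[OF YL(1)] YL(2) by simp
    then obtain D where D: "model X D" using model_exists[OF int] by blast
    have Dc: "polyhedral_complex (zs X) (restr (zs X) ` L) D" using D by (simp add: model_def)
    have p2: "passable T T2" and f2: "full_open T2 T'" using PY by (auto simp: P_def T2_def)
    have f2o: "full_open T2 To" using full_open_sub[OF f2 _ b2] by simp
    have fo: "full_open To T'" using full_open_sub[OF f2 b2] by simp
    \<comment> \<open>The open half-turn from \<open>T2\<close> to \<open>To\<close> lies in one
      member, and passing from \<open>T\<close> to \<open>T2\<close> puts \<open>T\<close> into the
      same member, which thus contains two opposite topes.\<close>
    obtain Q where Q: "Q \<in> D" "restr (zs X) T2 \<in> Q" "restr (zs X) To \<in> Q"
      using model_gallery[OF D X(1) t2(1) XT(2) To] full_openD[OF f2o] by blast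
    obtain Q' where Q': "Q' \<in> D" "restr (zs X) T \<in> Q'" "restr (zs X) T2 \<in> Q'"
      using D p2 wY(1) XT(1,2) unfolding model_def by blast
    have "Q' = Q" using S.complex_tope_unique[OF Dc Q'(1) Q(1) star_tope[OF t2(1)] Q'(3) Q(2)] .
    moreover have "opp (restr (zs X) T) = restr (zs X) To"
    proof
      fix e show "opp (restr (zs X) T) e = restr (zs X) To e"
      proof (cases "e \<in> zs X")
        case True
        then have "T e \<noteq> To e" "e \<in> E" using disTo zs_subset by (auto simp: dis_def)
        then have "To e = sign_neg (T e)" using sign_neq_neg tope_nonzero T(1) To(1) by metis
        then show ?thesis using True by (simp add: restr_def)
      qed (simp add: restr_def)
    qed
    ultimately have "Q = restr (zs X) ` L"
      using S.polyhedron_opposite[OF S.complexD(3)[OF Dc Q(1)] star_tope[OF T(1)]] Q Q' by simp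
    then have all: "passable V W" if "wall V W Y'" "X \<preceq> V" "X \<preceq> W" for V W Y'
      using D that Q(1) wallD(1,2)[OF that(1)] tope_in unfolding model_def by blast
    have "full_open T3 T'"
      using t2(2) To(1)
    proof (induction rule: gallery_induct)
      case base
      show ?case by (rule fo)
    next
      case (step V W Y')
      have XV: "X \<preceq> V" "X \<preceq> W" using between_above step(2,3) XT(3) To(2) by blast+
      have V: "tope V" "tope W" using wallD step(1) by blast+
      have VS: "V \<in> Supp C" using int XV(1) tope_in[OF V(1)] by (simp add: interior_def)
      \<comment> \<open>All topes from \<open>T3\<close> to \<open>To\<close> carry the sign of
        \<open>T'\<close> at \<open>e\<close>, unlike \<open>T\<close>. They are therefore strictly
        closer to \<open>T'\<close>, and the induction hypothesis applies to them.\<close>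
      obtain e where e: "e \<in> zs Z" using covers_nonempty[OF wallD(7)[OF wZ(1)]] by blast
      then have eX: "e \<in> zs X" using coversD(3)[OF cov(2)] by blast
      have "T3 e = T' e" "To e = T' e" using e eX by (simp_all add: T3_def To_def comp_apply zs_def)
      then have "V e = T' e" using step(2) unfolding between_def by metis
      moreover have "T e \<noteq> T' e" using eX zX by (auto simp: dis_def)
      ultimately have neq: "V \<noteq> T" by metis
      have bV: "between T V T'"
        using wZ(2) step(2) b3 unfolding between_def by metis
      have "between V W T'" using step(2,4) b3 unfolding between_def by metis
      then show ?case
        using less.hyps[OF between_card_less[OF tope_in[OF T(1)] tope_in[OF T'(1)] bV neq] V(1) VS T' step(1)]
          all[OF step(1) XV] step(5) by blast
    qed
    moreover have "passable T T3" using all[OF wZ(1) XT(1,3)] .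
    ultimately show "P Z" by (simp add: P_def T3_def)
  qed
  have all: "P Y" if "visible T T' Y" for Y
    by (rule visible_connected[where P = P, OF T(1) T'(1) link vis1 that \<open>P Y1\<close>])
  \<comment> \<open>A wall crossed away from \<open>T\<close> is either a facet of \<open>T\<close>,
    or lies behind a first step \<open>U\<close> towards it, inside the interval from
    \<open>U\<close> to \<open>T'\<close> that \<open>all\<close> opens.\<close>
  have near: "passable V W" if w: "wall V W Y" and b: "between T V T'" "between T W T'" "between T V W" for V W Y
  proof (cases "V = T")
    case True
    then have "visible T T' Y" "W = Y \<odot> T'" using wall_flip[OF _ b(2) tope_in[OF T'(1)]] w by auto
    then show ?thesis using all True by (simp add: P_def)
  next
    case False
    obtain U Y2 where U: "wall T U Y2" "between T U V"
      using wall_step[OF T(1) wallD(1)[OF w]] False by metis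
    have "between T U T'" using between_trans[OF b(1) U(2)] .
    then have "visible T T' Y2" "U = Y2 \<odot> T'" using wall_flip[OF U(1) _ tope_in[OF T'(1)]] by auto
    then have "full_open U T'" using all by (simp add: P_def)
    moreover have "between U V T'" using b U(2) unfolding between_def by metis
    moreover have "between U W T'" using b U(2) unfolding between_def by metis
    ultimately show ?thesis using full_openD w by blast
  qed
  show ?case unfolding full_open_def
  proof (intro allI impI)
    fix V W Y assume w: "wall V W Y \<and> between T V T' \<and> between T W T'"
    then have "between V W T \<or> between W V T" using wall_side T(1) by blast
    then show "passable V W"
    proof
      assume "between V W T"
      then have "passable W V" using near[OF wall_sym] w between_sym by blast
      then show ?thesis by (rule passable_sym)
    next
      assume "between W V T"
      then show ?thesis using near w between_sym by blast
    qed
  qed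
qed

text \<open>Move the endpoint from \<open>U\<close> to \<open>V\<close> along a minimal gallery. A
  step away from \<open>T\<close> extends the interval across a passable wall, as in
  \<open>full_open_step\<close>; a step towards \<open>T\<close> stays inside the open
  interval.\<close>

lemma full_open_trans:
  assumes T: "tope T" "T \<in> Supp C" and U: "tope U" "U \<in> Supp C" and V: "tope V" "V \<in> Supp C"
    and TU: "full_open T U" and UV: "full_open U V"
  shows "full_open T V"
  using V(1) U(1)
proof (induction rule: gallery_induct)
  case base
  show ?case by (rule TU)
next
  case (step A B Y)
  have A: "tope A" "tope B" using wallD step(1) by blast+
  have AS: "A \<in> Supp C" using polyhedron_between[OF S V(2) U(2) tope_in[OF A(1)] step(2)] .
  have p: "passable A B" using full_openD[OF full_open_sym[OF UV] step(1-3)] .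
  have "between A B T \<or> between B A T" using wall_side[OF step(1) T(1)] .
  then show ?case
  proof
    assume "between A B T"
    then have "full_open A T" using full_open_step[OF A(1) AS T step(1)] p full_open_sym[OF step(5)] by blast
    then show ?thesis by (rule full_open_sym)
  next
    assume "between B A T"
    then show ?thesis using full_open_sub[OF step(5) _ between_sym] by simp
  qed
qed

lemma passable_full_open:
  assumes "wall T U Y" "T \<in> Supp C" "U \<in> Supp C" "passable T U"
  shows "full_open T U"
  using full_open_step[OF wallD(1)[OF assms(1)] assms(2) wallD(2)[OF assms(1)] assms(3,1)] assms(4) full_open_refl
  by simp

end

section \<open>The coarsening defined by a set of edges\<close>

context polygon_edges
begin

definition stope :: "'a covector \<Rightarrow> bool" where
  "stope T \<longleftrightarrow> tope T \<and> T \<in> Supp C"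

text \<open>The openness class of \<open>T\<close> together with all faces of its topes, the
  candidate for a maximal member of the coarsening.\<close>

definition region :: "'a covector \<Rightarrow> 'a covector set" where
  "region T = {X \<in> L. \<exists>U. stope U \<and> full_open T U \<and> X \<preceq> U}"

lemma stopeD: "stope T \<Longrightarrow> tope T" "stope T \<Longrightarrow> T \<in> Supp C" "stope T \<Longrightarrow> T \<in> L"
  using tope_in by (auto simp: stope_def)

lemma stope_between: "stope T \<Longrightarrow> stope U \<Longrightarrow> tope V \<Longrightarrow> between T V U \<Longrightarrow> stope V"
  using polyhedron_between[OF S _ _ tope_in] unfolding stope_def by blast

lemma open_trans: "stope T \<Longrightarrow> stope U \<Longrightarrow> stope V \<Longrightarrow> full_open T U \<Longrightarrow> full_open U V \<Longrightarrow> full_open T V"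
  using full_open_trans unfolding stope_def by blast

lemma tope_le_eq: "tope U \<Longrightarrow> tope V \<Longrightarrow> U \<preceq> V \<Longrightarrow> U = V"
  by (rule le_zs_eq) (auto simp: tope_def)

lemma region_tope: "tope U \<Longrightarrow> U \<in> region T \<longleftrightarrow> stope U \<and> full_open T U"
  using tope_le_eq[of U] stopeD(1) cov_le_refl tope_in[of U] unfolding region_def by blast

lemma region_rep:
  assumes "X \<in> region T"
  obtains U where "stope U" "U \<in> region T" "X \<preceq> U"
  using assms region_tope stopeD(1) unfolding region_def by blast

lemma region_self: "stope T \<Longrightarrow> T \<in> region T"
  using region_tope stopeD(1) full_open_refl by blast

lemma region_sub: "region T \<subseteq> Supp C"
  using polyhedron_down[OF S] by (auto simp: region_def stope_def)

lemma region_down: "X \<in> L \<Longrightarrow> X \<preceq> Y \<Longrightarrow> Y \<in> region T \<Longrightarrow> X \<in> region T"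
  using cov_le_trans unfolding region_def by blast

lemma region_eq:
  assumes T: "stope T" and U: "stope U" and o: "full_open T U"
  shows "region T = region U"
proof -
  have "full_open T V \<longleftrightarrow> full_open U V" if "stope V" for V
    using open_trans[OF T U that o] open_trans[OF U T that full_open_sym[OF o]] by blast
  then show ?thesis unfolding region_def by blast
qed

lemma region_mem_eq: "stope T \<Longrightarrow> tope U \<Longrightarrow> U \<in> region T \<Longrightarrow> region T = region U"
  using region_tope region_eq by blast

lemma region_exit:
  assumes T: "stope T" and U: "tope U" "U \<notin> region T"
  shows "\<exists>V W Y. wall V W Y \<and> V \<in> region T \<and> W \<notin> region T \<and> between V W U"
proof -
  define K where "K = region T"
  have "T \<in> K \<longrightarrow> (\<exists>V W Y. wall V W Y \<and> V \<in> K \<and> W \<notin> K \<and> between V W U)"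
    using stopeD(1)[OF T] U(1)
  proof (induction rule: gallery_induct)
    case base
    then show ?case using U(2) by (simp add: K_def)
  next
    case (step V W Y)
    then show ?case by blast
  qed
  then show ?thesis using region_self[OF T] by (simp add: K_def)
qed

text \<open>A wall leaving the class supports it: for a tope \<open>B\<close> of the class on the
  far side, \<open>W\<close> would lie between \<open>V\<close> and \<open>B\<close> and hence in
  the class.\<close>

lemma region_wall_bound:
  assumes T: "stope T" and w: "wall V W Y" and V: "V \<in> region T" and W: "W \<notin> region T"
    and e: "e \<in> zs Y" and A: "A \<in> region T"
  shows "A e = Zero \<or> A e = V e"
proof -
  obtain B where B: "stope B" "B \<in> region T" "A \<preceq> B" using region_rep[OF A] by metis
  have sV: "stope V" "full_open T V" using region_tope wallD(1)[OF w] V by blast+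
  have TB: "full_open T B" using region_tope stopeD(1)[OF B(1)] B(2) by blast
  have VB: "full_open V B" using open_trans[OF sV(1) T B(1) full_open_sym[OF sV(2)] TB] .
  have "B e \<noteq> W e"
  proof
    assume "B e = W e"
    then have b: "between V W B" using wall_between[OF w stopeD(1)[OF B(1)] e] by blast
    then have "stope W" using stope_between[OF sV(1) B(1) wallD(2)[OF w]] by blast
    moreover have "full_open V W" using full_open_sub[OF VB _ b] by simp
    ultimately have "full_open T W" using open_trans[OF T sV(1)] sV(2) by blast
    then show False using W region_tope wallD(2)[OF w] \<open>stope W\<close> by blast
  qed
  then have "B e = V e" using wall_cases[OF w stopeD(1)[OF B(1)] e] by blast
  then show ?thesis using B(3) by (auto simp: cov_le_iff)
qed

lemma region_polyhedron:
  assumes T: "stope T"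
  shows "polyhedron E L (region T)"
  unfolding polyhedron_iff
proof (intro conjI ballI)
  show "region T \<subseteq> L" by (auto simp: region_def)
  fix X assume X: "X \<in> L - region T"
  \<comment> \<open>Filling up with \<open>T\<close> forces the sign of \<open>U\<close> at the
    separating \<open>e\<close> to come from \<open>X\<close>: the class contains \<open>T\<close>,
    whose sign there is that of \<open>V\<close>.\<close>
  define U where "U = X \<odot> T"
  have U: "tope U" "X \<preceq> U" using tope_comp stopeD(1)[OF T] X by (auto simp: U_def)
  then have "U \<notin> region T" using region_down X by blast
  then obtain V W Y where w: "wall V W Y" and VW: "V \<in> region T" "W \<notin> region T" "between V W U"
    using region_exit[OF T U(1)] by blast
  obtain e where e: "e \<in> zs Y" using covers_nonempty[OF wallD(7)[OF w]] by blast
  have eE: "e \<in> E" using e zs_subset by blast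
  have nz: "V e \<noteq> Zero" "W e \<noteq> Zero" "T e \<noteq> Zero"
    using tope_nonzero eE wallD(1,2)[OF w] stopeD(1)[OF T] by auto
  have "bounds (region T) e (V e)"
    using region_wall_bound[OF T w VW(1,2) e] nz(1) eE by (auto simp: bounds_def)
  moreover have "X e = sign_neg (V e)"
  proof -
    have "U e = W e" using VW(3) wall_zs[OF w e] unfolding between_def by metis
    moreover have "T e = V e" using region_wall_bound[OF T w VW(1,2) e region_self[OF T]] nz by blast
    ultimately have "X e = W e" using wall_zs[OF w e] by (auto simp: U_def comp_apply split: if_splits)
    then show ?thesis using sign_neq_neg nz wall_zs[OF w e] by metis
  qed
  ultimately show "\<exists>e s. bounds (region T) e s \<and> X e = sign_neg s" by blast
qed

lemma cell_region:
  assumes M: "M \<in> C" "T \<in> M" "tope T"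
  shows "M \<subseteq> region T"
proof
  have MS: "M \<subseteq> Supp C" using M(1) by (auto simp: Supp_def)
  fix X assume X: "X \<in> M"
  have XL: "X \<in> L" using X polyhedron_sub[OF poly[OF M(1)]] by blast
  have U: "tope (X \<odot> T)" "X \<odot> T \<in> M" using tope_comp[OF XL M(3)] polyhedron_comp[OF poly[OF M(1)] X M(2)] by auto
  have "full_open T (X \<odot> T)" unfolding full_open_def
  proof (intro allI impI)
    fix V W Y assume w: "wall V W Y \<and> between T V (X \<odot> T) \<and> between T W (X \<odot> T)"
    then have "V \<in> M" "W \<in> M"
      using polyhedron_between[OF poly[OF M(1)] M(2) U(2)] wallD(1,2) tope_in by blast+
    then show "passable V W" using M(1) by (auto simp: passable_def)
  qed
  then show "X \<in> region T" using XL U MS unfolding region_def stope_def by (auto intro: le_comp)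
qed

text \<open>Converse to \<open>model_gallery\<close>: members of \<open>D\<close> are convex, so
  every step of the gallery is passable, and single steps compose by transitivity.\<close>

lemma model_full_open:
  assumes X: "interior X" and D: "model X D" and T: "tope T" "X \<preceq> T" and U: "tope U" "X \<preceq> U"
    and Q: "Q \<in> D" "restr (zs X) T \<in> Q" "restr (zs X) U \<in> Q"
  shows "full_open T U"
  using T(1) U(1)
proof (induction rule: gallery_induct)
  case base
  show ?case by (rule full_open_refl)
next
  case (step V W Y)
  interpret S: loopless "zs X" "restr (zs X) ` L" using restr_loopless[OF zs_subset] .
  have Qp: "polyhedron (zs X) (restr (zs X) ` L) Q" using S.complexD(3) D Q(1) by (auto simp: model_def)
  have V: "tope V" "tope W" using wallD step(1) by blast+
  have XV: "X \<preceq> V" "X \<preceq> W" using between_above step(2,3) T(2) U(2) by blast+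
  have st: "stope V" "stope W" "stope U"
    using X V XV U tope_in by (auto simp: interior_def stope_def)
  have "restr (zs X) Z \<in> Q" if "tope Z" "between T Z U" for Z
    using S.polyhedron_between[OF Qp Q(2,3) _ restr_between[OF that(2)]] tope_in[OF that(1)] by blast
  then have "restr (zs X) V \<in> Q" "restr (zs X) W \<in> Q" using V step(2,3) by blast+
  then have "passable V W" using D step(1) XV Q(1) unfolding model_def by blast
  then have "full_open V W" using passable_full_open[OF step(1)] st by (simp add: stope_def)
  then show ?case using open_trans[OF st] step(5) by blast
qed

text \<open>The interval from \<open>A\<close> to \<open>A2\<close> acts as a half-turn around
  \<open>X\<close>: off \<open>B\<close> the two ends are opposite on \<open>zs X\<close>, and on
  \<open>B\<close> the tope \<open>V\<close> lies on the side of \<open>A\<close>.\<close>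

lemma half_between:
  assumes X: "X \<in> L" "X \<preceq> A" "X \<preceq> A2" "X \<preceq> V" and t: "tope A" "tope A2" "tope V"
    and on: "\<And>e. e \<in> B \<Longrightarrow> V e = A e" and off: "\<And>e. e \<in> zs X - B \<Longrightarrow> A e \<noteq> A2 e"
  shows "between A V A2"
  unfolding between_def
proof
  fix e show "V e = A e \<or> V e = A2 e"
  proof (cases "e \<in> zs X - B")
    case True
    then have "e \<in> E" using zs_subset by blast
    then show ?thesis using sign_two[of "A e" "A2 e" "V e"] off[OF True] tope_nonzero t by blast
  next
    case False
    then show ?thesis using on eq_off_zs[OF X(1) tope_in] X(2,4) t(1,3) by (metis DiffI)
  qed
qed

lemma wall_agree:
  assumes w: "wall T U Y" and A: "tope A" and e: "e \<in> zs Y" "A e = T e" and f: "f \<in> zs Y"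
  shows "A f = T f"
proof -
  have "between U T A" using wall_between[OF wall_sym[OF w] A e] .
  then show ?thesis using wall_zs[OF w f] unfolding between_def by metis
qed

text \<open>At a face \<open>X\<close> of corank 2 in the interior of the facet, the first region fills a
  half-turn, and by the intersection property of the local complex the opposite half-turn belongs
  to a single region.\<close>

lemma facet_transfer:
  assumes T: "stope T" "stope T'" and no: "\<not> full_open T T'"
    and "Y \<in> region T" "Y \<in> region T'" "covers {} (zs Y)" and Z: "Z \<in> region T" and "zs Y = zs Z"
  shows "Z \<in> region T'"
  using assms(4-6,8)
proof (induction "card (dis Y Z)" arbitrary: Y rule: less_induct)
  case less
  note Y = less.prems
  have P: "polyhedron E L (region T)" "polyhedron E L (region T')" using region_polyhedron T by auto
  have YL: "Y \<in> L" and ZL: "Z \<in> L" using Y(1) Z polyhedron_sub[OF P(1)] by blast+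
  show ?case
  proof (cases "Y = Z")
    case False
    obtain X where X: "X \<in> L" "X \<preceq> Y" "covers (zs Y) (zs X)" "zs X - zs Y \<subseteq> dis Y Z"
      using gallery_step[OF YL ZL Y(4) False] by metis
    interpret S: loopless "zs X" "restr (zs X) ` L" using restr_loopless[OF zs_subset] .
    \<comment> \<open>\<open>Y2\<close> is the covector opposite to \<open>Y\<close> around
      \<open>X\<close> with the same zero set. It lies between \<open>Y\<close> and
      \<open>Z\<close>, so repeating the transfer from \<open>Y2\<close> makes progress.\<close>
    define Y2 where "Y2 = X \<odot> Z"
    have Y2L: "Y2 \<in> L" using comp_in X(1) ZL by (simp add: Y2_def)
    have zXY: "zs Y \<subset> zs X" using coversD(3)[OF X(3)] .
    have zY2: "zs Y2 = zs Y" using zs_comp zXY Y(4) by (auto simp: Y2_def)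
    have b: "between Y Y2 Z" using X(2) unfolding Y2_def by (intro between_comp) (auto simp: cov_le_iff)
    have Y2P: "Y2 \<in> region T" using polyhedron_between[OF P(1) Y(1) Z Y2L b] .
    have Y2_on: "Y2 e = Z e" if "e \<in> zs X" for e using that by (simp add: Y2_def comp_apply zs_def)
    have opp: "Y2 e = sign_neg (Y e)" if "e \<in> zs X" for e
    proof (cases "e \<in> zs Y")
      case True
      then have "e \<in> zs Y2" using zY2 by simp
      then show ?thesis using True by (simp add: zs_def)
    next
      case False
      then have "Y e \<noteq> Z e" using X(4) that by (auto simp: dis_def)
      moreover have "Y e \<noteq> Zero" "Z e \<noteq> Zero" using False Y(4) that zs_subset by (auto simp: zs_def)
      ultimately show ?thesis using sign_neq_neg Y2_on[OF that] by metis
    qed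
    obtain A where A: "stope A" "A \<in> region T" "Y \<preceq> A" using region_rep[OF Y(1)] by metis
    obtain B where B: "stope B" "B \<in> region T'" "Y \<preceq> B" using region_rep[OF Y(2)] by metis
    have TA: "full_open T A" and TB: "full_open T' B"
      using region_tope stopeD(1) A B by blast+
    have "A \<noteq> B" using no open_trans[OF T(1) A(1) T(2) TA] full_open_sym[OF TB] by blast
    then have w: "wall A B Y" using A B stopeD(1) YL Y(3) by (simp add: wall_def)
    \<comment> \<open>\<open>A\<close> to \<open>A2\<close> and \<open>B\<close> to
      \<open>B2\<close> are the two half-turns around \<open>X\<close>, one on each side of the
      hyperplane of \<open>Y\<close>.\<close>
    define A2 B2 where "A2 = Y2 \<odot> A" and "B2 = Y2 \<odot> B"
    have A2: "A2 \<in> region T" "tope A2" "Y2 \<preceq> A2"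
      using polyhedron_comp[OF P(1) Y2P A(2)] tope_comp[OF Y2L stopeD(1)[OF A(1)]] by (simp_all add: A2_def)
    then have sA2: "stope A2" "full_open T A2" using region_tope by auto
    have B2: "tope B2" "Y2 \<preceq> B2" using tope_comp[OF Y2L stopeD(1)[OF B(1)]] by (simp_all add: B2_def)
    have sB2: "stope B2"
      using B2(1) polyhedron_comp[OF S _ stopeD(2)[OF B(1)]] Y2P region_sub by (auto simp: stope_def B2_def)
    have XY2: "X \<preceq> Y2" by (simp add: Y2_def)
    have Xle: "X \<preceq> A" "X \<preceq> B" "X \<preceq> A2" "X \<preceq> B2"
      using cov_le_trans X(2) XY2 A(3) B(3) A2(3) B2(2) by blast+
    have offA: "A e \<noteq> A2 e" "B e \<noteq> B2 e" if e: "e \<in> zs X - zs Y" for e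
    proof -
      have "A e = Y e" "B e = Y e" "A2 e = Y2 e" "B2 e = Y2 e"
        using e zY2 eq_off_zs[OF YL stopeD(3)[OF A(1)] A(3)] eq_off_zs[OF YL stopeD(3)[OF B(1)] B(3)]
          eq_off_zs[OF Y2L tope_in[OF A2(2)] A2(3)] eq_off_zs[OF Y2L tope_in[OF B2(1)] B2(2)] by auto
      moreover have "Y e \<noteq> Zero" using e zs_subset by (auto simp: zs_def)
      ultimately show "A e \<noteq> A2 e" "B e \<noteq> B2 e" using opp[of e] e by auto
    qed
    obtain e0 where e0: "e0 \<in> zs Y" using covers_nonempty[OF Y(3)] by blast
    \<comment> \<open>Each tope above \<open>X\<close> is on the side of \<open>A\<close> or of
      \<open>B\<close>, hence in one of the two half-turns, whose ends lie in the support.\<close>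
    have int_tope: "stope V" if V: "tope V" "X \<preceq> V" for V
    proof -
      have "V e0 = A e0 \<or> V e0 = B e0" using wall_cases[OF w V(1) e0] .
      then show ?thesis
      proof
        assume "V e0 = A e0"
        then have "between A V A2"
          using half_between[OF X(1) Xle(1,3) V(2) stopeD(1)[OF A(1)] A2(2) V(1), of "zs Y"]
            wall_agree[OF w V(1) e0] offA(1) by blast
        then show ?thesis using stope_between[OF A(1) sA2(1) V(1)] by blast
      next
        assume "V e0 = B e0"
        then have "between B V B2"
          using half_between[OF X(1) Xle(2,4) V(2) stopeD(1)[OF B(1)] B2(1) V(1), of "zs Y"]
            wall_agree[OF wall_sym[OF w] V(1) e0] offA(2) by blast
        then show ?thesis using stope_between[OF B(1) sB2 V(1)] by blast
      qed
    qed
    have int: "interior X" unfolding interior_def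
    proof (intro conjI ballI impI)
      fix V assume V: "V \<in> L" "X \<preceq> V"
      have "stope (V \<odot> A)"
        using int_tope tope_comp[OF V(1) stopeD(1)[OF A(1)]] cov_le_trans[OF V(2) le_comp] by blast
      then show "V \<in> Supp C" using polyhedron_down[OF S stopeD(2) V(1) le_comp] by blast
    qed (fact X(1))
    have "cov_rank L Y = Suc (cov_rank L X)" using covers_iff_rank[OF YL X(1)] X(3) by blast
    then have "cov_rank L X + 2 = om_rank L" using covers_empty_iff[OF YL] Y(3) by simp
    then obtain D where D: "model X D" using model_exists[OF int] by blast
    have Dc: "polyhedral_complex (zs X) (restr (zs X) ` L) D" and DS: "Supp D = restr (zs X) ` L"
      using D by (simp_all add: model_def)
    have "full_open A A2" using open_trans[OF A(1) T(1) sA2(1) full_open_sym[OF TA] sA2(2)] .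
    then obtain Q where Q: "Q \<in> D" "restr (zs X) A \<in> Q" "restr (zs X) A2 \<in> Q"
      using model_gallery[OF D X(1) stopeD(1)[OF A(1)] Xle(1) A2(2) Xle(3)] full_openD by blast
    obtain Q' where Q': "Q' \<in> D" "restr (zs X) B \<in> Q'"
      using DS stopeD(3)[OF B(1)] by (auto simp: Supp_def)
    have Qp: "polyhedron (zs X) (restr (zs X) ` L) Q" "polyhedron (zs X) (restr (zs X) ` L) Q'"
      using S.complexD(3)[OF Dc] Q(1) Q'(1) by auto
    have YQ: "restr (zs X) Y \<in> Q" "restr (zs X) Y \<in> Q'"
      using S.polyhedron_down[OF Qp(1) Q(2) _ restr_mono[OF A(3)]]
        S.polyhedron_down[OF Qp(2) Q'(2) _ restr_mono[OF B(3)]] YL by blast+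
    have Y2Q: "restr (zs X) Y2 \<in> Q" using S.polyhedron_down[OF Qp(1) Q(3) _ restr_mono[OF A2(3)]] Y2L by blast
    have oppY: "restr (zs X) Y2 = opp (restr (zs X) Y)" using opp by (intro ext) (simp add: restr_def)
    then have "restr (zs X) Y \<odot> opp (restr (zs X) Y2) \<in> Q"
      using YQ(1) by (simp add: comp_absorb)
    \<comment> \<open>Locally \<open>Y2\<close> is \<open>-Y\<close>, so it lies in the smallest
      face of \<open>Q\<close> at \<open>Y\<close>. The members \<open>Q\<close> and
      \<open>Q'\<close> share this face, which brings \<open>Y2\<close> into
      \<open>Q'\<close>.\<close>
    then have "restr (zs X) Y2 \<in> relface Q (restr (zs X) Y)" using Y2Q by (simp add: relface_def)
    then have "restr (zs X) Y2 \<in> Q'"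
      using S.complex_agree[OF Dc Q(1) Q'(1) YQ] relface_subset by blast
    then have "restr (zs X) B2 \<in> Q'"
      using S.polyhedron_comp[OF Qp(2) _ Q'(2)] by (simp add: B2_def restr_comp)
    then have "full_open B B2"
      using model_full_open[OF int D stopeD(1)[OF B(1)] Xle(2) B2(1) Xle(4) Q'] by blast
    then have "B2 \<in> region T'" using open_trans[OF T(2) B(1) sB2 TB] region_tope[OF B2(1)] sB2 by blast
    then have Y2P': "Y2 \<in> region T'" using region_down Y2L B2(2) by blast
    obtain e where e: "e \<in> zs X - zs Y" using covers_nonempty[OF X(3)] by blast
    have "Y2 \<noteq> Y" using offA(1)[OF e] opp[of e] e zs_subset by (auto simp: zs_def)
    then have "card (dis Y2 Z) < card (dis Y Z)" using between_card_less[OF YL ZL b] by blast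
    then show ?thesis using less.hyps[OF _ Y2P Y2P'] zY2 Y(3,4) by simp
  qed (use Y(2) in simp)
qed

text \<open>On \<open>zs Y\<close>, where \<open>X\<close> vanishes, \<open>V\<close> and its
  negative respect the same bound, so the smallest face at \<open>X\<close> lies in the hyperplane
  of the wall. Composing its covectors with \<open>Y\<close> gives covectors with zero set exactly
  \<open>zs Y\<close>, to which the facet transfer applies.\<close>

lemma relface_wall:
  assumes T: "stope T" "stope T'" and no: "\<not> full_open T T'" and w: "wall T T' Y" and X: "X \<preceq> Y"
  shows "relface (region T) X \<subseteq> relface (region T') X"
proof
  fix V assume "V \<in> relface (region T) X"
  then have V: "V \<in> region T" "X \<odot> opp V \<in> region T" by (auto simp: relface_def)
  have YL: "Y \<in> L" using wallD(4)[OF w] .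
  have Y: "Y \<in> region T" "Y \<in> region T'"
    using region_down[OF YL] wallD(5,6)[OF w] region_self T by blast+
  have no': "T' \<notin> region T" using no region_tope stopeD(1)[OF T(2)] by blast
  have zero: "V e = Zero" "(X \<odot> opp V) e = Zero" if e: "e \<in> zs Y" for e
  proof -
    have Xe: "X e = Zero" using zs_mono[OF X] e by (auto simp: zs_def)
    have b: "V e = Zero \<or> V e = T e" "(X \<odot> opp V) e = Zero \<or> (X \<odot> opp V) e = T e"
      using region_wall_bound[OF T(1) w region_self[OF T(1)] no' e] V by blast+
    have eq: "(X \<odot> opp V) e = sign_neg (V e)" using Xe by (simp add: comp_apply)
    then show "V e = Zero" using b sign_both_bounded by metis
    then show "(X \<odot> opp V) e = Zero" using eq by simp
  qed
  have transfer: "Z \<in> region T'" if Z: "Z \<in> region T" "\<And>e. e \<in> zs Y \<Longrightarrow> Z e = Zero" for Z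
  proof -
    have ZL: "Z \<in> L" using Z(1) by (simp add: region_def)
    have "zs Y \<subseteq> zs Z" using Z(2) zs_subset by (auto simp: zs_def)
    then have "zs Y = zs (Z \<odot> Y)" using zs_comp by auto
    moreover have "Z \<odot> Y \<in> region T" using polyhedron_comp[OF region_polyhedron[OF T(1)] Z(1) Y(1)] .
    ultimately have "Z \<odot> Y \<in> region T'" using facet_transfer[OF T no Y wallD(7)[OF w]] by blast
    then show ?thesis using region_down[OF ZL le_comp] by blast
  qed
  show "V \<in> relface (region T') X" using transfer V zero by (simp add: relface_def)
qed

text \<open>Walk along a gallery of topes above \<open>X\<close>: each wall crossed contains
  \<open>X\<close>, and either stays in one region or compares the two smallest faces in both
  directions.\<close>

lemma relface_region:
  assumes T: "stope T" "stope T'" and X: "X \<in> region T" "X \<in> region T'"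
  shows "relface (region T) X = relface (region T') X"
proof -
  obtain U where U: "stope U" "U \<in> region T" "X \<preceq> U" using region_rep[OF X(1)] by metis
  obtain U' where U': "stope U'" "U' \<in> region T'" "X \<preceq> U'" using region_rep[OF X(2)] by metis
  have "relface (region U) X = relface (region U') X"
    using stopeD(1)[OF U(1)] stopeD(1)[OF U'(1)]
  proof (induction rule: gallery_induct)
    case (step V W Y)
    have V: "stope V" "stope W" using stope_between[OF U(1) U'(1)] step(1-3) wallD(1,2) by blast+
    have XV: "X \<preceq> V" "X \<preceq> W" using between_above step(2,3) U(3) U'(3) by blast+
    have XY: "X \<preceq> Y" unfolding cov_le_iff
    proof (intro allI impI)
      fix e assume "X e \<noteq> Zero"
      then have "V e = X e" "W e = X e" using XV by (auto simp: cov_le_iff)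
      then have "e \<notin> zs Y" using wall_zs[OF step(1)] by metis
      then show "Y e = X e" using eq_off_zs[OF wallD(4)[OF step(1)] stopeD(3)[OF V(1)] wallD(5)[OF step(1)]]
          \<open>V e = X e\<close> by metis
    qed
    have "relface (region V) X = relface (region W) X"
    proof (cases "full_open V W")
      case True
      then show ?thesis using region_eq[OF V] by simp
    next
      case False
      then have "\<not> full_open W V" using full_open_sym by blast
      then show ?thesis
        using relface_wall[OF V False step(1) XY] relface_wall[OF V(2,1) _ wall_sym[OF step(1)] XY] by blast
    qed
    then show ?case using step(5) by simp
  qed simp
  then show ?thesis using region_mem_eq[OF T(1) stopeD(1)[OF U(1)] U(2)]
      region_mem_eq[OF T(2) stopeD(1)[OF U'(1)] U'(2)] by simp
qed

definition coarsening :: "'a covector set set" where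
  "coarsening = (\<Union>P\<in>region ` {T. stope T}. faces E L P)"

lemma coarsening_iff: "Q \<in> coarsening \<longleftrightarrow> (\<exists>T X. stope T \<and> X \<in> region T \<and> Q = relface (region T) X)"
proof -
  have "faces E L (region T) = relface (region T) ` region T" if "stope T" for T
    using faces_eq[OF region_polyhedron[OF that]] .
  then show ?thesis unfolding coarsening_def by auto
qed

lemma coarsening_complex: "polyhedral_complex E L coarsening"
  unfolding coarsening_def
proof (rule faces_complex)
  have "{T. stope T} \<subseteq> L" using stopeD(3) by blast
  then show "finite (region ` {T. stope T})" using finite_L finite_subset by blast
  show "region ` {T. stope T} \<noteq> {}" using full by (auto simp: stope_def)
next
  fix P assume "P \<in> region ` {T. stope T}"
  then show "polyhedron E L P" using region_polyhedron by blast
next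
  fix P Q X assume "P \<in> region ` {T. stope T}" "Q \<in> region ` {T. stope T}" "X \<in> P" "X \<in> Q"
  then show "relface P X = relface Q X" using relface_region by blast
qed

lemma region_in_coarsening: "stope T \<Longrightarrow> region T \<in> coarsening"
proof -
  assume T: "stope T"
  have "relface (region T) T = region T"
    using relface_generic generic_tope[OF _ region_self[OF T] stopeD(1)[OF T]]
      polyhedron_sub[OF region_polyhedron[OF T]] by blast
  then show ?thesis using T region_self[OF T] coarsening_iff by metis
qed

lemma Supp_region: "X \<in> Supp C \<Longrightarrow> \<exists>T. stope T \<and> X \<in> region T"
proof -
  assume X: "X \<in> Supp C"
  have XL: "X \<in> L" using X polyhedron_sub[OF S] by blast
  obtain T where T: "T \<in> Supp C" "tope T" using full by blast
  have st: "stope (X \<odot> T)" using polyhedron_comp[OF S X T(1)] tope_comp[OF XL T(2)] by (simp add: stope_def)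
  then show ?thesis using region_down[OF XL le_comp region_self] by blast
qed

lemma coarsening_coarsens: "coarsens coarsening C"
  unfolding coarsens_def
proof (intro conjI ballI)
  have "Supp coarsening \<subseteq> Supp C"
  proof
    fix X assume "X \<in> Supp coarsening"
    then obtain T Z where "X \<in> relface (region T) Z" by (auto simp: Supp_def coarsening_iff)
    then show "X \<in> Supp C" using relface_subset region_sub by blast
  qed
  moreover have "Supp C \<subseteq> Supp coarsening"
    using Supp_region region_in_coarsening unfolding Supp_def by blast
  ultimately show "Supp coarsening = Supp C" by (rule equalityI)
next
  fix Q assume "Q \<in> coarsening"
  then obtain T Z where T: "stope T" "Z \<in> region T" "Q = relface (region T) Z" using coarsening_iff by metis
  have P: "polyhedron E L (region T)" using region_polyhedron[OF T(1)] .
  have "Q \<subseteq> \<Union>{R \<in> C. R \<subseteq> Q}"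
  proof
    fix V assume V: "V \<in> Q"
    then have VP: "V \<in> region T" using T(3) relface_subset by blast
    then have VL: "V \<in> L" by (simp add: region_def)
    obtain U where U: "stope U" "U \<in> region T" "V \<preceq> U" using region_rep[OF VP] by metis
    obtain M where M: "M \<in> C" "U \<in> M" using tope_cell[OF stopeD(1,2)[OF U(1)]] U(1) by metis
    have "M \<subseteq> region T"
      using cell_region[OF M stopeD(1)[OF U(1)]] region_mem_eq[OF T(1) stopeD(1)[OF U(1)] U(2)] by simp
    then have "relface M V \<subseteq> relface (region T) V" by (rule relface_mono)
    \<comment> \<open>Faces are cut along cells: around any \<open>V\<close> of the face
      \<open>Q\<close>, the smallest face of a cell at \<open>V\<close> stays in the smallest face
      of the region at \<open>V\<close>, hence in \<open>Q\<close>.\<close>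
    also have "\<dots> \<subseteq> Q" using relface_trans[OF P T(2)] V T(3) by simp
    finally have "relface M V \<subseteq> Q" .
    moreover have VM: "V \<in> M" using below_in_cell[OF M VL U(3)] .
    moreover have "relface M V \<in> C" using complex_relface[OF C M(1) VM] .
    ultimately show "V \<in> \<Union>{R \<in> C. R \<subseteq> Q}" using relface_self[OF VM] by blast
  qed
  then have "Q = \<Union>{R \<in> C. R \<subseteq> Q}" by blast
  then show "\<exists>S\<subseteq>C. Q = \<Union>S" by (intro exI[of _ "{R \<in> C. R \<subseteq> Q}"]) blast
qed

lemma coarsening_edges: "edge_set L (om_rank L) C coarsening = EE"
proof
  show "edge_set L (om_rank L) C coarsening \<subseteq> EE"
  proof
    fix d assume "d \<in> edge_set L (om_rank L) C coarsening"
    then obtain Q where d: "d \<in> adj_edges L (om_rank L) C" and Q: "Q \<in> coarsening" "\<forall>M\<in>d. M \<subseteq> Q"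
      by (auto simp: edge_set_def)
    obtain M N where MN: "d = {M, N}" using adj_edgesE[OF d] by metis
    then obtain T U Y where w: "wall T U Y" "T \<in> M" "U \<in> N" "M \<noteq> N" "M \<in> C" "N \<in> C"
      using adj_edge_wall[OF C] d by metis
    obtain V Z where V: "stope V" "Q = relface (region V) Z" using Q(1) coarsening_iff by metis
    have "T \<in> region V" "U \<in> region V" using w(2,3) Q(2) MN V(2) relface_subset by blast+
    then have "stope T" "full_open V T" "stope U" "full_open V U" using region_tope wallD(1,2)[OF w(1)] by blast+
    then have "full_open T U" using open_trans[OF _ V(1)] full_open_sym by blast
    then have "passable T U" using full_openD[OF _ w(1)] by simp
    then show "d \<in> EE" using passable_iff[OF wallD(1)[OF w(1)] w(2,5) wallD(2)[OF w(1)] w(3,6)] w(4) MN by blast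
  qed
  show "EE \<subseteq> edge_set L (om_rank L) C coarsening"
  proof
    fix d assume dE: "d \<in> EE"
    then have d: "d \<in> adj_edges L (om_rank L) C" using EE by blast
    obtain M N where MN: "d = {M, N}" using adj_edgesE[OF d] by metis
    then obtain T U Y where w: "wall T U Y" "T \<in> M" "U \<in> N" "M \<noteq> N" "M \<in> C" "N \<in> C"
      using adj_edge_wall[OF C] d by metis
    have st: "stope T" "stope U" using w wallD(1,2)[OF w(1)] by (auto simp: stope_def Supp_def)
    have "passable T U" using dE MN w by (auto simp: passable_def)
    then have "full_open T U" using passable_full_open[OF w(1)] stopeD(2) st by blast
    then have "region T = region U" using region_eq st by blast
    then have "M \<subseteq> region T" "N \<subseteq> region T" using cell_region w wallD(1,2)[OF w(1)] by blast+
    then show "d \<in> edge_set L (om_rank L) C coarsening"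
      using d MN region_in_coarsening[OF st(1)] by (auto simp: edge_set_def)
  qed
qed

end

section \<open>Both directions combined, and supports without topes\<close>

context loopless
begin

lemma full_complex_coarsening_iff:
  assumes "polyhedral_complex E L C" "polyhedron E L (Supp C)" "\<exists>T\<in>Supp C. tope T"
    and EE: "EE \<subseteq> adj_edges L (om_rank L) C"
  shows "(\<exists>C'. polyhedral_complex E L C' \<and> coarsens C' C \<and> edge_set L (om_rank L) C C' = EE) \<longleftrightarrow>
    polygon_property E L (om_rank L) C EE"
proof
  interpret full_complex E L C using assms(1-3) by unfold_locales
  show "polygon_property E L (om_rank L) C EE"
    if "\<exists>C'. polyhedral_complex E L C' \<and> coarsens C' C \<and> edge_set L (om_rank L) C C' = EE"
    using that coarsening_polygon_property by blast
  assume "polygon_property E L (om_rank L) C EE"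
  then interpret polygon_edges E L C EE using EE by unfold_locales
  show "\<exists>C'. polyhedral_complex E L C' \<and> coarsens C' C \<and> edge_set L (om_rank L) C C' = EE"
    using coarsening_complex coarsening_coarsens coarsening_edges by blast
qed

text \<open>Without topes there are no cells of rank n and so no edges. Every covector of the
  support has a tope of \<open>L\<close> above it that lies outside, so all faces are in the
  boundary and the polygon property is vacuous.\<close>

lemma degenerate_complex:
  assumes C: "polyhedral_complex E L C" and S: "polyhedron E L (Supp C)" and no: "\<not> (\<exists>T\<in>Supp C. tope T)"
  shows "adj_edges L (om_rank L) C = {}" and "polygon_property E L (om_rank L) C EE"
proof -
  have "adj_vertices L (om_rank L) C = {}"
    using adj_vertices_iff[OF C] no unfolding Supp_def by blast
  then show "adj_edges L (om_rank L) C = {}" by (simp add: adj_edges_def)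
  have "F \<subseteq> ideal_boundary L (Supp C)" if F: "F \<in> C" for F
  proof
    fix X assume X: "X \<in> F"
    then have XS: "X \<in> Supp C" using F by (auto simp: Supp_def)
    then have XL: "X \<in> L" using polyhedron_sub[OF S] by blast
    obtain T where "tope T" using tope_exists by blast
    then have "tope (X \<odot> T)" using tope_comp[OF XL] by blast
    then have "X \<odot> T \<in> L" "X \<odot> T \<notin> Supp C" using tope_in no by blast+
    then show "X \<in> ideal_boundary L (Supp C)" using XS le_comp[of X T] unfolding ideal_boundary_def by blast
  qed
  then show "polygon_property E L (om_rank L) C EE" unfolding polygon_property_def by blast
qed

end

theorem theorem5p5:
  fixes E :: "'e set" and L :: "'e covector set" and n :: nat
    and C :: "'e covector set set" and EE :: "'e covector set set set"
  assumes "oriented_matroid E L"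
    and "no_loops E L"
    and "om_rank L = n"
    and "polyhedral_complex E L C"
    and "polyhedron E L (Supp C)"
    and "EE \<subseteq> adj_edges L n C"
  shows "(\<exists>C'. polyhedral_complex E L C' \<and> coarsens C' C \<and> edge_set L n C C' = EE) \<longleftrightarrow>
         polygon_property E L n C EE"
proof -
  interpret loopless E L using assms(1,2) by unfold_locales
  show ?thesis
  proof (cases "\<exists>T\<in>Supp C. tope T")
    case True
    then show ?thesis using full_complex_coarsening_iff assms(3-6) by blast
  next
    case False
    note deg = degenerate_complex[OF assms(4,5) False, unfolded assms(3)]
    \<comment> \<open>As \<open>EE\<close> is empty here, \<open>C\<close> itself serves as the
      coarsening.\<close>
    have "coarsens C C" unfolding coarsens_def by (metis cSup_singleton empty_subsetI insert_subset)
    moreover have "edge_set L n C C = EE" using deg(1) assms(6) by (auto simp: edge_set_def)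
    ultimately show ?thesis using assms(4) deg(2) by blast
  qed
qed

end
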